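(* Let $p_1,p_2,p_3\ge0$ with $|\mathbf p|=p_1+p_2+p_3\le1$, and let $\mathcal N_{\mathbf p}$ be the qubit Pauli channel \[ \mathcal N_{\mathbf p}(\rho)=(1-|\mathbf p|)\rho+p_1X\rho X+p_2Y\rho Y+p_3Z\rho Z. \] Then the private classical capacity of $\mathcal N_{\mathbf p}$ satisfies $C_p(\mathcal N_{\mathbf p})\le 1-H(|\mathbf p|)$.
   Context: $X,Y,Z$ are the Pauli matrices and $H(q)=-q\log_2q-(1-q)\log_2(1-q)$ is the binary entropy. Private classical capacity: for a channel $\mathcal N$ from $A$ to $B$ with isometric extension $U_{\mathcal N}:A\to B\otimes E$ ($\mathcal N(\rho)=\mathrm{Tr}_EU_{\mathcal N}\rho U_{\mathcal N}^\dagger$), an $(n,K)$ key code is $K$ states $\rho_x$ on $A^{\otimes n}$ and a decoding measurement $\mathcal D_n$ on $B^{\otimes n}$ with outcomes $\{1,\dots,K\}$; with $\rho_{XB^nE^n}=\frac1K\sum_x|x\rangle\langle x|\otimes U_{\mathcal N}^{\otimes n}\rho_x(U_{\mathcal N}^{\otimes n})^\dagger$, it is $\epsilon$-good if $\|(I\otimes\mathcal D_n\otimes I)(\rho_{XB^nE^n})-\frac1K\sum_x|x\rangle\langle x|\otimes|x\rangle\langle x|\otimes\rho_{E^n}\|_1<\epsilon$, $\rho_{E^n}$ the reduced state on $E^{\otimes n}$. A rate $R$ is achievable if for every $\epsilon>0$ and sufficiently large $n$ there is an $\epsilon$-good code $C_n$ for $\mathcal N^{\otimes n}$ with $\lim_n\frac{\log|C_n|}{n}\ge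 R$; $C_p(\mathcal N)$ is the supremum of achievable rates. *)

theory Defs
  imports "Jordan_Normal_Form.Char_Poly" "HOL-Library.Extended_Real" "HOL-Library.Liminf_Limsup"
begin

definition adj :: "complex mat \<Rightarrow> complex mat" where
  "adj A = mat (dim_col A) (dim_row A) (\<lambda>(i,j). cnj (A $$ (j,i)))"

text \<open>Kronecker (tensor) product; the first factor is the most significant index.\<close>
definition kron :: "complex mat \<Rightarrow> complex mat \<Rightarrow> complex mat" where
  "kron A B = mat (dim_row A * dim_row B) (dim_col A * dim_col B)
     (\<lambda>(i,j). A $$ (i div dim_row B, j div dim_col B) * B $$ (i mod dim_row B, j mod dim_col B))"

fun kron_pow :: "nat \<Rightarrow> complex mat \<Rightarrow> complex mat" where
  "kron_pow 0 A = 1\<^sub>m 1"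
| "kron_pow (Suc n) A = kron A (kron_pow n A)"

definition ptrace2 :: "nat \<Rightarrow> nat \<Rightarrow> complex mat \<Rightarrow> complex mat" where
  "ptrace2 d1 d2 M = mat d1 d1 (\<lambda>(i,j). \<Sum>k<d2. M $$ (i*d2+k, j*d2+k))"

definition ptrace1 :: "nat \<Rightarrow> nat \<Rightarrow> complex mat \<Rightarrow> complex mat" where
  "ptrace1 d1 d2 M = mat d2 d2 (\<lambda>(i,j). \<Sum>k<d1. M $$ (k*d2+i, k*d2+j))"

definition matsum :: "nat \<Rightarrow> nat \<Rightarrow> ('i \<Rightarrow> complex mat) \<Rightarrow> 'i set \<Rightarrow> complex mat" where
  "matsum nr nc f S = mat nr nc (\<lambda>ij. \<Sum>k\<in>S. f k $$ ij)"

definition proj :: "nat \<Rightarrow> nat \<Rightarrow> complex mat" where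
  "proj d x = mat d d (\<lambda>(i,j). if i = x \<and> j = x then 1 else 0)"

definition psd :: "nat \<Rightarrow> complex mat \<Rightarrow> bool" where
  "psd d A \<longleftrightarrow> A \<in> carrier_mat d d \<and>
     (\<forall>v \<in> carrier_vec d. let q = (\<Sum>i<d. cnj (v $ i) * (A *\<^sub>v v) $ i) in Im q = 0 \<and> Re q \<ge> 0)"

definition mtrace :: "complex mat \<Rightarrow> complex" where
  "mtrace A = (\<Sum>i<dim_row A. A $$ (i,i))"

definition density :: "nat \<Rightarrow> complex mat \<Rightarrow> bool" where
  "density d \<rho> \<longleftrightarrow> psd d \<rho> \<and> mtrace \<rho> = 1"

text \<open>Trace norm = sum of singular values, i.e. of the square roots of the eigenvalues of
  adj A * A counted with algebraic multiplicity.\<close>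
definition trace_norm :: "complex mat \<Rightarrow> real" where
  "trace_norm A = (let P = char_poly (adj A * A) in
     \<Sum>z\<in>{z. poly P z = 0}. real (order z P) * sqrt (Re z))"

definition pauliX :: "complex mat" where "pauliX = mat_of_rows_list 2 [[0,1],[1,0]]"
definition pauliY :: "complex mat" where "pauliY = mat_of_rows_list 2 [[0,-\<i>],[\<i>,0]]"
definition pauliZ :: "complex mat" where "pauliZ = mat_of_rows_list 2 [[1,0],[0,-1]]"

definition pauli_channel :: "real \<Rightarrow> real \<Rightarrow> real \<Rightarrow> complex mat \<Rightarrow> complex mat" where
  "pauli_channel p1 p2 p3 \<rho> =
     complex_of_real (1 - (p1+p2+p3)) \<cdot>\<^sub>m \<rho>
     + complex_of_real p1 \<cdot>\<^sub>m (pauliX * \<rho> * pauliX)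
     + complex_of_real p2 \<cdot>\<^sub>m (pauliY * \<rho> * pauliY)
     + complex_of_real p3 \<cdot>\<^sub>m (pauliZ * \<rho> * pauliZ)"

definition bin_entropy :: "real \<Rightarrow> real" where
  "bin_entropy q = - q * log 2 q - (1 - q) * log 2 (1 - q)"

definition isometric_extension ::
  "(complex mat \<Rightarrow> complex mat) \<Rightarrow> nat \<Rightarrow> nat \<Rightarrow> nat \<Rightarrow> complex mat \<Rightarrow> bool" where
  "isometric_extension N dA dB dE U \<longleftrightarrow>
     U \<in> carrier_mat (dB*dE) dA \<and> adj U * U = 1\<^sub>m dA \<and>
     (\<forall>\<rho> \<in> carrier_mat dA dA. ptrace2 dB dE (U * \<rho> * adj U) = N \<rho>)"

text \<open>Index bijection (B\<otimes>E)^n \<rightarrow> B^n \<otimes> E^n and the corresponding permutation matrix.\<close>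
definition reidx :: "nat \<Rightarrow> nat \<Rightarrow> nat \<Rightarrow> nat \<Rightarrow> nat" where
  "reidx n dB dE c =
     (\<Sum>i<n. (c div (dB*dE)^i mod (dB*dE)) div dE * dB^i) * dE^n
     + (\<Sum>i<n. (c div (dB*dE)^i mod (dB*dE)) mod dE * dE^i)"

definition reorder :: "nat \<Rightarrow> nat \<Rightarrow> nat \<Rightarrow> complex mat" where
  "reorder n dB dE = mat ((dB*dE)^n) ((dB*dE)^n) (\<lambda>(r,c). if r = reidx n dB dE c then 1 else 0)"

definition out_state :: "nat \<Rightarrow> nat \<Rightarrow> complex mat \<Rightarrow> nat \<Rightarrow> complex mat \<Rightarrow> complex mat" where
  "out_state dB dE U n \<rho> =
     (let P = reorder n dB dE; W = kron_pow n U in P * (W * \<rho> * adj W) * adj P)"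

text \<open>A code is (K, \<rho>, M): states \<rho> 0..K-1 on A^n and a POVM M 0..K-1 on B^n
  (messages/outcomes 1..K are relabelled 0..K-1).\<close>
type_synonym code = "nat \<times> (nat \<Rightarrow> complex mat) \<times> (nat \<Rightarrow> complex mat)"

definition is_key_code :: "nat \<Rightarrow> nat \<Rightarrow> nat \<Rightarrow> code \<Rightarrow> bool" where
  "is_key_code dA dB n C = (case C of (K, \<rho>, M) \<Rightarrow>
     K \<ge> 1 \<and> (\<forall>x<K. density (dA^n) (\<rho> x)) \<and> (\<forall>y<K. psd (dB^n) (M y)) \<and>
     matsum (dB^n) (dB^n) M {..<K} = 1\<^sub>m (dB^n))"

text \<open>(I \<otimes> D_n \<otimes> I)(\<rho>_{X B^n E^n}) on X \<otimes> Y \<otimes> E^n.\<close>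
definition measured_state :: "nat \<Rightarrow> nat \<Rightarrow> complex mat \<Rightarrow> nat \<Rightarrow> code \<Rightarrow> complex mat" where
  "measured_state dB dE U n C = (case C of (K, \<rho>, M) \<Rightarrow>
     matsum (K*(K*dE^n)) (K*(K*dE^n))
       (\<lambda>(x,y). complex_of_real (1 / real K) \<cdot>\<^sub>m
          kron (proj K x) (kron (proj K y)
            (ptrace1 (dB^n) (dE^n) (kron (M y) (1\<^sub>m (dE^n)) * out_state dB dE U n (\<rho> x)))))
       ({..<K} \<times> {..<K}))"

definition env_state :: "nat \<Rightarrow> nat \<Rightarrow> complex mat \<Rightarrow> nat \<Rightarrow> code \<Rightarrow> complex mat" where
  "env_state dB dE U n C = (case C of (K, \<rho>, M) \<Rightarrow>
     matsum (dE^n) (dE^n)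
       (\<lambda>x. complex_of_real (1 / real K) \<cdot>\<^sub>m ptrace1 (dB^n) (dE^n) (out_state dB dE U n (\<rho> x)))
       {..<K})"

definition ideal_state :: "nat \<Rightarrow> nat \<Rightarrow> complex mat \<Rightarrow> nat \<Rightarrow> code \<Rightarrow> complex mat" where
  "ideal_state dB dE U n C = (case C of (K, \<rho>, M) \<Rightarrow>
     matsum (K*(K*dE^n)) (K*(K*dE^n))
       (\<lambda>x. complex_of_real (1 / real K) \<cdot>\<^sub>m
          kron (proj K x) (kron (proj K x) (env_state dB dE U n C)))
       {..<K})"

definition good_code :: "nat \<Rightarrow> nat \<Rightarrow> nat \<Rightarrow> complex mat \<Rightarrow> nat \<Rightarrow> real \<Rightarrow> code \<Rightarrow> bool" where
  "good_code dA dB dE U n \<epsilon> C \<longleftrightarrow>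
     is_key_code dA dB n C \<and>
     trace_norm (measured_state dB dE U n C - ideal_state dB dE U n C) < \<epsilon>"

definition achievable_private_rate :: "nat \<Rightarrow> nat \<Rightarrow> nat \<Rightarrow> complex mat \<Rightarrow> real \<Rightarrow> bool" where
  "achievable_private_rate dA dB dE U R \<longleftrightarrow>
     (\<forall>\<epsilon>>0. \<exists>C :: nat \<Rightarrow> code.
        (\<exists>N. \<forall>n\<ge>N. good_code dA dB dE U n \<epsilon> (C n)) \<and>
        liminf (\<lambda>n. ereal (log 2 (real (fst (C n))) / real n)) \<ge> ereal R)"

definition private_capacity :: "nat \<Rightarrow> nat \<Rightarrow> nat \<Rightarrow> complex mat \<Rightarrow> ereal" where
  "private_capacity dA dB dE U = Sup {ereal R | R. achievable_private_rate dA dB dE U R}"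

end

theory Submission
  imports Defs "Jordan_Normal_Form.Schur_Decomposition" "HOL-Analysis.Convex"
begin

text \<open>
  The argument is a one-shot comparison with an entanglement-breaking channel and uses no entropies
  of quantum states. Put \<open>q = p1 + p2 + p3\<close>. On \<open>n\<close> qubits the channel is a mixture of Pauli strings with the
  product weights \<open>P = (1 - q, p1, p2, p3)\<close>. The product weights \<open>Q = (1/2, p1/(2q), p2/(2q), p3/(2q))\<close> give
  instead the channel that measures each qubit in a random Pauli eigenbasis and prepares the
  outcome. A code that is private up to \<open>\<epsilon>\<close> yields a positive functional of the channel (a privacy test)
  whose value is at least \<open>(1 - \<epsilon>)\<^sup>2\<close> on the given channel, at most 1 on every unitary and at most \<open>1/K\<close> on the
  measure-and-prepare channel. Since the log-likelihood ratio of \<open>P\<close> against \<open>Q\<close> concentrates at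
  \<open>n (1 - H(q))\<close>, the key size \<open>K\<close> cannot grow faster than \<open>2\<close> to the power \<open>n (1 - H(q))\<close>.
\<close>

section \<open>Spectral theory of matrices and the trace norm\<close>

text \<open>The weight 1/2 on the identity is what makes the comparison channel
  entanglement-breaking: (\<rho> + \<sigma> \<rho> \<sigma>) / 2 is the dephasing of \<rho> in the
  eigenbasis of the Pauli matrix \<sigma>, so its Kraus operators can be chosen of rank one. Sharing
  the other half in proportion to p1, p2, p3 makes the likelihood ratio depend only on whether an
  error occurred: it is 2 (1 - q) or 2 q. Its logarithm has mean (1 - H(q)) ln 2 under
  \<open>P\<close>, and this is how the entropy of q alone appears. The obstacle is that privacy
  speaks of one fixed environment, while the comparison changes the channel. Privacy is therefore
  used once, to build contractions that stay fixed afterwards. What remains is a quadratic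
  expression in each Kraus operator whose sum over a Kraus family depends only on the Choi matrix,
  so the environment Kraus operators may be exchanged for Pauli strings, and Pauli strings for
  rank-one operators. The square in (1 - \<epsilon>)^2 arises because the alignment bounds an
  amplitude from below.\<close>

lemma adj_dim [simp]: "dim_row (adj A) = dim_col A" "dim_col (adj A) = dim_row A"
  by (simp_all add: adj_def)

lemma adj_index [simp]: "i < dim_col A \<Longrightarrow> j < dim_row A \<Longrightarrow> adj A $$ (i, j) = cnj (A $$ (j, i))"
  by (simp add: adj_def)

lemma adj_carrier [simp]: "A \<in> carrier_mat n m \<Longrightarrow> adj A \<in> carrier_mat m n"
  by (auto simp: adj_def)

lemma adj_adj [simp]: "adj (adj A) = A"
  by (rule eq_matI) auto

lemma mat_mult_index: "A \<in> carrier_mat n m \<Longrightarrow> B \<in> carrier_mat m k \<Longrightarrow> i < n \<Longrightarrow> j < k \<Longrightarrow>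
    (A * B) $$ (i, j) = (\<Sum>l<m. A $$ (i, l) * B $$ (l, j))"
  by (auto simp: scalar_prod_def atLeast0LessThan intro!: sum.cong)

lemma adj_mult: "A \<in> carrier_mat n m \<Longrightarrow> B \<in> carrier_mat m k \<Longrightarrow> adj (A * B) = adj B * adj A"
  by (rule eq_matI) (auto simp: scalar_prod_def intro!: sum.cong)

text \<open>Gram-Schmidt applied to a basis completion of \<open>v\<close> keeps \<open>v\<close> as
  its first vector. Dividing by the lengths \<open>s\<close> makes the family orthonormal, which is
  why the first column is \<open>v\<close> only up to the scalar \<open>c\<close>.\<close>

lemma unitary_with_first_column:
  fixes v :: "complex vec"
  assumes v: "v \<in> carrier_vec n" and v0: "v \<noteq> 0\<^sub>v n"
  obtains W c where "W \<in> carrier_mat n n" "adj W * W = 1\<^sub>m n" "col W 0 = c \<cdot>\<^sub>v v"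
proof -
  interpret cof_vec_space n "TYPE(complex)" .
  have n: "n \<noteq> 0" using v v0 by auto
  define b where "b = basis_completion v"
  from basis_completion[OF v v0, folded b_def]
  have span_b: "span (set b) = carrier_vec n" and dist_b: "distinct b"
    and indep: "\<not> lin_dep (set b)" and b: "set b \<subseteq> carrier_vec n" and hdb: "hd b = v"
    and len_b: "length b = n" by auto
  define ws where "ws = gram_schmidt n b"
  from hdb len_b n obtain vs where bv: "b = v # vs" by (cases b) auto
  from gram_schmidt_result[OF b dist_b indep refl, folded ws_def]
  have ws: "set ws \<subseteq> carrier_vec n" "corthogonal ws" "length ws = n"
    by (auto simp: len_b)
  have ws0: "ws ! 0 = v"
    using gram_schmidt_hd[OF v, of vs, folded bv] ws(3) n unfolding ws_def by (metis hd_conv_nth list.size(3))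
  have wsc: "ws ! i \<in> carrier_vec n" if "i < n" for i
    using ws that by (meson nth_mem subsetD)
  have ip: "(\<Sum>k<n. cnj (ws ! i $ k) * ws ! j $ k) = ws ! j \<bullet>c ws ! i" if "i < n" "j < n" for i j
    using wsc[OF that(1)] wsc[OF that(2)]
    by (auto simp: scalar_prod_def atLeast0LessThan mult.commute intro!: sum.cong)
  have orth: "(\<Sum>k<n. cnj (ws ! i $ k) * ws ! j $ k) = 0 \<longleftrightarrow> i \<noteq> j" if "i < n" "j < n" for i j
    using corthogonalD[OF ws(2), of j i] ip that ws(3) by auto
  define s where "s j = sqrt (\<Sum>k<n. (cmod (ws ! j $ k))\<^sup>2)" for j
  have diag: "(\<Sum>k<n. cnj (ws ! j $ k) * ws ! j $ k) = of_real ((s j)\<^sup>2)" for j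
    by (simp add: s_def sum_nonneg mult.commute complex_norm_square[symmetric])
  have s0: "s j \<noteq> 0" if "j < n" for j
    using orth[OF that that] diag[of j] by auto
  define W where "W = mat n n (\<lambda>(i,j). ws ! j $ i / of_real (s j))"
  have Wc: "W \<in> carrier_mat n n" by (simp add: W_def)
  have "adj W * W = 1\<^sub>m n"
  proof (rule eq_matI)
    fix i j assume "i < dim_row (1\<^sub>m n)" "j < dim_col (1\<^sub>m n :: complex mat)"
    hence ij: "i < n" "j < n" by auto
    have "(adj W * W) $$ (i,j) = (\<Sum>k<n. cnj (ws ! i $ k) * ws ! j $ k) / (of_real (s i) * of_real (s j))"
      using ij Wc by (subst mat_mult_index[of _ n n _ n])
        (auto simp: W_def sum_divide_distrib intro!: sum.cong)
    also have "\<dots> = (if i = j then 1 else 0)"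
      using orth[OF ij] diag[of i] s0[OF ij(1)] by (auto simp: power2_eq_square)
    finally show "(adj W * W) $$ (i,j) = 1\<^sub>m n $$ (i,j)" using ij by simp
  qed (auto simp: W_def)
  moreover have "col W 0 = (1 / of_real (s 0)) \<cdot>\<^sub>v v"
    using n v by (intro eq_vecI) (auto simp: W_def ws0)
  ultimately show ?thesis using that Wc by blast
qed

text \<open>Induction on the dimension: conjugating with a unitary whose first column is an
  eigenvector clears the first column below the corner, and Hermitian symmetry then clears the first
  row. The remaining block \<open>A3\<close> is again Hermitian.\<close>

lemma hermitian_unitary_diag:
  assumes "H \<in> carrier_mat n n" "adj H = H"
  shows "\<exists>V\<in>carrier_mat n n. adj V * V = 1\<^sub>m n \<and> diagonal_mat (adj V * H * V)"
  using assms
proof (induction n arbitrary: H)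
  case 0
  then show ?case by (intro bexI[of _ "1\<^sub>m 0"]) (auto simp: diagonal_mat_def)
next
  case (Suc m)
  let ?n = "Suc m"
  note H = Suc.prems(1) and herm = Suc.prems(2)
  obtain es where es: "char_poly H = (\<Prod>a\<leftarrow>es. [:- a, 1:])" "length es = ?n"
    using char_poly_factorized[OF H] by blast
  then obtain e es' where ees: "es = e # es'" by (cases es) auto
  have "poly (char_poly H) e = 0" unfolding es(1) ees by simp
  hence "eigenvalue H e" using eigenvalue_root_char_poly[OF H] by simp
  then obtain v where v: "v \<in> carrier_vec ?n" "v \<noteq> 0\<^sub>v ?n" and Hv: "H *\<^sub>v v = e \<cdot>\<^sub>v v"
    using H unfolding eigenvalue_def eigenvector_def by auto
  obtain W c where W: "W \<in> carrier_mat ?n ?n" "adj W * W = 1\<^sub>m ?n" and W0: "col W 0 = c \<cdot>\<^sub>v v"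
    using unitary_with_first_column[OF v] by blast
  define A where "A = adj W * H * W"
  have A: "A \<in> carrier_mat ?n ?n" using W H by (auto simp: A_def)
  have Aherm: "adj A = A"
    using W H herm unfolding A_def
    by (simp add: adj_mult[of _ ?n ?n _ ?n] assoc_mult_mat[of _ ?n ?n _ ?n _ ?n])
  have cj: "A $$ (j, i) = cnj (A $$ (i, j))" if "i < ?n" "j < ?n" for i j
    using arg_cong[OF Aherm, of "\<lambda>M. M $$ (j, i)"] A that by simp
  have "col A 0 = (adj W * H) *\<^sub>v col W 0"
    using W H unfolding A_def by (intro col_mult2[of _ ?n ?n _ ?n]) auto
  also have "\<dots> = e \<cdot>\<^sub>v (adj W *\<^sub>v col W 0)"
    using W H v unfolding W0
    by (subst assoc_mult_mat_vec[of _ ?n ?n _ ?n]) (auto simp: Hv smult_smult_assoc mult.commute mult_mat_vec[of _ ?n ?n])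
  also have "adj W *\<^sub>v col W 0 = col (adj W * W) 0"
    using W by (intro col_mult2[symmetric, of _ ?n ?n _ ?n]) auto
  finally have colA: "col A 0 = e \<cdot>\<^sub>v col (1\<^sub>m ?n) 0" using W by simp
  have A0: "A $$ (i, 0) = (if i = 0 then e else 0)" if "i < ?n" for i
    using arg_cong[OF colA, of "\<lambda>v. v $ i"] A that by auto
  have A0': "A $$ (0, i) = 0" if "i < ?n" "i \<noteq> 0" for i
    using cj[of i 0] A0[of i] that by simp
  define A3 where "A3 = mat m m (\<lambda>(i,j). A $$ (Suc i, Suc j))"
  have A3: "A3 \<in> carrier_mat m m" by (simp add: A3_def)
  have "adj A3 = A3"
    by (rule eq_matI) (auto simp: A3_def cj[symmetric])
  from Suc.IH[OF A3 this] obtain V where V: "V \<in> carrier_mat m m" "adj V * V = 1\<^sub>m m"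
    and dV: "diagonal_mat (adj V * A3 * V)" by blast
  define F where "F = four_block_mat (1\<^sub>m 1) (0\<^sub>m 1 m) (0\<^sub>m m 1) V"
  define E where "E = mat 1 1 (\<lambda>_. e)"
  have E: "E \<in> carrier_mat 1 1" by (simp add: E_def)
  have F: "F \<in> carrier_mat ?n ?n" using V by (auto simp: F_def)
  have adjF: "adj F = four_block_mat (1\<^sub>m 1) (0\<^sub>m 1 m) (0\<^sub>m m 1) (adj V)"
    by (rule eq_matI) (use V in \<open>auto simp: F_def\<close>)
  have Ablock: "A = four_block_mat E (0\<^sub>m 1 m) (0\<^sub>m m 1) A3"
    by (rule eq_matI) (use A in \<open>auto simp: E_def A3_def A0 A0'\<close>)
  have FF: "adj F * F = 1\<^sub>m ?n"
  proof -
    have "adj F * F = four_block_mat (1\<^sub>m 1) (0\<^sub>m 1 m) (0\<^sub>m m 1) (1\<^sub>m m)"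
      unfolding adjF unfolding F_def using V by (subst mult_four_block_mat[of _ 1 1 _ m _ m _ _ 1 _ m]) auto
    thus ?thesis by simp
  qed
  have diag: "adj F * A * F = four_block_mat E (0\<^sub>m 1 m) (0\<^sub>m m 1) (adj V * A3 * V)"
  proof -
    have VA3: "adj V * A3 \<in> carrier_mat m m" using V A3 by auto
    have "adj F * A = four_block_mat E (0\<^sub>m 1 m) (0\<^sub>m m 1) (adj V * A3)"
      unfolding Ablock adjF using V A3 E VA3
      by (subst mult_four_block_mat[of _ 1 1 _ m _ m _ _ 1 _ m]) (auto simp: left_add_zero_mat[of _ m m])
    moreover have "four_block_mat E (0\<^sub>m 1 m) (0\<^sub>m m 1) (adj V * A3) * F
        = four_block_mat E (0\<^sub>m 1 m) (0\<^sub>m m 1) (adj V * A3 * V)"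
      unfolding F_def using V A3 E VA3 mult_carrier_mat[OF VA3 V(1)]
      by (subst mult_four_block_mat[of _ 1 1 _ m _ m _ _ 1 _ m]) (auto simp: left_add_zero_mat[of _ m m])
    ultimately show ?thesis by simp
  qed
  have "diagonal_mat (adj F * A * F)"
    unfolding diag using dV V A3 by (auto simp: diagonal_mat_def E_def)
  moreover have "adj (W * F) * H * (W * F) = adj F * A * F"
    using W F H by (simp add: A_def mult_carrier_mat[of _ ?n ?n _ ?n] adj_mult[of _ ?n ?n _ ?n] assoc_mult_mat[of _ ?n ?n _ ?n _ ?n])
  moreover have "adj (W * F) * (W * F) = 1\<^sub>m ?n"
  proof -
    have "adj (W * F) * (W * F) = adj F * (adj W * W) * F"
      using W(1) F by (simp add: mult_carrier_mat[of _ ?n ?n _ ?n] adj_mult[of _ ?n ?n _ ?n] assoc_mult_mat[of _ ?n ?n _ ?n _ ?n])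
    also have "\<dots> = 1\<^sub>m ?n" unfolding W(2) using F FF by simp
    finally show ?thesis .
  qed
  ultimately show ?case using W F by (intro bexI[of _ "W * F"]) auto
qed

definition orthonormal :: "'a set \<Rightarrow> 'b set \<Rightarrow> ('b \<Rightarrow> 'a \<Rightarrow> complex) \<Rightarrow> bool" where
  "orthonormal I J g \<longleftrightarrow> (\<forall>k\<in>J. \<forall>l\<in>J. (\<Sum>i\<in>I. cnj (g k i) * g l i) = (if k = l then 1 else 0))"

lemma orthonormalD: "orthonormal I J g \<Longrightarrow> k \<in> J \<Longrightarrow> l \<in> J \<Longrightarrow>
    (\<Sum>i\<in>I. cnj (g k i) * g l i) = (if k = l then 1 else 0)"
  by (simp add: orthonormal_def)

text \<open>The diagonalisation in coordinates, with \<open>u k\<close> the k-th eigenvector. The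
  factorised characteristic polynomial is recorded because \<open>trace_norm\<close> reads the
  singular values off its roots and their orders.\<close>

lemma spectral_decomposition:
  fixes h :: "nat \<Rightarrow> nat \<Rightarrow> complex"
  assumes herm: "\<And>i j. i < n \<Longrightarrow> j < n \<Longrightarrow> h j i = cnj (h i j)"
  obtains u and \<mu> :: "nat \<Rightarrow> real" where "orthonormal {..<n} {..<n} u"
    "\<And>i j. i < n \<Longrightarrow> j < n \<Longrightarrow> (\<Sum>k<n. u k i * cnj (u k j)) = (if i = j then 1 else 0)"
    "\<And>i j. i < n \<Longrightarrow> j < n \<Longrightarrow> h i j = (\<Sum>k<n. of_real (\<mu> k) * u k i * cnj (u k j))"
    "char_poly (mat n n (\<lambda>(i,j). h i j)) = (\<Prod>k<n. [:- of_real (\<mu> k), 1:])"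
proof -
  define H where "H = mat n n (\<lambda>(i,j). h i j)"
  have H: "H \<in> carrier_mat n n" by (simp add: H_def)
  have adjH: "adj H = H"
  proof (rule eq_matI)
    fix i j assume "i < dim_row H" "j < dim_col H"
    hence ij: "i < n" "j < n" by (simp_all add: H_def)
    show "adj H $$ (i, j) = H $$ (i, j)" using ij herm[OF ij(2) ij(1)] by (simp add: H_def)
  qed (simp_all add: H_def)
  obtain V where V: "V \<in> carrier_mat n n" "adj V * V = 1\<^sub>m n" and dV: "diagonal_mat (adj V * H * V)"
    using hermitian_unitary_diag[OF H adjH] by blast
  define B where "B = adj V * H * V"
  have B: "B \<in> carrier_mat n n" using V H by (auto simp: B_def)
  have VV: "V * adj V = 1\<^sub>m n"
    using mat_mult_left_right_inverse[of "adj V" n V] V by simp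
  have HB: "H = V * B * adj V"
  proof -
    have "V * B * adj V = (V * adj V) * H * (V * adj V)"
      using V(1) H by (simp add: B_def mult_carrier_mat[of _ n n _ n] assoc_mult_mat[of _ n n _ n _ n])
    thus ?thesis using H by (simp add: VV)
  qed
  have adjB: "adj B = B"
    using V H adjH unfolding B_def by (simp add: mult_carrier_mat[of _ n n _ n] adj_mult[of _ n n _ n] assoc_mult_mat[of _ n n _ n _ n])
  define \<mu> where "\<mu> k = Re (B $$ (k,k))" for k
  have diag: "B $$ (i,j) = (if i = j then of_real (\<mu> i) else 0)" if "i < n" "j < n" for i j
  proof (cases "i = j")
    case True
    have "B $$ (i,i) = cnj (B $$ (i,i))"
      using arg_cong[OF adjB, of "\<lambda>M. M $$ (i,i)"] that B by simp
    thus ?thesis using True by (auto simp: \<mu>_def complex_eq_iff)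
  next
    case False
    thus ?thesis using dV that B unfolding diagonal_mat_def B_def by auto
  qed
  define u where "u k i = V $$ (i,k)" for k i
  show ?thesis
  proof (rule that[of u \<mu>])
    show "orthonormal {..<n} {..<n} u"
      unfolding orthonormal_def
    proof (intro ballI)
      fix k l assume kl: "k \<in> {..<n}" "l \<in> {..<n}"
      have "(adj V * V) $$ (k,l) = (\<Sum>i<n. cnj (u k i) * u l i)"
        using kl V(1) by (subst mat_mult_index[of _ n n _ n]) (auto simp: u_def)
      thus "(\<Sum>i<n. cnj (u k i) * u l i) = (if k = l then 1 else 0)" using kl V by simp
    qed
    fix i j assume ij: "i < n" "j < n"
    have "(V * adj V) $$ (i,j) = (\<Sum>k<n. u k i * cnj (u k j))"
      using ij V(1) by (subst mat_mult_index[of _ n n _ n]) (auto simp: u_def)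
    thus "(\<Sum>k<n. u k i * cnj (u k j)) = (if i = j then 1 else 0)" using ij VV by simp
    have VB: "(V * B) $$ (i,k) = u k i * of_real (\<mu> k)" if "k < n" for k
      using ij V B that by (subst mat_mult_index[of _ n n _ n]) (auto simp: u_def diag if_distrib cong: if_cong)
    have "H $$ (i,j) = (\<Sum>k<n. of_real (\<mu> k) * u k i * cnj (u k j))"
      unfolding HB using ij V(1) B
      by (subst mat_mult_index[of _ n n _ n]) (auto simp: VB u_def intro!: sum.cong simp del: index_mult_mat(1))
    thus "h i j = (\<Sum>k<n. of_real (\<mu> k) * u k i * cnj (u k j))" using ij by (simp add: H_def)
  next
    have "similar_mat H B"
      using similar_mat_witI[OF VV V(2) HB H B V(1)] V(1) unfolding similar_mat_def by auto
    hence "char_poly H = char_poly B" by (rule char_poly_similar)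
    also have "\<dots> = (\<Prod>a\<leftarrow>diag_mat B. [:- a, 1:])"
      using B by (intro char_poly_upper_triangular[of _ n]) (auto simp: diag)
    also have "\<dots> = (\<Prod>k<n. [:- of_real (\<mu> k), 1:])"
      using B by (simp add: diag_mat_def prod.list_conv_set_nth atLeast0LessThan diag o_def)
    finally show "char_poly (mat n n (\<lambda>(i,j). h i j)) = (\<Prod>k<n. [:- of_real (\<mu> k), 1:])"
      by (simp add: H_def)
  qed
qed

text \<open>\<open>trace_norm\<close> sums over distinct roots weighted by their order, whereas a
  list of eigenvalues repeats them. Grouping the indices by the value of \<open>c k\<close> matches
  the two.\<close>

lemma sum_roots_order:
  fixes c :: "nat \<Rightarrow> complex" and f :: "complex \<Rightarrow> real" and n :: nat
  defines "P \<equiv> (\<Prod>k<n. [:- c k, 1:])"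
  shows "(\<Sum>z\<in>{z. poly P z = 0}. real (Polynomial.order z P) * f z) = (\<Sum>k<n. f (c k))"
proof -
  have nz: "(\<Prod>k<m. [:- c k, 1:]) \<noteq> 0" for m by simp
  have lin: "Polynomial.order z [:- a, 1:] = (if z = a then 1 else 0)" for z a :: complex
    using order_power_n_n[of a 1] by (auto intro!: order_0I)
  have ord: "Polynomial.order z (\<Prod>k<m. [:- c k, 1:]) = card {k. k < m \<and> c k = z}" for z m
  proof (induction m)
    case (Suc m)
    have "{k. k < Suc m \<and> c k = z} = {k. k < m \<and> c k = z} \<union> (if c m = z then {m} else {})"
      by (auto simp: less_Suc_eq)
    moreover have "Polynomial.order z (\<Prod>k<Suc m. [:- c k, 1:])
        = Polynomial.order z (\<Prod>k<m. [:- c k, 1:]) + Polynomial.order z [:- c m, 1:]"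
      unfolding prod.lessThan_Suc by (rule order_mult) (metis nz prod.lessThan_Suc)
    ultimately show ?case
      using Suc by (simp add: lin del: prod.lessThan_Suc)
  qed simp
  have roots: "{z. poly P z = 0} = c ` {..<n}"
    by (auto simp: P_def poly_prod)
  have "(\<Sum>k<n. f (c k)) = (\<Sum>z\<in>c ` {..<n}. \<Sum>k\<in>{k\<in>{..<n}. c k = z}. f (c k))"
    by (rule sum.image_gen) simp
  also have "\<dots> = (\<Sum>z\<in>c ` {..<n}. real (Polynomial.order z P) * f z)"
    unfolding P_def ord by (intro sum.cong refl) (simp add: lessThan_def)
  finally show ?thesis unfolding roots by simp
qed

section \<open>Orthonormal families: Parseval and Bessel\<close>

lemma Cauchy_Schwarz_cmod:
  fixes f g :: "'a \<Rightarrow> complex"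
  shows "(cmod (\<Sum>i\<in>I. f i * g i))\<^sup>2 \<le> (\<Sum>i\<in>I. (cmod (f i))\<^sup>2) * (\<Sum>i\<in>I. (cmod (g i))\<^sup>2)"
proof -
  have "cmod (\<Sum>i\<in>I. f i * g i) \<le> (\<Sum>i\<in>I. cmod (f i) * cmod (g i))"
    by (rule order_trans[OF norm_sum]) (simp add: norm_mult)
  hence "(cmod (\<Sum>i\<in>I. f i * g i))\<^sup>2 \<le> (\<Sum>i\<in>I. cmod (f i) * cmod (g i))\<^sup>2"
    by (rule power_mono) simp
  also have "\<dots> \<le> (\<Sum>i\<in>I. (cmod (f i))\<^sup>2) * (\<Sum>i\<in>I. (cmod (g i))\<^sup>2)"
    by (rule Cauchy_Schwarz_ineq_sum)
  finally show ?thesis .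
qed

lemma sum_mult_delta:
  fixes f :: "'a \<Rightarrow> complex"
  assumes "finite A"
  shows "(\<Sum>k\<in>A. f k * (if k = i then 1 else 0)) = (if i \<in> A then f i else 0)"
    and "(\<Sum>k\<in>A. f k * (if i = k then 1 else 0)) = (if i \<in> A then f i else 0)"
  using assms by (simp_all add: if_distrib cong: if_cong)

lemma sum_rotate3:
  "(\<Sum>i\<in>A. \<Sum>j\<in>B. \<Sum>k\<in>C. f i j k) = (\<Sum>k\<in>C. \<Sum>i\<in>A. \<Sum>j\<in>B. f i j k)"
proof -
  have "(\<Sum>i\<in>A. \<Sum>j\<in>B. \<Sum>k\<in>C. f i j k) = (\<Sum>i\<in>A. \<Sum>k\<in>C. \<Sum>j\<in>B. f i j k)"
    by (intro sum.cong refl sum.swap)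
  also have "\<dots> = (\<Sum>k\<in>C. \<Sum>i\<in>A. \<Sum>j\<in>B. f i j k)" by (rule sum.swap)
  finally show ?thesis .
qed

lemma norm_sq_linear_combination:
  fixes c :: "'k \<Rightarrow> complex"
  shows "of_real (\<Sum>i\<in>I. (cmod (\<Sum>k\<in>K. c k * g k i))\<^sup>2)
    = (\<Sum>k\<in>K. \<Sum>l\<in>K. c k * cnj (c l) * (\<Sum>i\<in>I. cnj (g l i) * g k i))"
proof -
  have "of_real (\<Sum>i\<in>I. (cmod (\<Sum>k\<in>K. c k * g k i))\<^sup>2)
      = (\<Sum>i\<in>I. \<Sum>k\<in>K. \<Sum>l\<in>K. c k * cnj (c l) * (cnj (g l i) * g k i))"
    by (simp only: of_real_sum complex_norm_square cnj_sum complex_cnj_mult sum_product)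
      (simp add: mult_ac)
  also have "\<dots> = (\<Sum>k\<in>K. \<Sum>l\<in>K. \<Sum>i\<in>I. c k * cnj (c l) * (cnj (g l i) * g k i))"
    by (subst sum.swap) (intro sum.cong refl sum.swap)
  finally show ?thesis by (simp only: sum_distrib_left)
qed

lemma parseval:
  assumes "finite K" "orthonormal I K g"
  shows "(\<Sum>i\<in>I. (cmod (\<Sum>k\<in>K. c k * g k i))\<^sup>2) = (\<Sum>k\<in>K. (cmod (c k))\<^sup>2)"
proof -
  have "complex_of_real (\<Sum>i\<in>I. (cmod (\<Sum>k\<in>K. c k * g k i))\<^sup>2) = (\<Sum>k\<in>K. c k * cnj (c k))"
    unfolding norm_sq_linear_combination using assms
    by (intro sum.cong refl) (simp add: orthonormalD if_distrib cong: if_cong sum.cong)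
  also have "\<dots> = complex_of_real (\<Sum>k\<in>K. (cmod (c k))\<^sup>2)"
    by (simp add: complex_norm_square[symmetric])
  finally show ?thesis using of_real_eq_iff by blast
qed

text \<open>If S is the squared norm of the coefficients, the inner product of the projected vector
  with \<open>v\<close> is S, and the projected vector has squared norm S by
  \<open>parseval\<close>. Cauchy-Schwarz then gives S^2 \<le> S |v|^2. The family need not
  span.\<close>

lemma bessel:
  assumes "finite K" "orthonormal I K g"
  shows "(\<Sum>k\<in>K. (cmod (\<Sum>i\<in>I. cnj (g k i) * v i))\<^sup>2) \<le> (\<Sum>i\<in>I. (cmod (v i))\<^sup>2)"
proof -
  define c where "c k = (\<Sum>i\<in>I. cnj (g k i) * v i)" for k
  define S where "S = (\<Sum>k\<in>K. (cmod (c k))\<^sup>2)"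
  have S0: "0 \<le> S" by (simp add: S_def sum_nonneg)
  have "(\<Sum>i\<in>I. cnj (\<Sum>k\<in>K. c k * g k i) * v i) = (\<Sum>k\<in>K. cnj (c k) * c k)"
  proof -
    have "(\<Sum>i\<in>I. cnj (\<Sum>k\<in>K. c k * g k i) * v i) = (\<Sum>i\<in>I. \<Sum>k\<in>K. cnj (c k) * (cnj (g k i) * v i))"
      by (simp add: sum_distrib_left sum_distrib_right mult_ac)
    also have "\<dots> = (\<Sum>k\<in>K. cnj (c k) * c k)"
      by (subst sum.swap) (simp only: c_def sum_distrib_left)
    finally show ?thesis .
  qed
  also have "\<dots> = of_real S"
    by (simp add: S_def mult.commute complex_norm_square[symmetric])
  finally have "S\<^sup>2 = (cmod (\<Sum>i\<in>I. cnj (\<Sum>k\<in>K. c k * g k i) * v i))\<^sup>2" using S0 by simp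
  also have "\<dots> \<le> (\<Sum>i\<in>I. (cmod (cnj (\<Sum>k\<in>K. c k * g k i)))\<^sup>2) * (\<Sum>i\<in>I. (cmod (v i))\<^sup>2)"
    by (rule Cauchy_Schwarz_cmod)
  also have "(\<Sum>i\<in>I. (cmod (cnj (\<Sum>k\<in>K. c k * g k i)))\<^sup>2) = S"
    unfolding complex_mod_cnj parseval[OF assms] S_def ..
  finally have "S * S \<le> S * (\<Sum>i\<in>I. (cmod (v i))\<^sup>2)" by (simp add: power2_eq_square)
  hence "S \<le> (\<Sum>i\<in>I. (cmod (v i))\<^sup>2)"
    using S0 by (cases "S = 0") (auto simp: sum_nonneg)
  thus ?thesis unfolding S_def c_def .
qed

text \<open>Diagonalising the Gram matrix of the columns of \<open>G\<close> yields right singular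
  vectors \<open>u k\<close> and squared singular values \<open>\<mu> k\<close>: the images of the
  \<open>u k\<close> are orthogonal with squared lengths \<open>\<mu> k\<close>. The row index has
  an arbitrary type because rows will later be pairs and triples.\<close>

lemma singular_value_decomposition:
  fixes G :: "'j \<Rightarrow> nat \<Rightarrow> complex"
  obtains u and \<mu> :: "nat \<Rightarrow> real" where "orthonormal {..<D} {..<D} u"
    "\<And>i j. i < D \<Longrightarrow> j < D \<Longrightarrow> (\<Sum>k<D. u k i * cnj (u k j)) = (if i = j then 1 else 0)"
    "\<And>i j. i < D \<Longrightarrow> j < D \<Longrightarrow>
        (\<Sum>x\<in>J. cnj (G x i) * G x j) = (\<Sum>k<D. of_real (\<mu> k) * u k i * cnj (u k j))"
    "char_poly (mat D D (\<lambda>(i,j). \<Sum>x\<in>J. cnj (G x i) * G x j)) = (\<Prod>k<D. [:- of_real (\<mu> k), 1:])"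
    "\<And>k l. k < D \<Longrightarrow> l < D \<Longrightarrow> (\<Sum>x\<in>J. cnj (\<Sum>i<D. G x i * u k i) * (\<Sum>i<D. G x i * u l i))
        = (if k = l then of_real (\<mu> k) else 0)"
    "\<And>k. k < D \<Longrightarrow> (\<Sum>x\<in>J. (cmod (\<Sum>i<D. G x i * u k i))\<^sup>2) = \<mu> k"
    "\<And>k. k < D \<Longrightarrow> 0 \<le> \<mu> k"
proof -
  define h where "h i j = (\<Sum>x\<in>J. cnj (G x i) * G x j)" for i j
  have herm: "h j i = cnj (h i j)" for i j by (simp add: h_def mult.commute)
  obtain u \<mu> where on: "orthonormal {..<D} {..<D} u"
    and compl: "\<And>i j. i < D \<Longrightarrow> j < D \<Longrightarrow> (\<Sum>k<D. u k i * cnj (u k j)) = (if i = j then 1 else 0)"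
    and dec: "\<And>i j. i < D \<Longrightarrow> j < D \<Longrightarrow> h i j = (\<Sum>k<D. of_real (\<mu> k) * u k i * cnj (u k j))"
    and cp: "char_poly (mat D D (\<lambda>(i,j). h i j)) = (\<Prod>k<D. [:- of_real (\<mu> k), 1:])"
    using spectral_decomposition[of D h] herm by blast
  have hu: "(\<Sum>j<D. h i j * u l j) = of_real (\<mu> l) * u l i" if "i < D" "l < D" for i l
  proof -
    have "(\<Sum>j<D. h i j * u l j) = (\<Sum>j<D. \<Sum>k<D. of_real (\<mu> k) * u k i * (cnj (u k j) * u l j))"
      using that by (simp add: dec sum_distrib_right mult.assoc)
    also have "\<dots> = (\<Sum>k<D. of_real (\<mu> k) * u k i * (\<Sum>j<D. cnj (u k j) * u l j))"
      by (subst sum.swap) (simp only: sum_distrib_left)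
    also have "\<dots> = (\<Sum>k<D. of_real (\<mu> k) * u k i * (if k = l then 1 else 0))"
      using that by (intro sum.cong refl) (simp add: orthonormalD[OF on])
    also have "\<dots> = of_real (\<mu> l) * u l i"
      using that by (simp add: sum_mult_delta)
    finally show ?thesis .
  qed
  have orth: "(\<Sum>x\<in>J. cnj (\<Sum>i<D. G x i * u k i) * (\<Sum>i<D. G x i * u l i))
        = (if k = l then of_real (\<mu> k) else 0)" if "k < D" "l < D" for k l
  proof -
    have "(\<Sum>x\<in>J. cnj (\<Sum>i<D. G x i * u k i) * (\<Sum>i<D. G x i * u l i))
        = (\<Sum>x\<in>J. \<Sum>i<D. \<Sum>j<D. cnj (u k i) * u l j * (cnj (G x i) * G x j))"
      by (simp only: cnj_sum complex_cnj_mult sum_product) (simp add: mult_ac)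
    also have "\<dots> = (\<Sum>i<D. \<Sum>j<D. \<Sum>x\<in>J. cnj (u k i) * u l j * (cnj (G x i) * G x j))"
      by (subst sum.swap) (intro sum.cong refl sum.swap)
    also have "\<dots> = (\<Sum>i<D. cnj (u k i) * (\<Sum>j<D. h i j * u l j))"
      by (simp add: h_def sum_distrib_left sum_distrib_right mult_ac)
    also have "\<dots> = of_real (\<mu> l) * (\<Sum>i<D. cnj (u k i) * u l i)"
      using that by (simp add: hu sum_distrib_left mult_ac)
    finally show ?thesis using that on by (simp add: orthonormalD)
  qed
  have norm: "(\<Sum>x\<in>J. (cmod (\<Sum>i<D. G x i * u k i))\<^sup>2) = \<mu> k" if "k < D" for k
  proof -
    have "complex_of_real (\<Sum>x\<in>J. (cmod (\<Sum>i<D. G x i * u k i))\<^sup>2) = of_real (\<mu> k)"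
      using orth[OF that that] by (simp only: of_real_sum complex_norm_square mult.commute[of "cnj _"] simp_thms if_True)
    thus ?thesis using of_real_eq_iff by blast
  qed
  have "0 \<le> \<mu> k" if "k < D" for k
    unfolding norm[OF that, symmetric] by (intro sum_nonneg) simp
  from that[OF on compl dec[unfolded h_def] cp[unfolded h_def] orth norm this] show ?thesis .
qed

lemma basis_expansion:
  fixes D :: nat
  assumes "\<And>i j. i < D \<Longrightarrow> j < D \<Longrightarrow> (\<Sum>k<D. u k i * cnj (u k j)) = (if i = j then 1 else 0)" and "i < D"
  shows "(\<Sum>k<D. (\<Sum>j<D. cnj (u k j) * g j) * u k i) = (g i :: complex)"
proof -
  have "(\<Sum>k<D. (\<Sum>j<D. cnj (u k j) * g j) * u k i) = (\<Sum>j<D. g j * (\<Sum>k<D. u k i * cnj (u k j)))"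
    by (simp add: sum_distrib_left sum_distrib_right mult_ac) (rule sum.swap)
  also have "\<dots> = (\<Sum>j<D. g j * (if i = j then 1 else 0))"
    using assms(2) by (intro sum.cong refl) (simp only: assms(1) lessThan_iff)
  also have "\<dots> = g i"
    using assms(2) by (simp add: sum_mult_delta)
  finally show ?thesis .
qed

definition qform :: "nat \<Rightarrow> (nat \<Rightarrow> nat \<Rightarrow> complex) \<Rightarrow> (nat \<Rightarrow> complex) \<Rightarrow> complex" where
  "qform d a v = (\<Sum>i<d. \<Sum>j<d. cnj (v i) * a i j * v j)"

text \<open>Expanding \<open>g k\<close> in the right singular vectors writes its form as the sum
  over m of \<open>c m k * p m k\<close>. For fixed m, Bessel bounds the squares of c by 1 and those
  of p by \<open>\<mu> m\<close>, so Cauchy-Schwarz over \<open>J\<close> contributes at most one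
  singular value. This is the only way in which the trace norm enters the argument.\<close>

lemma qform_le_trace_norm:
  assumes A: "A \<in> carrier_mat d d" and fin: "finite J" and g: "orthonormal {..<d} J g"
  shows "(\<Sum>k\<in>J. cmod (qform d (\<lambda>i j. A $$ (i,j)) (g k))) \<le> trace_norm A"
proof -
  define h where "h i j = (\<Sum>l<d. cnj (A $$ (l,i)) * A $$ (l,j))" for i j
  obtain u \<mu> where on: "orthonormal {..<d} {..<d} u"
    and compl: "\<And>i j. i < d \<Longrightarrow> j < d \<Longrightarrow> (\<Sum>k<d. u k i * cnj (u k j)) = (if i = j then 1 else 0)"
    and "\<And>i j. i < d \<Longrightarrow> j < d \<Longrightarrow> h i j = (\<Sum>k<d. of_real (\<mu> k) * u k i * cnj (u k j))"
    and cp: "char_poly (mat d d (\<lambda>(i,j). h i j)) = (\<Prod>k<d. [:- of_real (\<mu> k), 1:])"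
    and "\<And>k l. k < d \<Longrightarrow> l < d \<Longrightarrow> (\<Sum>x<d. cnj (\<Sum>i<d. A $$ (x,i) * u k i) * (\<Sum>i<d. A $$ (x,i) * u l i))
        = (if k = l then of_real (\<mu> k) else 0)"
    and norm: "\<And>k. k < d \<Longrightarrow> (\<Sum>l<d. (cmod (\<Sum>i<d. A $$ (l,i) * u k i))\<^sup>2) = \<mu> k"
    and "\<And>k. k < d \<Longrightarrow> 0 \<le> \<mu> k"
    using singular_value_decomposition[where D=d and J="{..<d}" and G="\<lambda>l i. A $$ (l,i)", folded h_def] by blast
  have AA: "adj A * A = mat d d (\<lambda>(i,j). h i j)"
    using A by (intro eq_matI) (auto simp: h_def mat_mult_index[of _ d d _ d] simp del: index_mult_mat(1))
  have tn: "trace_norm A = (\<Sum>k<d. sqrt (\<mu> k))"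
    unfolding trace_norm_def Let_def AA cp using sum_roots_order[where n=d and c="\<lambda>k. of_real (\<mu> k)" and f="\<lambda>z. sqrt (Re z)"] by simp
  define y where "y m l = (\<Sum>i<d. A $$ (l,i) * u m i)" for m l
  define c where "c m k = (\<Sum>i<d. cnj (u m i) * g k i)" for m k
  define p where "p m k = (\<Sum>l<d. cnj (g k l) * y m l)" for m k
  have qf: "qform d (\<lambda>i j. A $$ (i,j)) (g k) = (\<Sum>m<d. c m k * p m k)" for k
  proof -
    have "qform d (\<lambda>i j. A $$ (i,j)) (g k) = (\<Sum>i<d. cnj (g k i) * (\<Sum>j<d. A $$ (i,j) * g k j))"
      by (simp add: qform_def sum_distrib_left mult.assoc)
    also have "\<dots> = (\<Sum>i<d. cnj (g k i) * (\<Sum>j<d. A $$ (i,j) * (\<Sum>m<d. c m k * u m j)))"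
      unfolding c_def by (intro sum.cong refl arg_cong2[where f="(*)"]) (simp add: basis_expansion[OF compl])
    also have "\<dots> = (\<Sum>i<d. cnj (g k i) * (\<Sum>m<d. c m k * y m i))"
    proof (rule sum.cong[OF refl], rule arg_cong2[where f="(*)", OF refl])
      fix i
      have "(\<Sum>j<d. A $$ (i,j) * (\<Sum>m<d. c m k * u m j)) = (\<Sum>j<d. \<Sum>m<d. c m k * (A $$ (i,j) * u m j))"
        by (simp add: sum_distrib_left mult_ac)
      also have "\<dots> = (\<Sum>m<d. c m k * y m i)"
        by (subst sum.swap) (simp only: y_def sum_distrib_left)
      finally show "(\<Sum>j<d. A $$ (i,j) * (\<Sum>m<d. c m k * u m j)) = (\<Sum>m<d. c m k * y m i)" .
    qed
    also have "\<dots> = (\<Sum>m<d. c m k * p m k)"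
    proof -
      have "(\<Sum>i<d. cnj (g k i) * (\<Sum>m<d. c m k * y m i)) = (\<Sum>i<d. \<Sum>m<d. c m k * (cnj (g k i) * y m i))"
        by (simp add: sum_distrib_left mult_ac)
      also have "\<dots> = (\<Sum>m<d. c m k * p m k)"
        by (subst sum.swap) (simp only: p_def sum_distrib_left)
      finally show ?thesis .
    qed
    finally show ?thesis .
  qed
  have cb: "(\<Sum>k\<in>J. (cmod (c m k))\<^sup>2) \<le> 1" if "m < d" for m
  proof -
    have "(\<Sum>k\<in>J. (cmod (c m k))\<^sup>2) = (\<Sum>k\<in>J. (cmod (\<Sum>i<d. cnj (g k i) * u m i))\<^sup>2)"
    proof (intro sum.cong refl arg_cong[where f="\<lambda>x. x\<^sup>2"])
      fix k
      have "c m k = cnj (\<Sum>i<d. cnj (g k i) * u m i)" by (simp add: c_def mult.commute)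
      thus "cmod (c m k) = cmod (\<Sum>i<d. cnj (g k i) * u m i)" by (simp only: complex_mod_cnj)
    qed
    also have "\<dots> \<le> (\<Sum>i<d. (cmod (u m i))\<^sup>2)" by (rule bessel[OF fin g])
    also have "\<dots> = 1"
    proof -
      have "complex_of_real (\<Sum>i<d. (cmod (u m i))\<^sup>2) = (\<Sum>i<d. cnj (u m i) * u m i)"
        by (simp only: of_real_sum complex_norm_square mult.commute)
      also have "\<dots> = 1" using on that by (simp add: orthonormalD)
      finally show ?thesis by (metis of_real_eq_1_iff)
    qed
    finally show ?thesis .
  qed
  have pb: "(\<Sum>k\<in>J. (cmod (p m k))\<^sup>2) \<le> \<mu> m" if "m < d" for m
    unfolding p_def norm[OF that, symmetric] y_def[symmetric] by (rule bessel[OF fin g])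
  have "(\<Sum>k\<in>J. cmod (qform d (\<lambda>i j. A $$ (i,j)) (g k))) \<le> (\<Sum>k\<in>J. \<Sum>m<d. cmod (c m k) * cmod (p m k))"
    unfolding qf by (intro sum_mono order_trans[OF norm_sum]) (simp add: norm_mult)
  also have "\<dots> = (\<Sum>m<d. \<Sum>k\<in>J. cmod (c m k) * cmod (p m k))" by (rule sum.swap)
  also have "\<dots> \<le> (\<Sum>m<d. sqrt (\<mu> m))"
  proof (intro sum_mono real_le_rsqrt)
    fix m assume "m \<in> {..<d}"
    have "(\<Sum>k\<in>J. cmod (c m k) * cmod (p m k))\<^sup>2 \<le> (\<Sum>k\<in>J. (cmod (c m k))\<^sup>2) * (\<Sum>k\<in>J. (cmod (p m k))\<^sup>2)"
      by (rule Cauchy_Schwarz_ineq_sum)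
    also have "\<dots> \<le> 1 * \<mu> m"
      using \<open>m \<in> {..<d}\<close> by (intro mult_mono cb pb) (auto intro: sum_nonneg)
    finally show "(\<Sum>k\<in>J. cmod (c m k) * cmod (p m k))\<^sup>2 \<le> \<mu> m" by simp
  qed
  finally show ?thesis unfolding tn .
qed

text \<open>In the polar form G = V a with a = |G|, the matrix \<open>C\<close> is the adjoint of
  the partial isometry V, so that C G = |G|. Normalised images \<open>g k\<close> exist only for
  positive singular values, hence the restriction to \<open>P\<close>; the remaining ones contribute
  nothing to \<open>a\<close>.\<close>

lemma polar_decomposition:
  fixes G :: "'j \<Rightarrow> nat \<Rightarrow> complex" and D :: nat
  assumes J: "finite J"
  obtains C a where
    "\<And>v. (\<Sum>f<D. (cmod (\<Sum>x\<in>J. C f x * v x))\<^sup>2) \<le> (\<Sum>x\<in>J. (cmod (v x))\<^sup>2)"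
    "\<And>f e. f < D \<Longrightarrow> e < D \<Longrightarrow> (\<Sum>x\<in>J. C f x * G x e) = a f e"
    "\<And>f e. a e f = cnj (a f e)"
    "\<And>v. 0 \<le> Re (qform D a v)"
    "\<And>f e. f < D \<Longrightarrow> e < D \<Longrightarrow> (\<Sum>m<D. a f m * a m e) = (\<Sum>x\<in>J. cnj (G x f) * G x e)"
proof -
  obtain u \<mu> where on: "orthonormal {..<D} {..<D} u"
    and compl: "\<And>i j. i < D \<Longrightarrow> j < D \<Longrightarrow> (\<Sum>k<D. u k i * cnj (u k j)) = (if i = j then 1 else 0)"
    and dec: "\<And>i j. i < D \<Longrightarrow> j < D \<Longrightarrow>
        (\<Sum>x\<in>J. cnj (G x i) * G x j) = (\<Sum>k<D. of_real (\<mu> k) * u k i * cnj (u k j))"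
    and "char_poly (mat D D (\<lambda>(i,j). \<Sum>x\<in>J. cnj (G x i) * G x j)) = (\<Prod>k<D. [:- of_real (\<mu> k), 1:])"
    and orth: "\<And>k l. k < D \<Longrightarrow> l < D \<Longrightarrow> (\<Sum>x\<in>J. cnj (\<Sum>i<D. G x i * u k i) * (\<Sum>i<D. G x i * u l i))
        = (if k = l then of_real (\<mu> k) else 0)"
    and "\<And>k. k < D \<Longrightarrow> (\<Sum>x\<in>J. (cmod (\<Sum>i<D. G x i * u k i))\<^sup>2) = \<mu> k"
    and pos: "\<And>k. k < D \<Longrightarrow> 0 \<le> \<mu> k"
    using singular_value_decomposition[where D=D and J=J and G=G] by blast
  define P where "P = {k. k < D \<and> \<mu> k > 0}"
  have P: "finite P" "P \<subseteq> {..<D}" by (auto simp: P_def)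
  define s :: "nat \<Rightarrow> complex" where "s k = of_real (sqrt (\<mu> k))" for k
  have ss: "s k * s k = of_real (\<mu> k)" if "k < D" for k
    using pos[OF that] by (simp add: s_def flip: of_real_mult)
  have s0: "s k \<noteq> 0" if "k \<in> P" for k using that by (simp add: P_def s_def)
  have s00: "s k = 0" if "k < D" "k \<notin> P" for k
    using that pos[of k] by (simp add: P_def s_def)
  have cnjs [simp]: "cnj (s k) = s k" for k by (simp add: s_def)
  define y where "y k x = (\<Sum>i<D. G x i * u k i)" for k x
  define g where "g k x = y k x / s k" for k x
  have ong: "orthonormal J P g"
    unfolding orthonormal_def
  proof (intro ballI)
    fix k l assume kl: "k \<in> P" "l \<in> P"
    hence kl': "k < D" "l < D" using P by auto
    have "(\<Sum>x\<in>J. cnj (g k x) * g l x) = (\<Sum>x\<in>J. cnj (y k x) * y l x) / (s k * s l)"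
      by (simp add: g_def sum_divide_distrib)
    also have "\<dots> = (if k = l then 1 else 0)"
      using orth[OF kl'] s0[OF kl(1)] ss[OF kl'(1)] by (auto simp: y_def)
    finally show "(\<Sum>x\<in>J. cnj (g k x) * g l x) = (if k = l then 1 else 0)" .
  qed
  have onP: "orthonormal {..<D} P u" using on P(2) unfolding orthonormal_def by blast
  define C where "C f x = (\<Sum>k\<in>P. u k f * cnj (g k x))" for f x
  define a where "a f e = (\<Sum>k<D. s k * (u k f * cnj (u k e)))" for f e
  show ?thesis
  proof (rule that[of C a])
    fix v :: "'j \<Rightarrow> complex"
    have "(\<Sum>x\<in>J. C f x * v x) = (\<Sum>k\<in>P. (\<Sum>x\<in>J. cnj (g k x) * v x) * u k f)" for f
    proof -
      have "(\<Sum>x\<in>J. C f x * v x) = (\<Sum>x\<in>J. \<Sum>k\<in>P. (cnj (g k x) * v x) * u k f)"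
        by (simp add: C_def sum_distrib_right sum_distrib_left mult_ac)
      also have "\<dots> = (\<Sum>k\<in>P. (\<Sum>x\<in>J. cnj (g k x) * v x) * u k f)"
        by (subst sum.swap) (simp only: sum_distrib_right)
      finally show ?thesis .
    qed
    hence "(\<Sum>f<D. (cmod (\<Sum>x\<in>J. C f x * v x))\<^sup>2) = (\<Sum>k\<in>P. (cmod (\<Sum>x\<in>J. cnj (g k x) * v x))\<^sup>2)"
      using parseval[OF P(1) onP] by simp
    also have "\<dots> \<le> (\<Sum>x\<in>J. (cmod (v x))\<^sup>2)" by (rule bessel[OF P(1) ong])
    finally show "(\<Sum>f<D. (cmod (\<Sum>x\<in>J. C f x * v x))\<^sup>2) \<le> (\<Sum>x\<in>J. (cmod (v x))\<^sup>2)" .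
  next
    fix f e assume fe: "f < D" "e < D"
    have gG: "(\<Sum>x\<in>J. cnj (g k x) * G x e) = s k * cnj (u k e)" if "k \<in> P" for k
    proof -
      have k: "k < D" using that P by auto
      have "(\<Sum>x\<in>J. cnj (y k x) * G x e) = (\<Sum>x\<in>J. cnj (y k x) * (\<Sum>l<D. y l x * cnj (u l e)))"
      proof (intro sum.cong refl arg_cong2[where f="(*)"])
        fix x
        have "(\<Sum>l<D. y l x * cnj (u l e)) = (\<Sum>l<D. \<Sum>i<D. G x i * (u l i * cnj (u l e)))"
          by (simp add: y_def sum_distrib_right mult.assoc)
        also have "\<dots> = (\<Sum>i<D. G x i * (\<Sum>l<D. u l i * cnj (u l e)))"
          by (subst sum.swap) (simp only: sum_distrib_left)
        also have "\<dots> = (\<Sum>i<D. G x i * (if i = e then 1 else 0))"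
          using fe by (intro sum.cong refl) (simp only: compl lessThan_iff)
        also have "\<dots> = G x e" using fe by (simp add: sum_mult_delta)
        finally show "G x e = (\<Sum>l<D. y l x * cnj (u l e))" by simp
      qed
      also have "\<dots> = (\<Sum>x\<in>J. \<Sum>l<D. cnj (u l e) * (cnj (y k x) * y l x))"
        by (simp add: sum_distrib_left mult_ac)
      also have "\<dots> = (\<Sum>l<D. cnj (u l e) * (\<Sum>x\<in>J. cnj (y k x) * y l x))"
        by (subst sum.swap) (simp only: sum_distrib_left)
      also have "\<dots> = (\<Sum>l<D. (cnj (u l e) * of_real (\<mu> k)) * (if k = l then 1 else 0))"
        using k by (intro sum.cong refl) (simp add: orth[folded y_def])
      also have "\<dots> = cnj (u k e) * of_real (\<mu> k)" using k by (simp add: sum_mult_delta)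
      finally have *: "(\<Sum>x\<in>J. cnj (y k x) * G x e) = s k * s k * cnj (u k e)"
        using ss[OF k] by simp
      have "(\<Sum>x\<in>J. cnj (g k x) * G x e) = (\<Sum>x\<in>J. cnj (y k x) * G x e) / s k"
        by (simp add: g_def sum_divide_distrib)
      thus ?thesis unfolding * using s0[OF that] by simp
    qed
    have "(\<Sum>x\<in>J. C f x * G x e) = (\<Sum>x\<in>J. \<Sum>k\<in>P. u k f * (cnj (g k x) * G x e))"
      by (simp add: C_def sum_distrib_left sum_distrib_right mult_ac)
    also have "\<dots> = (\<Sum>k\<in>P. u k f * (\<Sum>x\<in>J. cnj (g k x) * G x e))"
      by (subst sum.swap) (simp only: sum_distrib_left)
    also have "\<dots> = (\<Sum>k\<in>P. s k * (u k f * cnj (u k e)))"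
      by (intro sum.cong refl) (simp add: gG)
    also have "\<dots> = a f e"
      unfolding a_def using P s00 by (intro sum.mono_neutral_left) auto
    finally show "(\<Sum>x\<in>J. C f x * G x e) = a f e" .
    have "(\<Sum>m<D. a f m * a m e)
        = (\<Sum>m<D. \<Sum>k<D. \<Sum>l<D. s k * u k f * s l * cnj (u l e) * (cnj (u k m) * u l m))"
      by (simp only: a_def sum_product) (simp add: mult_ac)
    also have "\<dots> = (\<Sum>k<D. \<Sum>l<D. \<Sum>m<D. s k * u k f * s l * cnj (u l e) * (cnj (u k m) * u l m))"
      by (subst sum.swap) (intro sum.cong refl sum.swap)
    also have "\<dots> = (\<Sum>k<D. \<Sum>l<D. s k * u k f * s l * cnj (u l e) * (if k = l then 1 else 0))"
      by (intro sum.cong refl) (simp add: orthonormalD[OF on] flip: sum_distrib_left)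
    also have "\<dots> = (\<Sum>k<D. s k * u k f * s k * cnj (u k e))"
      by (simp only: sum_mult_delta finite_lessThan) (intro sum.cong refl, simp)
    also have "\<dots> = (\<Sum>x\<in>J. cnj (G x f) * G x e)"
      unfolding dec[OF fe] by (intro sum.cong refl) (simp add: ss[symmetric] mult_ac)
    finally show "(\<Sum>m<D. a f m * a m e) = (\<Sum>x\<in>J. cnj (G x f) * G x e)" .
  next
    fix f e show "a e f = cnj (a f e)" by (simp add: a_def mult_ac)
  next
    fix v
    have "qform D a v = (\<Sum>i<D. \<Sum>j<D. \<Sum>k<D. s k * ((cnj (v i) * u k i) * (cnj (u k j) * v j)))"
      by (simp add: qform_def a_def sum_distrib_left sum_distrib_right mult_ac)
    also have "\<dots> = (\<Sum>k<D. \<Sum>i<D. \<Sum>j<D. s k * ((cnj (v i) * u k i) * (cnj (u k j) * v j)))"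
      by (rule sum_rotate3)
    also have "\<dots> = (\<Sum>k<D. s k * ((\<Sum>i<D. cnj (v i) * u k i) * (\<Sum>j<D. cnj (u k j) * v j)))"
      by (rule sum.cong[OF refl], subst sum_product, simp only: sum_distrib_left)
    also have "\<dots> = (\<Sum>k<D. s k * (cnj (\<Sum>j<D. cnj (u k j) * v j) * (\<Sum>j<D. cnj (u k j) * v j)))"
      by (simp add: mult.commute)
    also have "\<dots> = (\<Sum>k<D. of_real (sqrt (\<mu> k) * (cmod (\<Sum>j<D. cnj (u k j) * v j))\<^sup>2))"
      by (simp only: s_def of_real_mult complex_norm_square mult.commute[of "cnj _"])
    finally have "Re (qform D a v) = (\<Sum>k<D. sqrt (\<mu> k) * (cmod (\<Sum>j<D. cnj (u k j) * v j))\<^sup>2)"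
      by simp
    also have "\<dots> \<ge> 0" using pos by (intro sum_nonneg mult_nonneg_nonneg) auto
    finally show "0 \<le> Re (qform D a v)" .
  qed
qed

lemma qform_square:
  assumes "\<And>i j. i < D \<Longrightarrow> j < D \<Longrightarrow> a j i = cnj (a i j)"
  shows "qform D (\<lambda>i j. \<Sum>m<D. a i m * a m j) v = of_real (\<Sum>m<D. (cmod (\<Sum>j<D. a m j * v j))\<^sup>2)"
proof -
  have "qform D (\<lambda>i j. \<Sum>m<D. a i m * a m j) v = (\<Sum>i<D. \<Sum>j<D. \<Sum>m<D. cnj (a m i * v i) * (a m j * v j))"
    unfolding qform_def
  proof (intro sum.cong refl)
    fix i j assume i: "i \<in> {..<D}"
    have "cnj (v i) * (\<Sum>m<D. a i m * a m j) * v j = (\<Sum>m<D. cnj (v i) * (a i m * a m j) * v j)"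
      by (simp add: sum_distrib_left sum_distrib_right)
    also have "\<dots> = (\<Sum>m<D. cnj (a m i * v i) * (a m j * v j))"
    proof (intro sum.cong refl)
      fix m assume "m \<in> {..<D}"
      hence "a i m = cnj (a m i)" using assms[of m i] i by simp
      thus "cnj (v i) * (a i m * a m j) * v j = cnj (a m i * v i) * (a m j * v j)" by simp
    qed
    finally show "cnj (v i) * (\<Sum>m<D. a i m * a m j) * v j = (\<Sum>m<D. cnj (a m i * v i) * (a m j * v j))" .
  qed
  also have "\<dots> = (\<Sum>m<D. \<Sum>i<D. \<Sum>j<D. cnj (a m i * v i) * (a m j * v j))"
    by (rule sum_rotate3)
  also have "\<dots> = (\<Sum>m<D. cnj (\<Sum>j<D. a m j * v j) * (\<Sum>j<D. a m j * v j))"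
    by (simp only: cnj_sum sum_product)
  finally show ?thesis
    by (simp only: of_real_sum complex_norm_square mult.commute[of "cnj _"])
qed

text \<open>The Powers--Stoermer inequality becomes a scalar estimate in the eigenbasis of \<open>a - b\<close>.\<close>

lemma powers_stoermer:
  fixes a b :: "nat \<Rightarrow> nat \<Rightarrow> complex"
  assumes ha: "\<And>i j. i < D \<Longrightarrow> j < D \<Longrightarrow> a j i = cnj (a i j)"
    and hb: "\<And>i j. i < D \<Longrightarrow> j < D \<Longrightarrow> b j i = cnj (b i j)"
    and pa: "\<And>v. 0 \<le> Re (qform D a v)" and pb: "\<And>v. 0 \<le> Re (qform D b v)"
  obtains u where "orthonormal {..<D} {..<D} u"
    "\<And>i j. i < D \<Longrightarrow> j < D \<Longrightarrow> (\<Sum>k<D. u k i * cnj (u k j)) = (if i = j then 1 else 0)"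
    "(\<Sum>i<D. \<Sum>j<D. (cmod (a i j - b i j))\<^sup>2)
       \<le> (\<Sum>k<D. cmod (qform D (\<lambda>i j. (\<Sum>m<D. a i m * a m j) - (\<Sum>m<D. b i m * b m j)) (u k)))"
proof -
  define c where "c i j = a i j - b i j" for i j
  have hc: "c j i = cnj (c i j)" if "i < D" "j < D" for i j
    using ha[OF that] hb[OF that] by (simp add: c_def)
  obtain u and d :: "nat \<Rightarrow> real" where on: "orthonormal {..<D} {..<D} u"
    and compl: "\<And>i j. i < D \<Longrightarrow> j < D \<Longrightarrow> (\<Sum>k<D. u k i * cnj (u k j)) = (if i = j then 1 else 0)"
    and dec: "\<And>i j. i < D \<Longrightarrow> j < D \<Longrightarrow> c i j = (\<Sum>k<D. of_real (d k) * u k i * cnj (u k j))"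
    and "char_poly (mat D D (\<lambda>(i,j). c i j)) = (\<Prod>k<D. [:- of_real (d k), 1:])"
    using spectral_decomposition[of D c] hc by blast
  have unorm: "(\<Sum>i<D. (cmod (u k i))\<^sup>2) = 1" if "k < D" for k
  proof -
    have "complex_of_real (\<Sum>i<D. (cmod (u k i))\<^sup>2) = (\<Sum>i<D. cnj (u k i) * u k i)"
      by (simp only: of_real_sum complex_norm_square mult.commute)
    also have "\<dots> = 1" using on that by (simp add: orthonormalD)
    finally show ?thesis by (metis of_real_eq_1_iff)
  qed
  have cu: "(\<Sum>j<D. c i j * u k j) = of_real (d k) * u k i" if "i < D" "k < D" for i k
  proof -
    have "(\<Sum>j<D. c i j * u k j) = (\<Sum>j<D. \<Sum>l<D. of_real (d l) * u l i * (cnj (u l j) * u k j))"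
      using that by (simp add: dec sum_distrib_right mult.assoc)
    also have "\<dots> = (\<Sum>l<D. of_real (d l) * u l i * (\<Sum>j<D. cnj (u l j) * u k j))"
      by (subst sum.swap) (simp only: sum_distrib_left)
    also have "\<dots> = (\<Sum>l<D. of_real (d l) * u l i * (if l = k then 1 else 0))"
      using that by (intro sum.cong refl) (simp add: orthonormalD[OF on])
    also have "\<dots> = of_real (d k) * u k i"
      using that by (simp add: sum_mult_delta)
    finally show ?thesis .
  qed
  have hs: "(\<Sum>i<D. \<Sum>j<D. (cmod (c i j))\<^sup>2) = (\<Sum>k<D. (d k)\<^sup>2)"
  proof -
    have "(\<Sum>i<D. \<Sum>j<D. (cmod (c i j))\<^sup>2) = (\<Sum>j<D. \<Sum>i<D. (cmod (\<Sum>k<D. (of_real (d k) * cnj (u k j)) * u k i))\<^sup>2)"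
      by (subst sum.swap) (intro sum.cong refl, simp add: dec mult_ac)
    also have "\<dots> = (\<Sum>j<D. \<Sum>k<D. (cmod (of_real (d k) * cnj (u k j)))\<^sup>2)"
      by (simp only: parseval[OF finite_lessThan on])
    also have "\<dots> = (\<Sum>k<D. (d k)\<^sup>2 * (\<Sum>j<D. (cmod (u k j))\<^sup>2))"
      by (subst sum.swap) (simp add: norm_mult power_mult_distrib sum_distrib_left)
    also have "\<dots> = (\<Sum>k<D. (d k)\<^sup>2)" by (simp add: unorm)
    finally show ?thesis .
  qed
  \<comment> \<open>On the eigenvector \<open>u k\<close> of a - b with eigenvalue d, the form of
    a^2 - b^2 equals d (qa + qb), where qa and qb are the values of a and b there. Since d = qa - qb
    and both values are nonnegative, |d| \<le> qa + qb.\<close>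
  have key: "(d k)\<^sup>2 \<le> cmod (qform D (\<lambda>i j. (\<Sum>m<D. a i m * a m j) - (\<Sum>m<D. b i m * b m j)) (u k))"
    if k: "k < D" for k
  proof -
    define \<alpha> where "\<alpha> m = (\<Sum>j<D. a m j * u k j)" for m
    define \<beta> where "\<beta> m = (\<Sum>j<D. b m j * u k j)" for m
    have ab: "\<alpha> m = \<beta> m + of_real (d k) * u k m" if "m < D" for m
      using cu[OF that k] by (simp add: c_def \<alpha>_def \<beta>_def algebra_simps sum_subtractf)
    define qa where "qa = Re (qform D a (u k))"
    define qb where "qb = Re (qform D b (u k))"
    have qa': "qa = (\<Sum>m<D. Re (cnj (u k m) * \<alpha> m))"
      by (simp only: qa_def qform_def \<alpha>_def sum_distrib_left mult.assoc Re_sum)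
    have qb': "qb = (\<Sum>m<D. Re (cnj (u k m) * \<beta> m))"
      by (simp only: qb_def qform_def \<beta>_def sum_distrib_left mult.assoc Re_sum)
    have cm: "(cmod z)\<^sup>2 = Re (cnj z * z)" for z
      unfolding cmod_power2 by (simp add: power2_eq_square)
    have qq: "qa - qb = d k"
    proof -
      have "qa - qb = (\<Sum>m<D. d k * (cmod (u k m))\<^sup>2)"
        unfolding qa' qb' sum_subtractf[symmetric]
        by (intro sum.cong refl) (simp add: ab cm algebra_simps)
      also have "\<dots> = d k" using unorm[OF k] by (simp flip: sum_distrib_left)
      finally show ?thesis .
    qed
    have "qform D (\<lambda>i j. (\<Sum>m<D. a i m * a m j) - (\<Sum>m<D. b i m * b m j)) (u k)
        = qform D (\<lambda>i j. \<Sum>m<D. a i m * a m j) (u k) - qform D (\<lambda>i j. \<Sum>m<D. b i m * b m j) (u k)"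
      by (simp add: qform_def algebra_simps sum_subtractf)
    also have "\<dots> = of_real ((\<Sum>m<D. (cmod (\<alpha> m))\<^sup>2) - (\<Sum>m<D. (cmod (\<beta> m))\<^sup>2))"
      using qform_square[of D a "u k", OF ha] qform_square[of D b "u k", OF hb]
      by (simp only: \<alpha>_def \<beta>_def of_real_diff)
    also have "(\<Sum>m<D. (cmod (\<alpha> m))\<^sup>2) - (\<Sum>m<D. (cmod (\<beta> m))\<^sup>2) = d k * (qa + qb)"
    proof -
      have "(cmod (\<alpha> m))\<^sup>2 - (cmod (\<beta> m))\<^sup>2 = d k * (Re (cnj (u k m) * \<alpha> m) + Re (cnj (u k m) * \<beta> m))"
        if "m < D" for m
        unfolding ab[OF that] cm by (simp add: algebra_simps)
      hence "(\<Sum>m<D. (cmod (\<alpha> m))\<^sup>2 - (cmod (\<beta> m))\<^sup>2)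
          = (\<Sum>m<D. d k * (Re (cnj (u k m) * \<alpha> m) + Re (cnj (u k m) * \<beta> m)))"
        by (intro sum.cong refl) simp
      thus ?thesis
        by (simp only: qa' qb' sum_subtractf sum.distrib sum_distrib_left[symmetric])
    qed
    finally have "cmod (qform D (\<lambda>i j. (\<Sum>m<D. a i m * a m j) - (\<Sum>m<D. b i m * b m j)) (u k)) = \<bar>d k\<bar> * \<bar>qa + qb\<bar>"
      by (simp only: norm_of_real abs_mult)
    moreover have "\<bar>d k\<bar> \<le> \<bar>qa + qb\<bar>"
      using qq pa[of "u k"] pb[of "u k"] unfolding qa_def[symmetric] qb_def[symmetric] by linarith
    hence "\<bar>d k\<bar> * \<bar>d k\<bar> \<le> \<bar>d k\<bar> * \<bar>qa + qb\<bar>" by (intro mult_left_mono) auto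
    ultimately show ?thesis by (simp add: power2_eq_square)
  qed
  show ?thesis
  proof (rule that[OF on compl])
    show "(\<Sum>i<D. \<Sum>j<D. (cmod (a i j - b i j))\<^sup>2)
       \<le> (\<Sum>k<D. cmod (qform D (\<lambda>i j. (\<Sum>m<D. a i m * a m j) - (\<Sum>m<D. b i m * b m j)) (u k)))"
      using hs unfolding c_def by (simp only:) (intro sum_mono key, simp)
  qed
qed

section \<open>The privacy test\<close>

text \<open>The closed existential form is what \<open>choice\<close> needs to select one
  decomposition per message.\<close>

lemma polar_decomposition_ex:
  fixes G :: "'j \<Rightarrow> nat \<Rightarrow> complex" and D :: nat
  assumes "finite J"
  shows "\<exists>C a. (\<forall>v. (\<Sum>f<D. (cmod (\<Sum>x\<in>J. C f x * v x))\<^sup>2) \<le> (\<Sum>x\<in>J. (cmod (v x))\<^sup>2)) \<and>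
    (\<forall>f e. f < D \<longrightarrow> e < D \<longrightarrow> (\<Sum>x\<in>J. C f x * G x e) = a f e) \<and>
    (\<forall>f e. a e f = cnj (a f e)) \<and> (\<forall>v. 0 \<le> Re (qform D a v)) \<and>
    (\<forall>f e. f < D \<longrightarrow> e < D \<longrightarrow> (\<Sum>m<D. a f m * a m e) = (\<Sum>x\<in>J. cnj (G x f) * G x e))"
proof -
  obtain C a where
    c1: "\<And>v. (\<Sum>f<D. (cmod (\<Sum>x\<in>J. C f x * v x))\<^sup>2) \<le> (\<Sum>x\<in>J. (cmod (v x))\<^sup>2)" and
    c2: "\<And>f e. f < D \<Longrightarrow> e < D \<Longrightarrow> (\<Sum>x\<in>J. C f x * G x e) = a f e" and
    c3: "\<And>f e. a e f = cnj (a f e)" and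
    c4: "\<And>v. 0 \<le> Re (qform D a v)" and
    c5: "\<And>f e. f < D \<Longrightarrow> e < D \<Longrightarrow> (\<Sum>m<D. a f m * a m e) = (\<Sum>x\<in>J. cnj (G x f) * G x e)"
    using polar_decomposition[where J=J and D=D and G=G, OF assms] by blast
  show ?thesis
    by (intro exI[of _ C] exI[of _ a] conjI allI impI) (rule c1 c2 c3 c4 c5; assumption?)+
qed

lemma qform_cong:
  "(\<And>i j. i < D \<Longrightarrow> j < D \<Longrightarrow> a i j = b i j) \<Longrightarrow> qform D a v = qform D b v"
  by (simp add: qform_def)

lemma sum_qform_basis:
  assumes "\<And>i j. i < D \<Longrightarrow> j < D \<Longrightarrow> (\<Sum>k<D. u k i * cnj (u k j)) = (if i = j then 1 else 0)"
  shows "(\<Sum>k<D. qform D a (u k)) = (\<Sum>i<D. a i i)"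
proof -
  have "(\<Sum>k<D. qform D a (u k)) = (\<Sum>k<D. \<Sum>i<D. \<Sum>j<D. a i j * (u k j * cnj (u k i)))"
    by (simp add: qform_def mult_ac)
  also have "\<dots> = (\<Sum>i<D. \<Sum>j<D. \<Sum>k<D. a i j * (u k j * cnj (u k i)))"
    by (rule sum_rotate3[symmetric])
  also have "\<dots> = (\<Sum>i<D. \<Sum>j<D. a i j * (if j = i then 1 else 0))"
    by (intro sum.cong refl) (simp only: sum_distrib_left[symmetric] assms lessThan_iff)
  also have "\<dots> = (\<Sum>i<D. a i i)"
    by (simp only: sum_mult_delta finite_lessThan) (intro sum.cong refl, simp)
  finally show ?thesis .
qed

text \<open>
  The role of Uhlmann's theorem: the columns of \<open>G x\<close> purify the environment state that goes with
  message \<open>x\<close>, and the contractions of their polar decompositions map all of them close to one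
  and the same purification.
\<close>

lemma aligned_purifications:
  fixes G :: "nat \<Rightarrow> 'j \<Rightarrow> nat \<Rightarrow> complex" and G' :: "'k \<Rightarrow> nat \<Rightarrow> complex" and D K :: nat and \<epsilon> :: real
  assumes K: "K > 0" and J: "finite J" and J': "finite J'" and eps: "\<epsilon> \<le> 1"
    and tr: "(\<Sum>e<D. \<Sum>p\<in>J'. (cmod (G' p e))\<^sup>2) = 1"
    and close: "\<And>u. (\<And>x. x < K \<Longrightarrow> orthonormal {..<D} {..<D} (u x)) \<Longrightarrow>
      (\<Sum>x<K. \<Sum>k<D. cmod (qform D (\<lambda>i j. (\<Sum>p\<in>J. cnj (G x p i) * G x p j)
         - (\<Sum>p\<in>J'. cnj (G' p i) * G' p j)) (u x k))) \<le> real K * \<epsilon>"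
  obtains C where
    "\<And>x v. (\<Sum>f<D. (cmod (\<Sum>p\<in>J. C x f p * v p))\<^sup>2) \<le> (\<Sum>p\<in>J. (cmod (v p))\<^sup>2)"
    "(1 - \<epsilon>)\<^sup>2 \<le> (\<Sum>f<D. \<Sum>e<D. (cmod (\<Sum>x<K. \<Sum>p\<in>J. C x f p * G x p e))\<^sup>2) / (real K)\<^sup>2"
proof -
  define \<omega> where "\<omega> x i j = (\<Sum>p\<in>J. cnj (G x p i) * G x p j)" for x i j
  define \<omega>0 where "\<omega>0 i j = (\<Sum>p\<in>J'. cnj (G' p i) * G' p j)" for i j
  have "\<forall>x. \<exists>C a. (\<forall>v. (\<Sum>f<D. (cmod (\<Sum>p\<in>J. C f p * v p))\<^sup>2) \<le> (\<Sum>p\<in>J. (cmod (v p))\<^sup>2)) \<and>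
    (\<forall>f e. f < D \<longrightarrow> e < D \<longrightarrow> (\<Sum>p\<in>J. C f p * G x p e) = a f e) \<and>
    (\<forall>f e. a e f = cnj (a f e)) \<and> (\<forall>v. 0 \<le> Re (qform D a v)) \<and>
    (\<forall>f e. f < D \<longrightarrow> e < D \<longrightarrow> (\<Sum>m<D. a f m * a m e) = \<omega> x f e)"
    using polar_decomposition_ex[OF J, of D] unfolding \<omega>_def by blast
  from choice[OF this] obtain C where "\<forall>x. \<exists>a. (\<forall>v. (\<Sum>f<D. (cmod (\<Sum>p\<in>J. C x f p * v p))\<^sup>2) \<le> (\<Sum>p\<in>J. (cmod (v p))\<^sup>2)) \<and>
    (\<forall>f e. f < D \<longrightarrow> e < D \<longrightarrow> (\<Sum>p\<in>J. C x f p * G x p e) = a f e) \<and>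
    (\<forall>f e. a e f = cnj (a f e)) \<and> (\<forall>v. 0 \<le> Re (qform D a v)) \<and>
    (\<forall>f e. f < D \<longrightarrow> e < D \<longrightarrow> (\<Sum>m<D. a f m * a m e) = \<omega> x f e)"
    by blast
  from choice[OF this] obtain a where Ca: "\<forall>x. (\<forall>v. (\<Sum>f<D. (cmod (\<Sum>p\<in>J. C x f p * v p))\<^sup>2) \<le> (\<Sum>p\<in>J. (cmod (v p))\<^sup>2)) \<and>
    (\<forall>f e. f < D \<longrightarrow> e < D \<longrightarrow> (\<Sum>p\<in>J. C x f p * G x p e) = a x f e) \<and>
    (\<forall>f e. a x e f = cnj (a x f e)) \<and> (\<forall>v. 0 \<le> Re (qform D (a x) v)) \<and>
    (\<forall>f e. f < D \<longrightarrow> e < D \<longrightarrow> (\<Sum>m<D. a x f m * a x m e) = \<omega> x f e)"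
    by blast
  obtain C0 b where b: "(\<forall>f e. b e f = cnj (b f e)) \<and> (\<forall>v. 0 \<le> Re (qform D b v)) \<and>
    (\<forall>f e. f < D \<longrightarrow> e < D \<longrightarrow> (\<Sum>m<D. b f m * b m e) = \<omega>0 f e)"
    using polar_decomposition_ex[OF J', of D G'] unfolding \<omega>0_def[symmetric] by blast
  have aC: "\<And>x f e. f < D \<Longrightarrow> e < D \<Longrightarrow> (\<Sum>p\<in>J. C x f p * G x p e) = a x f e"
    and aS: "\<And>x f e. f < D \<Longrightarrow> e < D \<Longrightarrow> (\<Sum>m<D. a x f m * a x m e) = \<omega> x f e"
    and aH: "\<And>x. \<forall>f e. a x e f = cnj (a x f e)"
    using Ca by blast+
  have bS: "\<And>f e. f < D \<Longrightarrow> e < D \<Longrightarrow> (\<Sum>m<D. b f m * b m e) = \<omega>0 f e"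
    and bH: "\<forall>f e. b e f = cnj (b f e)"
    using b by blast+
  have "\<exists>u. orthonormal {..<D} {..<D} u \<and>
    (\<forall>i j. i < D \<longrightarrow> j < D \<longrightarrow> (\<Sum>k<D. u k i * cnj (u k j)) = (if i = j then 1 else 0)) \<and>
    (\<Sum>i<D. \<Sum>j<D. (cmod (a x i j - b i j))\<^sup>2)
       \<le> (\<Sum>k<D. cmod (qform D (\<lambda>i j. \<omega> x i j - \<omega>0 i j) (u k)))" for x
  proof -
    have 1: "\<And>i j. i < D \<Longrightarrow> j < D \<Longrightarrow> a x j i = cnj (a x i j)" using Ca by blast
    have 2: "\<And>i j. i < D \<Longrightarrow> j < D \<Longrightarrow> b j i = cnj (b i j)" using b by blast
    have 3: "\<And>v. 0 \<le> Re (qform D (a x) v)" using Ca by blast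
    have 4: "\<And>v. 0 \<le> Re (qform D b v)" using b by blast
    have eq: "qform D (\<lambda>i j. (\<Sum>m<D. a x i m * a x m j) - (\<Sum>m<D. b i m * b m j)) v
        = qform D (\<lambda>i j. \<omega> x i j - \<omega>0 i j) v" for v
      by (rule qform_cong) (simp add: aS bS)
    obtain u where "orthonormal {..<D} {..<D} u"
      "\<And>i j. i < D \<Longrightarrow> j < D \<Longrightarrow> (\<Sum>k<D. u k i * cnj (u k j)) = (if i = j then 1 else 0)"
      "(\<Sum>i<D. \<Sum>j<D. (cmod (a x i j - b i j))\<^sup>2)
       \<le> (\<Sum>k<D. cmod (qform D (\<lambda>i j. (\<Sum>m<D. a x i m * a x m j) - (\<Sum>m<D. b i m * b m j)) (u k)))"
      using powers_stoermer[of D "a x" b, OF 1 2 3 4] by blast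
    thus ?thesis unfolding eq by blast
  qed
  then obtain u where u: "\<forall>x. orthonormal {..<D} {..<D} (u x) \<and>
    (\<forall>i j. i < D \<longrightarrow> j < D \<longrightarrow> (\<Sum>k<D. u x k i * cnj (u x k j)) = (if i = j then 1 else 0)) \<and>
    (\<Sum>i<D. \<Sum>j<D. (cmod (a x i j - b i j))\<^sup>2)
       \<le> (\<Sum>k<D. cmod (qform D (\<lambda>i j. \<omega> x i j - \<omega>0 i j) (u x k)))"
    using choice[of "\<lambda>x u. orthonormal {..<D} {..<D} u \<and>
    (\<forall>i j. i < D \<longrightarrow> j < D \<longrightarrow> (\<Sum>k<D. u k i * cnj (u k j)) = (if i = j then 1 else 0)) \<and>
    (\<Sum>i<D. \<Sum>j<D. (cmod (a x i j - b i j))\<^sup>2)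
       \<le> (\<Sum>k<D. cmod (qform D (\<lambda>i j. \<omega> x i j - \<omega>0 i j) (u k)))"] by blast
  define q where "q x = (\<Sum>k<D. cmod (qform D (\<lambda>i j. \<omega> x i j - \<omega>0 i j) (u x k)))" for x
  \<comment> \<open>Powers-Stoermer picks a basis for each message; \<open>close\<close> is
    quantified over all families of bases so that it can absorb this choice.\<close>
  have sumq: "(\<Sum>x<K. q x) \<le> real K * \<epsilon>"
    unfolding q_def \<omega>_def \<omega>0_def by (rule close) (use u in blast)
  have hs: "(\<Sum>i<D. \<Sum>m<D. c i m * c m i) = of_real (\<Sum>i<D. \<Sum>m<D. (cmod (c i m))\<^sup>2)"
    if "\<forall>f e. c e f = cnj (c f e)" for c :: "nat \<Rightarrow> nat \<Rightarrow> complex"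
  proof -
    have *: "c m i = cnj (c i m)" for i m using that by blast
    show ?thesis
      unfolding of_real_sum complex_norm_square by (intro sum.cong refl arg_cong2[where f="(*)"] *)
  qed
  have bnorm: "(\<Sum>i<D. \<Sum>m<D. (cmod (b i m))\<^sup>2) = 1"
  proof -
    have "complex_of_real (\<Sum>i<D. \<Sum>m<D. (cmod (b i m))\<^sup>2) = (\<Sum>i<D. \<omega>0 i i)"
      by (simp only: hs[OF bH, symmetric]) (intro sum.cong refl, simp add: bS)
    also have "\<dots> = complex_of_real (\<Sum>e<D. \<Sum>p\<in>J'. (cmod (G' p e))\<^sup>2)"
      by (simp only: \<omega>0_def of_real_sum complex_norm_square mult.commute)
    finally show ?thesis unfolding tr using of_real_eq_iff by blast
  qed
  define R where "R x = (\<Sum>i<D. \<Sum>j<D. Re (cnj (b i j) * a x i j))" for x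
  \<comment> \<open>The squared norms of \<open>a x\<close> and \<open>b\<close> differ by the trace
    of \<open>\<omega> x - \<omega>0\<close>, so |a|^2 \<ge> 1 - q x, and Powers-Stoermer gives |a -
    b|^2 \<le> q x. With |b| = 1, polarisation yields 2 R x \<ge> 2 - 2 q x.\<close>
  have R: "1 - q x \<le> R x" for x
  proof -
    have an: "complex_of_real (\<Sum>i<D. \<Sum>m<D. (cmod (a x i m))\<^sup>2) = (\<Sum>i<D. \<omega> x i i)"
      by (simp only: hs[OF aH, symmetric]) (intro sum.cong refl, simp add: aS)
    have bn: "complex_of_real (\<Sum>i<D. \<Sum>m<D. (cmod (b i m))\<^sup>2) = (\<Sum>i<D. \<omega>0 i i)"
      by (simp only: hs[OF bH, symmetric]) (intro sum.cong refl, simp add: bS)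
    have "(\<Sum>k<D. qform D (\<lambda>i j. \<omega> x i j - \<omega>0 i j) (u x k)) = (\<Sum>i<D. \<omega> x i i - \<omega>0 i i)"
      by (rule sum_qform_basis) (use u in blast)
    hence eq: "of_real ((\<Sum>i<D. \<Sum>m<D. (cmod (a x i m))\<^sup>2) - 1) = (\<Sum>k<D. qform D (\<lambda>i j. \<omega> x i j - \<omega>0 i j) (u x k))"
      using an bn bnorm by (simp add: sum_subtractf)
    have "\<bar>(\<Sum>i<D. \<Sum>m<D. (cmod (a x i m))\<^sup>2) - 1\<bar>
        = cmod (of_real ((\<Sum>i<D. \<Sum>m<D. (cmod (a x i m))\<^sup>2) - 1))" by (simp only: norm_of_real)
    also have "\<dots> \<le> q x" unfolding eq q_def by (rule norm_sum)
    finally have "\<bar>(\<Sum>i<D. \<Sum>m<D. (cmod (a x i m))\<^sup>2) - 1\<bar> \<le> q x" .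
    moreover have "(\<Sum>i<D. \<Sum>j<D. (cmod (a x i j - b i j))\<^sup>2) \<le> q x" using u unfolding q_def by blast
    moreover have "(\<Sum>i<D. \<Sum>j<D. (cmod (a x i j - b i j))\<^sup>2)
        = (\<Sum>i<D. \<Sum>j<D. (cmod (a x i j))\<^sup>2) + (\<Sum>i<D. \<Sum>j<D. (cmod (b i j))\<^sup>2) - 2 * R x"
    proof -
      have "(cmod (z - w))\<^sup>2 = (cmod z)\<^sup>2 + (cmod w)\<^sup>2 - 2 * Re (cnj w * z)" for z w
        unfolding cmod_power2 by (simp add: power2_eq_square algebra_simps)
      thus ?thesis
        by (simp add: R_def sum.distrib sum_subtractf sum_distrib_left)
    qed
    ultimately show ?thesis using bnorm by linarith
  qed
  \<comment> \<open>Cauchy-Schwarz against the unit vector \<open>b\<close> eliminates the average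
    state: only the Hilbert-Schmidt norm of the sum of the aligned purifications remains. The
    assumption \<open>eps\<close> keeps the left side nonnegative before squaring.\<close>
  define A where "A i j = (\<Sum>x<K. a x i j)" for i j
  have "real K * (1 - \<epsilon>) \<le> (\<Sum>x<K. 1 - q x)"
    using sumq by (simp add: sum_subtractf algebra_simps)
  also have "\<dots> \<le> (\<Sum>x<K. R x)" by (intro sum_mono R)
  also have "\<dots> = Re (\<Sum>i<D. \<Sum>j<D. cnj (b i j) * A i j)"
    by (simp only: R_def A_def sum_distrib_left Re_sum) (rule sum_rotate3[symmetric])
  also have "\<dots> \<le> cmod (\<Sum>i<D. \<Sum>j<D. cnj (b i j) * A i j)" by (rule complex_Re_le_cmod)
  finally have "(real K * (1 - \<epsilon>))\<^sup>2 \<le> (cmod (\<Sum>i<D. \<Sum>j<D. cnj (b i j) * A i j))\<^sup>2"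
    using eps by (intro power_mono) auto
  also have "(\<Sum>i<D. \<Sum>j<D. cnj (b i j) * A i j)
      = (\<Sum>p\<in>{..<D}\<times>{..<D}. cnj (b (fst p) (snd p)) * A (fst p) (snd p))"
    by (simp add: sum.cartesian_product case_prod_beta)
  also have "(cmod \<dots>)\<^sup>2 \<le> (\<Sum>p\<in>{..<D}\<times>{..<D}. (cmod (cnj (b (fst p) (snd p))))\<^sup>2)
      * (\<Sum>p\<in>{..<D}\<times>{..<D}. (cmod (A (fst p) (snd p)))\<^sup>2)"
    by (rule Cauchy_Schwarz_cmod)
  also have "(\<Sum>p\<in>{..<D}\<times>{..<D}. (cmod (cnj (b (fst p) (snd p))))\<^sup>2) = 1"
    using bnorm by (simp add: sum.cartesian_product case_prod_beta)
  also have "(\<Sum>p\<in>{..<D}\<times>{..<D}. (cmod (A (fst p) (snd p)))\<^sup>2) = (\<Sum>f<D. \<Sum>e<D. (cmod (A f e))\<^sup>2)"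
    by (simp add: sum.cartesian_product case_prod_beta)
  also have "(\<Sum>f<D. \<Sum>e<D. (cmod (A f e))\<^sup>2)
      = (\<Sum>f<D. \<Sum>e<D. (cmod (\<Sum>x<K. \<Sum>p\<in>J. C x f p * G x p e))\<^sup>2)"
    unfolding A_def by (intro sum.cong refl) (simp add: aC)
  finally have "(1 - \<epsilon>)\<^sup>2 \<le> (\<Sum>f<D. \<Sum>e<D. (cmod (\<Sum>x<K. \<Sum>p\<in>J. C x f p * G x p e))\<^sup>2) / (real K)\<^sup>2"
    using K by (simp add: power_mult_distrib pos_le_divide_eq mult.commute)
  moreover have "\<And>x v. (\<Sum>f<D. (cmod (\<Sum>p\<in>J. C x f p * v p))\<^sup>2) \<le> (\<Sum>p\<in>J. (cmod (v p))\<^sup>2)"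
    using Ca by blast
  ultimately show ?thesis using that by blast
qed

text \<open>
  If the POVM element of message \<open>x\<close> is \<open>S\<^sup>* S\<close> and the code state is \<open>R R\<^sup>*\<close>, then \<open>S A R\<close> is the
  unnormalised vector that remains when the Kraus operator \<open>A\<close> acts and Bob decodes \<open>x\<close> correctly.
\<close>

definition sandwich ::
  "nat \<Rightarrow> (nat \<Rightarrow> nat \<Rightarrow> complex) \<Rightarrow> (nat \<Rightarrow> nat \<Rightarrow> complex) \<Rightarrow> (nat \<Rightarrow> nat \<Rightarrow> complex) \<Rightarrow> nat \<times> nat \<Rightarrow> complex" where
  "sandwich d s r A p = (\<Sum>b<d. \<Sum>a<d. s (fst p) b * A b a * r a (snd p))"

text \<open>The squared length of the average over the messages of the aligned vectors. The
  contractions \<open>C\<close> come from the environment of the given channel but are constants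
  here; only \<open>A\<close> varies. The conjugation reconciles two conventions: the Gram matrices
  of the polar decomposition conjugate the left factor, environment states the right one.\<close>

definition privacy_test ::
  "nat \<Rightarrow> nat \<Rightarrow> nat \<Rightarrow> (nat \<Rightarrow> nat \<Rightarrow> nat \<times> nat \<Rightarrow> complex) \<Rightarrow> (nat \<Rightarrow> nat \<Rightarrow> nat \<Rightarrow> complex)
    \<Rightarrow> (nat \<Rightarrow> nat \<Rightarrow> nat \<Rightarrow> complex) \<Rightarrow> (nat \<Rightarrow> nat \<Rightarrow> complex) \<Rightarrow> real" where
  "privacy_test D d K C S R A = (\<Sum>f<D. (cmod (\<Sum>x<K. \<Sum>p\<in>{..<d}\<times>{..<d}.
      C x f p * cnj (sandwich d (S x) (R x) A p)))\<^sup>2) / (real K)\<^sup>2"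

lemma privacy_test_nonneg: "0 \<le> privacy_test D d K C S R A"
  by (simp add: privacy_test_def sum_nonneg)

text \<open>Each summand of the test is the squared modulus of a functional that is linear in the
  conjugate of \<open>A\<close>. A weighted sum over a Kraus family therefore sees only the products
  of two entries, that is, the Choi matrix, and Kraus representations of one map are
  interchangeable.\<close>

lemma privacy_test_kernel_cong:
  assumes kernel: "\<And>b a b' a'. b < d \<Longrightarrow> a < d \<Longrightarrow> b' < d \<Longrightarrow> a' < d \<Longrightarrow>
      (\<Sum>i\<in>I. of_real (w i) * (A i b a * cnj (A i b' a'))) = (\<Sum>j\<in>I'. of_real (w' j) * (A' j b a * cnj (A' j b' a')))"
  shows "(\<Sum>i\<in>I. w i * privacy_test D d K C S R (A i)) = (\<Sum>j\<in>I'. w' j * privacy_test D d K C S R (A' j))"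
proof -
  let ?Q = "{..<d} \<times> {..<d}"
  define L where "L f q = (\<Sum>x<K. \<Sum>p\<in>?Q. C x f p * cnj (S x (fst p) (fst q)) * cnj (R x (snd q) (snd p)))" for f q
  have lin: "(\<Sum>x<K. \<Sum>p\<in>?Q. C x f p * cnj (sandwich d (S x) (R x) B p))
      = (\<Sum>q\<in>?Q. L f q * cnj (B (fst q) (snd q)))" for f B
  proof -
    have "(\<Sum>x<K. \<Sum>p\<in>?Q. C x f p * cnj (sandwich d (S x) (R x) B p))
        = (\<Sum>x<K. \<Sum>p\<in>?Q. \<Sum>q\<in>?Q. C x f p * cnj (S x (fst p) (fst q)) * cnj (R x (snd q) (snd p)) * cnj (B (fst q) (snd q)))"
      by (simp add: sandwich_def sum.cartesian_product case_prod_beta sum_distrib_left mult_ac)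
    also have "\<dots> = (\<Sum>q\<in>?Q. L f q * cnj (B (fst q) (snd q)))"
      unfolding sum_rotate3[of _ "?Q" "?Q"] L_def sum_distrib_right ..
    finally show ?thesis .
  qed
  have key: "complex_of_real (\<Sum>i\<in>X. v i * (cmod (\<Sum>q\<in>?Q. L f q * cnj (B i (fst q) (snd q))))\<^sup>2)
     = (\<Sum>q'\<in>?Q. \<Sum>q\<in>?Q. L f q * cnj (L f q') * (\<Sum>i\<in>X. of_real (v i) * (B i (fst q') (snd q') * cnj (B i (fst q) (snd q)))))"
    for f and X :: "'x set" and v and B
  proof -
    have "complex_of_real (\<Sum>i\<in>X. v i * (cmod (\<Sum>q\<in>?Q. L f q * cnj (B i (fst q) (snd q))))\<^sup>2)
      = (\<Sum>i\<in>X. \<Sum>q\<in>?Q. \<Sum>q'\<in>?Q. L f q * cnj (L f q') * (of_real (v i) * (B i (fst q') (snd q') * cnj (B i (fst q) (snd q)))))"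
    proof -
      have "complex_of_real ((cmod (\<Sum>q\<in>?Q. L f q * cnj (B i (fst q) (snd q))))\<^sup>2)
        = (\<Sum>q\<in>?Q. \<Sum>q'\<in>?Q. (L f q * cnj (B i (fst q) (snd q))) * cnj (L f q' * cnj (B i (fst q') (snd q'))))" for i
        by (simp only: complex_norm_square cnj_sum sum_product)
      thus ?thesis
        unfolding of_real_sum of_real_mult by (simp add: sum_distrib_left mult_ac)
    qed
    also have "\<dots> = (\<Sum>q'\<in>?Q. \<Sum>i\<in>X. \<Sum>q\<in>?Q. L f q * cnj (L f q') * (of_real (v i) * (B i (fst q') (snd q') * cnj (B i (fst q) (snd q)))))"
      by (rule sum_rotate3)
    also have "\<dots> = (\<Sum>q'\<in>?Q. \<Sum>q\<in>?Q. \<Sum>i\<in>X. L f q * cnj (L f q') * (of_real (v i) * (B i (fst q') (snd q') * cnj (B i (fst q) (snd q)))))"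
      by (rule sum.cong[OF refl], rule sum.swap)
    finally show ?thesis by (simp only: sum_distrib_left)
  qed
  have "(\<Sum>i\<in>I. w i * (cmod (\<Sum>q\<in>?Q. L f q * cnj (A i (fst q) (snd q))))\<^sup>2)
      = (\<Sum>i\<in>I'. w' i * (cmod (\<Sum>q\<in>?Q. L f q * cnj (A' i (fst q) (snd q))))\<^sup>2)" for f
  proof -
    have "complex_of_real (\<Sum>i\<in>I. w i * (cmod (\<Sum>q\<in>?Q. L f q * cnj (A i (fst q) (snd q))))\<^sup>2)
      = complex_of_real (\<Sum>i\<in>I'. w' i * (cmod (\<Sum>q\<in>?Q. L f q * cnj (A' i (fst q) (snd q))))\<^sup>2)"
      unfolding key
      by (rule sum.cong[OF refl], rule sum.cong[OF refl], rule arg_cong2[where f="(*)", OF refl], rule kernel) auto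
    thus ?thesis using of_real_eq_iff by blast
  qed
  note eq = this
  have tot: "(\<Sum>i\<in>X. v i * privacy_test D d K C S R (B i))
      = (\<Sum>f<D. \<Sum>i\<in>X. v i * (cmod (\<Sum>q\<in>?Q. L f q * cnj (B i (fst q) (snd q))))\<^sup>2) / (real K)\<^sup>2"
    for X :: "'x set" and v B
    unfolding privacy_test_def lin sum_divide_distrib sum_distrib_left times_divide_eq_right by (rule sum.swap)
  show ?thesis unfolding tot eq ..
qed

lemma norm_sum_sq_le: "(cmod (\<Sum>x<K. z x))\<^sup>2 \<le> real K * (\<Sum>x<K. (cmod (z x))\<^sup>2)"
  using Cauchy_Schwarz_cmod[of "\<lambda>_. 1" z "{..<K}"] by simp

lemma povm_member_bound:
  assumes "\<And>v. (\<Sum>x<K. \<Sum>c<d. (cmod (\<Sum>b<d. S x c b * v b))\<^sup>2) = (\<Sum>b<d. (cmod (v b))\<^sup>2)"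
    and "x < (K::nat)"
  shows "(\<Sum>c<d. (cmod (\<Sum>b<d. S x c b * v b))\<^sup>2) \<le> (\<Sum>b<d. (cmod (v b))\<^sup>2)"
proof -
  have "(\<Sum>c<d. (cmod (\<Sum>b<d. S x c b * v b))\<^sup>2) \<le> (\<Sum>x<K. \<Sum>c<d. (cmod (\<Sum>b<d. S x c b * v b))\<^sup>2)"
    by (rule member_le_sum) (use assms(2) in \<open>auto intro!: sum_nonneg\<close>)
  thus ?thesis by (simp only: assms(1))
qed

text \<open>For each message the vector \<open>Z x\<close> has norm at most 1: a normalised state is
  moved by an isometry, shortened by a POVM element and then by a contraction. The average of such
  vectors has norm at most 1.\<close>

lemma privacy_test_isometry_le:
  assumes K: "K > 0"
    and contr: "\<And>x v. (\<Sum>f<D. (cmod (\<Sum>p\<in>{..<d}\<times>{..<d}. C x f p * v p))\<^sup>2) \<le> (\<Sum>p\<in>{..<d}\<times>{..<d}. (cmod (v p))\<^sup>2)"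
    and povm: "\<And>v. (\<Sum>x<K. \<Sum>c<d. (cmod (\<Sum>b<d. S x c b * v b))\<^sup>2) = (\<Sum>b<d. (cmod (v b))\<^sup>2)"
    and dens: "\<And>x. x < K \<Longrightarrow> (\<Sum>k<d. \<Sum>a<d. (cmod (R x a k))\<^sup>2) = 1"
    and iso: "\<And>v. (\<Sum>b<d. (cmod (\<Sum>a<d. A b a * v a))\<^sup>2) = (\<Sum>a<d. (cmod (v a))\<^sup>2)"
  shows "privacy_test D d K C S R A \<le> 1"
proof -
  let ?Q = "{..<d} \<times> {..<d}"
  define Z where "Z x f = (\<Sum>p\<in>?Q. C x f p * cnj (sandwich d (S x) (R x) A p))" for x f
  have one: "(\<Sum>f<D. (cmod (Z x f))\<^sup>2) \<le> 1" if x: "x < K" for x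
  proof -
    have "(\<Sum>f<D. (cmod (Z x f))\<^sup>2) \<le> (\<Sum>p\<in>?Q. (cmod (sandwich d (S x) (R x) A p))\<^sup>2)"
      unfolding Z_def using contr[of x "\<lambda>p. cnj (sandwich d (S x) (R x) A p)"] by simp
    also have "\<dots> = (\<Sum>c<d. \<Sum>k<d. (cmod (\<Sum>b<d. S x c b * (\<Sum>a<d. A b a * R x a k)))\<^sup>2)"
      by (simp add: sum.cartesian_product case_prod_beta sandwich_def sum_distrib_left mult.assoc)
    also have "\<dots> = (\<Sum>k<d. \<Sum>c<d. (cmod (\<Sum>b<d. S x c b * (\<Sum>a<d. A b a * R x a k)))\<^sup>2)"
      by (rule sum.swap)
    also have "\<dots> \<le> (\<Sum>k<d. \<Sum>b<d. (cmod (\<Sum>a<d. A b a * R x a k))\<^sup>2)"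
      by (intro sum_mono povm_member_bound[OF povm x])
    also have "\<dots> = 1" by (simp only: iso dens[OF x])
    finally show ?thesis .
  qed
  have "(\<Sum>f<D. (cmod (\<Sum>x<K. Z x f))\<^sup>2) \<le> (\<Sum>f<D. real K * (\<Sum>x<K. (cmod (Z x f))\<^sup>2))"
    by (intro sum_mono norm_sum_sq_le)
  also have "\<dots> = real K * (\<Sum>x<K. \<Sum>f<D. (cmod (Z x f))\<^sup>2)"
    by (simp only: sum_distrib_left[symmetric] sum.swap[of _ "{..<D}" "{..<K}"])
  also have "\<dots> \<le> real K * (\<Sum>x<K. 1)" by (intro mult_left_mono sum_mono one) auto
  finally show ?thesis
    using K by (simp add: privacy_test_def Z_def power2_eq_square)
qed

text \<open>
  On a rank-one operator the vectors \<open>S A R\<close> are product vectors, and Cauchy--Schwarz over the messages gains the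
  factor \<open>1/K\<close> that bounds the overlap of a separable state with a maximally entangled key.
\<close>

lemma privacy_test_rank_one_le:
  assumes K: "K > 0"
    and contr: "\<And>x v. (\<Sum>f<D. (cmod (\<Sum>p\<in>{..<d}\<times>{..<d}. C x f p * v p))\<^sup>2) \<le> (\<Sum>p\<in>{..<d}\<times>{..<d}. (cmod (v p))\<^sup>2)"
    and povm: "\<And>v. (\<Sum>x<K. \<Sum>c<d. (cmod (\<Sum>b<d. S x c b * v b))\<^sup>2) = (\<Sum>b<d. (cmod (v b))\<^sup>2)"
  shows "privacy_test D d K C S R (\<lambda>b a. v b * cnj (v a))
    \<le> (\<Sum>b<d. (cmod (v b))\<^sup>2) * (\<Sum>x<K. \<Sum>k<d. (cmod (\<Sum>a<d. cnj (v a) * R x a k))\<^sup>2) / (real K)\<^sup>2"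
proof -
  let ?Q = "{..<d} \<times> {..<d}"
  define s where "s x c = (\<Sum>b<d. S x c b * v b)" for x c
  define t where "t x k = (\<Sum>a<d. cnj (v a) * R x a k)" for x k
  define \<alpha> where "\<alpha> x = (\<Sum>c<d. (cmod (s x c))\<^sup>2)" for x
  define \<beta> where "\<beta> x = (\<Sum>k<d. (cmod (t x k))\<^sup>2)" for x
  have pos: "0 \<le> \<alpha> x" "0 \<le> \<beta> x" for x by (simp_all add: \<alpha>_def \<beta>_def sum_nonneg)
  define Z where "Z x f = (\<Sum>p\<in>?Q. C x f p * cnj (s x (fst p) * t x (snd p)))" for x f
  have sw: "sandwich d (S x) (R x) (\<lambda>b a. v b * cnj (v a)) p = s x (fst p) * t x (snd p)" for x p
    by (simp add: sandwich_def s_def t_def sum_product mult_ac)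
  have Zle: "(\<Sum>f<D. (cmod (Z x f))\<^sup>2) \<le> \<alpha> x * \<beta> x" for x
  proof -
    have "(\<Sum>f<D. (cmod (Z x f))\<^sup>2) \<le> (\<Sum>p\<in>?Q. (cmod (cnj (s x (fst p) * t x (snd p))))\<^sup>2)"
      unfolding Z_def by (rule contr)
    also have "\<dots> = \<alpha> x * \<beta> x"
      unfolding \<alpha>_def \<beta>_def sum_product sum.cartesian_product case_prod_beta
      by (intro sum.cong refl) (simp add: norm_mult power_mult_distrib)
    finally show ?thesis .
  qed
  have Z0: "Z x f = 0" if "\<beta> x = 0" for x f
  proof -
    have "\<forall>k\<in>{..<d}. (cmod (t x k))\<^sup>2 = 0"
      using that unfolding \<beta>_def by (subst (asm) sum_nonneg_eq_0_iff) auto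
    thus ?thesis unfolding Z_def by (intro sum.neutral) auto
  qed
  \<comment> \<open>Cauchy-Schwarz is weighted by \<open>\<beta>\<close>: dividing the bound
    \<open>\<alpha> x * \<beta> x\<close> by \<open>\<beta> x\<close> leaves
    \<open>\<alpha> x\<close>, and completeness of the POVM makes all \<open>\<alpha> x\<close>
    together sum to a single squared norm of \<open>v\<close>. Where \<open>\<beta> x\<close> is 0
    the quotient is 0 by convention, and \<open>Z0\<close> keeps the splitting valid.\<close>
  have "(\<Sum>f<D. (cmod (\<Sum>x<K. Z x f))\<^sup>2)
      \<le> (\<Sum>f<D. (\<Sum>x<K. (cmod (Z x f))\<^sup>2 / \<beta> x) * (\<Sum>x<K. \<beta> x))"
  proof (rule sum_mono)
    fix f
    have "(\<Sum>x<K. Z x f) = (\<Sum>x<K. (Z x f / of_real (sqrt (\<beta> x))) * of_real (sqrt (\<beta> x)))"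
      using Z0 pos by (intro sum.cong refl) auto
    also have "(cmod \<dots>)\<^sup>2 \<le> (\<Sum>x<K. (cmod (Z x f / of_real (sqrt (\<beta> x))))\<^sup>2)
        * (\<Sum>x<K. (cmod (of_real (sqrt (\<beta> x))))\<^sup>2)"
      by (rule Cauchy_Schwarz_cmod)
    also have "\<dots> = (\<Sum>x<K. (cmod (Z x f))\<^sup>2 / \<beta> x) * (\<Sum>x<K. \<beta> x)"
      using pos by (simp add: norm_divide power_divide)
    finally show "(cmod (\<Sum>x<K. Z x f))\<^sup>2 \<le> (\<Sum>x<K. (cmod (Z x f))\<^sup>2 / \<beta> x) * (\<Sum>x<K. \<beta> x)" .
  qed
  also have "\<dots> = (\<Sum>x<K. (\<Sum>f<D. (cmod (Z x f))\<^sup>2) / \<beta> x) * (\<Sum>x<K. \<beta> x)"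
    by (simp only: sum_distrib_right[symmetric] sum_divide_distrib sum.swap[of _ "{..<D}" "{..<K}"])
  also have "\<dots> \<le> (\<Sum>x<K. \<alpha> x) * (\<Sum>x<K. \<beta> x)"
  proof (intro mult_right_mono sum_mono)
    fix x
    show "(\<Sum>f<D. (cmod (Z x f))\<^sup>2) / \<beta> x \<le> \<alpha> x"
      using Zle[of x] pos[of x] by (cases "\<beta> x = 0") (auto simp: divide_le_eq)
  qed (use pos in \<open>auto intro: sum_nonneg\<close>)
  also have "(\<Sum>x<K. \<alpha> x) = (\<Sum>b<d. (cmod (v b))\<^sup>2)"
    unfolding \<alpha>_def s_def by (rule povm)
  finally show ?thesis
    unfolding privacy_test_def sw Z_def[symmetric] \<beta>_def t_def[symmetric]
    by (rule divide_right_mono) simp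
qed

section \<open>Tensor powers indexed by digits\<close>

lemma sum_lessThan_mult:
  fixes f :: "nat \<Rightarrow> 'a :: comm_monoid_add"
  shows "(\<Sum>r<m * k. f r) = (\<Sum>i<m. \<Sum>j<k. f (i * k + j))"
proof -
  have "(\<Sum>j<k. f (i * k + j)) = sum f {i * k..<i * k + k}" for i
    by (rule sum.reindex_bij_witness[of _ "\<lambda>r. r - i * k" "\<lambda>j. i * k + j"]) auto
  thus ?thesis by (simp add: sum.nat_group)
qed

text \<open>Site i of a tensor power is read off as the i-th digit, counted from the least
  significant one. This runs against the order of \<open>kron\<close>, whose first factor is the
  most significant, but all factors of \<open>kron_pow\<close> are equal.\<close>

definition dig :: "nat \<Rightarrow> nat \<Rightarrow> nat \<Rightarrow> nat" where
  "dig d c i = c div d ^ i mod d"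

lemma dig_less [simp]: "d > 0 \<Longrightarrow> dig d c i < d"
  by (simp add: dig_def)

lemma dig_add_high:
  assumes "i < n" shows "dig d (k * d ^ n + c) i = dig d c i"
proof (cases "d = 0")
  case False
  obtain m where n: "n = i + Suc m" using assms less_imp_add_positive by (metis Suc_pred)
  have *: "k * d ^ n + c = c + d ^ i * (k * d ^ m * d)" by (simp add: n power_add mult_ac)
  show ?thesis using False unfolding dig_def * by (simp add: div_mult_self2)
qed (use assms in \<open>cases n; simp add: dig_def\<close>)

lemma dig_add_top:
  assumes "c < d ^ n" "k < d" shows "dig d (k * d ^ n + c) n = k"
  using assms by (simp add: dig_def)

lemma dig_mod: "i < n \<Longrightarrow> dig d (c mod d ^ n) i = dig d c i"
  using dig_add_high[of i n d "c div d ^ n" "c mod d ^ n"] by (simp only: div_mult_mod_eq)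

text \<open>The distributive law over digit strings; it reduces identities for tensor powers to a
  single site. The summand may depend on the site because fixed row and column indices have
  different digits at different sites.\<close>

lemma sum_prod_dig:
  fixes f :: "nat \<Rightarrow> nat \<Rightarrow> 'a :: comm_semiring_1"
  shows "(\<Sum>c<d ^ n. \<Prod>i<n. f i (dig d c i)) = (\<Prod>i<n. \<Sum>k<d. f i k)"
proof (induction n)
  case (Suc n)
  have "(\<Sum>c<d ^ Suc n. \<Prod>i<Suc n. f i (dig d c i))
      = (\<Sum>k<d. \<Sum>c<d ^ n. (\<Prod>i<n. f i (dig d c i)) * f n k)"
    unfolding power_Suc sum_lessThan_mult
    by (intro sum.cong refl) (simp add: dig_add_high dig_add_top)
  also have "\<dots> = (\<Sum>c<d ^ n. \<Prod>i<n. f i (dig d c i)) * (\<Sum>k<d. f n k)"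
    by (simp only: sum_distrib_left[symmetric] sum_distrib_right[symmetric])
  finally show ?case using Suc by simp
qed simp

lemma sum_dig: "(\<Sum>i<n. dig d c i * d ^ i) = c mod d ^ n"
proof (induction n)
  case (Suc n)
  have "c mod d ^ Suc n = d ^ n * (c div d ^ n mod d) + c mod d ^ n"
    by (metis mod_mult2_eq power_Suc2)
  thus ?case using Suc by (simp add: dig_def mult.commute)
qed simp

lemma undig_less:
  fixes e :: "nat \<Rightarrow> nat"
  assumes "\<And>i. i < n \<Longrightarrow> e i < d" shows "(\<Sum>i<n. e i * d ^ i) < d ^ n"
  using assms
proof (induction n)
  case (Suc n)
  have "(\<Sum>i<n. e i * d ^ i) < d ^ n" using Suc by simp
  moreover have "(e n + 1) * d ^ n \<le> d * d ^ n" using Suc.prems[of n] by (intro mult_right_mono) auto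
  ultimately show ?case by simp
qed simp

lemma dig_undig:
  fixes e :: "nat \<Rightarrow> nat"
  assumes "\<And>i. i < n \<Longrightarrow> e i < d" "j < n" shows "dig d (\<Sum>i<n. e i * d ^ i) j = e j"
  using assms
proof (induction n)
  case (Suc n)
  have lt: "(\<Sum>i<n. e i * d ^ i) < d ^ n" using Suc.prems by (intro undig_less) simp
  show ?case
  proof (cases "j = n")
    case True
    have "dig d (e n * d ^ n + (\<Sum>i<n. e i * d ^ i)) n = e n"
      using lt Suc.prems(1)[of n] by (intro dig_add_top) auto
    thus ?thesis using True by (simp add: add.commute)
  next
    case False
    hence j: "j < n" using Suc.prems by simp
    have "dig d (e n * d ^ n + (\<Sum>i<n. e i * d ^ i)) j = e j"
      using j Suc by (simp add: dig_add_high)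
    thus ?thesis by (simp add: add.commute)
  qed
qed simp

lemma dig_eqI:
  assumes "a < d ^ n" "b < d ^ n" "\<And>i. i < n \<Longrightarrow> dig d a i = dig d b i"
  shows "a = b"
proof -
  have "(\<Sum>i<n. dig d a i * d ^ i) = (\<Sum>i<n. dig d b i * d ^ i)"
    by (intro sum.cong refl arg_cong2[where f="(*)"] assms(3)) simp
  thus ?thesis unfolding sum_dig using assms(1,2) by simp
qed

lemma prod_dig_delta:
  assumes "a < d ^ n" "b < d ^ n"
  shows "(\<Prod>i<n. if dig d a i = dig d b i then 1 else 0) = (if a = b then 1 else 0 :: 'a :: comm_semiring_1)"
proof (cases "a = b")
  case False
  then obtain i where "i < n" "dig d a i \<noteq> dig d b i" using dig_eqI[OF assms] by blast
  hence "(\<Prod>i<n. if dig d a i = dig d b i then 1 else 0 :: 'a) = 0"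
    by (intro prod_zero) auto
  thus ?thesis using False by simp
qed simp

section \<open>Pauli strings\<close>

text \<open>
  The index \<open>s < 4\<close> stands for \<open>I, X, Y, Z\<close>. The vectors \<open>pauli_ev t\<close> with \<open>t < 6\<close> are the eigenvectors of
  \<open>X, X, Y, Y, Z, Z\<close>; those of \<open>X\<close> and \<open>Y\<close> have squared norm 2, which the factor \<open>1/4\<close> in \<open>ev_weight\<close> makes up for.
\<close>

definition pauli :: "nat \<Rightarrow> nat \<Rightarrow> nat \<Rightarrow> complex" where
  "pauli s b a = (if s = 0 then (if b = a then 1 else 0)
    else if s = 1 then (if b = a then 0 else 1)
    else if s = 2 then (if b = a then 0 else if b = 0 then - \<i> else \<i>)
    else (if b = a then (if b = 0 then 1 else - 1) else 0))"

definition pauli_ev :: "nat \<Rightarrow> nat \<Rightarrow> complex" where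
  "pauli_ev t b = (if t < 4 then (if b = 0 then 1 else [1, - 1, \<i>, - \<i>] ! t)
    else (if b = t - 4 then 1 else 0))"

definition ev_weight :: "(nat \<Rightarrow> real) \<Rightarrow> nat \<Rightarrow> real" where
  "ev_weight r t = (if t < 4 then r (t div 2) / 4 else r 2)"

lemma sum_lessThan_2_4_6:
  fixes f :: "nat \<Rightarrow> 'a :: comm_monoid_add"
  shows "(\<Sum>t<2. f t) = f 0 + f (Suc 0)"
    and "(\<Sum>t<4. f t) = f 0 + f (Suc 0) + f 2 + f 3"
    and "(\<Sum>t<6. f t) = f 0 + f (Suc 0) + f 2 + f 3 + f 4 + f 5"
  by (simp_all add: numeral_eq_Suc)

lemma pauli_ev_table:
  "pauli_ev 0 0 = 1" "pauli_ev 0 (Suc 0) = 1"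
  "pauli_ev (Suc 0) 0 = 1" "pauli_ev (Suc 0) (Suc 0) = - 1"
  "pauli_ev 2 0 = 1" "pauli_ev 2 (Suc 0) = \<i>"
  "pauli_ev 3 0 = 1" "pauli_ev 3 (Suc 0) = - \<i>"
  "pauli_ev 4 0 = 1" "pauli_ev 4 (Suc 0) = 0"
  "pauli_ev 5 0 = 0" "pauli_ev 5 (Suc 0) = 1"
  by (simp_all add: pauli_ev_def)

lemma pauli_table:
  "pauli 0 0 0 = 1" "pauli 0 0 (Suc 0) = 0" "pauli 0 (Suc 0) 0 = 0" "pauli 0 (Suc 0) (Suc 0) = 1"
  "pauli (Suc 0) 0 0 = 0" "pauli (Suc 0) 0 (Suc 0) = 1" "pauli (Suc 0) (Suc 0) 0 = 1" "pauli (Suc 0) (Suc 0) (Suc 0) = 0"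
  "pauli 2 0 0 = 0" "pauli 2 0 (Suc 0) = - \<i>" "pauli 2 (Suc 0) 0 = \<i>" "pauli 2 (Suc 0) (Suc 0) = 0"
  "pauli 3 0 0 = 1" "pauli 3 0 (Suc 0) = 0" "pauli 3 (Suc 0) 0 = 0" "pauli 3 (Suc 0) (Suc 0) = - 1"
  by (simp_all add: pauli_def)

lemma ev_weight_table:
  "ev_weight r 0 = r 0 / 4" "ev_weight r (Suc 0) = r 0 / 4" "ev_weight r 2 = r (Suc 0) / 4"
  "ev_weight r 3 = r (Suc 0) / 4" "ev_weight r 4 = r 2" "ev_weight r 5 = r 2"
  by (simp_all add: ev_weight_def)

lemma pauli_unitary:
  assumes "s < 4" "a < 2" "a' < 2"
  shows "(\<Sum>b<2. cnj (pauli s b a) * pauli s b a') = (if a = a' then 1 else 0)"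
proof -
  have s: "s = 0 \<or> s = Suc 0 \<or> s = 2 \<or> s = 3" using assms by auto
  have "a = 0 \<or> a = Suc 0" "a' = 0 \<or> a' = Suc 0" using assms by auto
  with s show ?thesis
    by (elim disjE; simp add: sum_lessThan_2_4_6 pauli_table)
qed

text \<open>Trace preservation of the measure-and-prepare map: the squared norm of the prepared
  vector weighs the outcome, and each of the three eigenbases contributes its \<open>r\<close> times
  the identity.\<close>

lemma pauli_ev_resolution:
  assumes "a < 2" "a' < 2"
  shows "(\<Sum>t<6. complex_of_real (ev_weight r t * (\<Sum>b<2. (cmod (pauli_ev t b))\<^sup>2)) * (pauli_ev t a * cnj (pauli_ev t a')))
    = (if a = a' then of_real (r 0 + r 1 + r 2) else 0)"
proof -
  have "a = 0 \<or> a = Suc 0" "a' = 0 \<or> a' = Suc 0" using assms by auto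
  thus ?thesis
    by (elim disjE; simp add: sum_lessThan_2_4_6 pauli_ev_table ev_weight_table)
qed

text \<open>Both sides are the Choi kernel of one mixture of the three dephasing maps, written on
  the left with the Kraus operators I and \<sigma>, on the right with the rank-one operators of the
  eigenvectors of \<sigma>.\<close>

lemma pauli_twirl_eq_measure_prepare:
  assumes "b < 2" "a < 2" "b' < 2" "a' < 2"
  shows "(\<Sum>s<4. complex_of_real ((if s = 0 then r 0 + r 1 + r 2 else r (s - 1)) / 2) * (pauli s b a * cnj (pauli s b' a')))
    = (\<Sum>t<6. complex_of_real (ev_weight r t) * ((pauli_ev t b * cnj (pauli_ev t a)) * cnj (pauli_ev t b' * cnj (pauli_ev t a'))))"
proof -
  have "b = 0 \<or> b = Suc 0" "a = 0 \<or> a = Suc 0" "b' = 0 \<or> b' = Suc 0" "a' = 0 \<or> a' = Suc 0"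
    using assms by auto
  thus ?thesis
    by (elim disjE; hypsubst_thin; simp add: sum_lessThan_2_4_6 pauli_table pauli_ev_table ev_weight_table; simp add: field_simps)
qed

section \<open>Products of Pauli matrices and of eigenvectors over the sites\<close>

definition tens :: "nat \<Rightarrow> nat \<Rightarrow> (nat \<Rightarrow> nat \<Rightarrow> nat \<Rightarrow> complex) \<Rightarrow> nat \<Rightarrow> nat \<Rightarrow> nat \<Rightarrow> complex" where
  "tens m n A s b a = (\<Prod>i<n. A (dig m s i) (dig 2 b i) (dig 2 a i))"

definition wprod :: "nat \<Rightarrow> nat \<Rightarrow> (nat \<Rightarrow> real) \<Rightarrow> nat \<Rightarrow> real" where
  "wprod m n w s = (\<Prod>i<n. w (dig m s i))"

lemma sum_wprod: "(\<Sum>s<m ^ n. wprod m n w s) = (\<Sum>s<m. w s) ^ n"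
  unfolding wprod_def using sum_prod_dig[where f="\<lambda>_. w" and n=n and d=m] by simp

lemma kernel_tens:
  "(\<Sum>s<m ^ n. complex_of_real (wprod m n w s) * (tens m n A s b a * cnj (tens m n A s b' a')))
    = (\<Prod>i<n. \<Sum>s<m. complex_of_real (w s) * (A s (dig 2 b i) (dig 2 a i) * cnj (A s (dig 2 b' i) (dig 2 a' i))))"
  by (simp only: wprod_def tens_def of_real_prod cnj_prod prod.distrib[symmetric]
      sum_prod_dig[of "\<lambda>i s. complex_of_real (w s) * (A s (dig 2 b i) (dig 2 a i) * cnj (A s (dig 2 b' i) (dig 2 a' i)))"])

text \<open>With product weights the kernel factorises over the sites, so agreement on one site
  suffices.\<close>

lemma kernel_tens_cong:
  assumes "\<And>b a b' a'. b < 2 \<Longrightarrow> a < 2 \<Longrightarrow> b' < 2 \<Longrightarrow> a' < 2 \<Longrightarrow>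
      (\<Sum>s<m. complex_of_real (w s) * (A s b a * cnj (A s b' a'))) = (\<Sum>t<m'. complex_of_real (w' t) * (A' t b a * cnj (A' t b' a')))"
  shows "(\<Sum>s<m ^ n. complex_of_real (wprod m n w s) * (tens m n A s b a * cnj (tens m n A s b' a')))
    = (\<Sum>t<m' ^ n. complex_of_real (wprod m' n w' t) * (tens m' n A' t b a * cnj (tens m' n A' t b' a')))"
  unfolding kernel_tens by (intro prod.cong refl assms) simp_all

lemma tens_pauli_orthonormal: "orthonormal {..<2 ^ n} {..<2 ^ n} (\<lambda>a b. tens 4 n pauli s b a)"
  unfolding orthonormal_def
proof (intro ballI)
  fix a a' assume a: "a \<in> {..<(2::nat) ^ n}" "a' \<in> {..<(2::nat) ^ n}"
  have "(\<Sum>b<2 ^ n. cnj (tens 4 n pauli s b a) * tens 4 n pauli s b a')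
      = (\<Prod>i<n. \<Sum>b<2. cnj (pauli (dig 4 s i) b (dig 2 a i)) * pauli (dig 4 s i) b (dig 2 a' i))"
    by (simp only: tens_def cnj_prod prod.distrib[symmetric]
      sum_prod_dig[of "\<lambda>i b. cnj (pauli (dig 4 s i) b (dig 2 a i)) * pauli (dig 4 s i) b (dig 2 a' i)"])
  also have "\<dots> = (\<Prod>i<n. if dig 2 a i = dig 2 a' i then 1 else 0)"
    by (intro prod.cong refl pauli_unitary) simp_all
  also have "\<dots> = (if a = a' then 1 else 0)"
    using a by (intro prod_dig_delta) auto
  finally show "(\<Sum>b<2 ^ n. cnj (tens 4 n pauli s b a) * tens 4 n pauli s b a') = (if a = a' then 1 else 0)" .
qed

definition ev_tens :: "nat \<Rightarrow> nat \<Rightarrow> nat \<Rightarrow> complex" where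
  "ev_tens n t b = (\<Prod>i<n. pauli_ev (dig 6 t i) (dig 2 b i))"

lemma tens_ev: "tens 6 n (\<lambda>t b a. pauli_ev t b * cnj (pauli_ev t a)) t b a = ev_tens n t b * cnj (ev_tens n t a)"
  by (simp add: tens_def ev_tens_def prod.distrib)

lemma ev_tens_norm: "(\<Sum>b<2 ^ n. (cmod (ev_tens n t b))\<^sup>2) = wprod 6 n (\<lambda>t. \<Sum>b<2. (cmod (pauli_ev t b))\<^sup>2) t"
  by (simp only: ev_tens_def wprod_def prod_power_distrib prod_norm[symmetric]
      sum_prod_dig[of "\<lambda>i b. (cmod (pauli_ev (dig 6 t i) b))\<^sup>2"])

lemma ev_tens_resolution:
  assumes r: "r 0 + r 1 + r 2 = 1" and a: "a < 2 ^ n" "a' < 2 ^ n"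
  shows "(\<Sum>t<6 ^ n. complex_of_real (wprod 6 n (ev_weight r) t * (\<Sum>b<2 ^ n. (cmod (ev_tens n t b))\<^sup>2))
      * (ev_tens n t a * cnj (ev_tens n t a'))) = (if a = a' then 1 else 0)"
proof -
  let ?f = "\<lambda>i t. complex_of_real (ev_weight r t * (\<Sum>b<2. (cmod (pauli_ev t b))\<^sup>2))
      * (pauli_ev t (dig 2 a i) * cnj (pauli_ev t (dig 2 a' i)))"
  have "complex_of_real (wprod 6 n (ev_weight r) t * (\<Sum>b<2 ^ n. (cmod (ev_tens n t b))\<^sup>2))
      * (ev_tens n t a * cnj (ev_tens n t a')) = (\<Prod>i<n. ?f i (dig 6 t i))" for t
    unfolding ev_tens_norm by (simp add: ev_tens_def wprod_def prod.distrib)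
  hence "(\<Sum>t<6 ^ n. complex_of_real (wprod 6 n (ev_weight r) t * (\<Sum>b<2 ^ n. (cmod (ev_tens n t b))\<^sup>2))
      * (ev_tens n t a * cnj (ev_tens n t a'))) = (\<Prod>i<n. \<Sum>t<6. ?f i t)"
    by (simp only: sum_prod_dig[of ?f])
  also have "\<dots> = (\<Prod>i<n. if dig 2 a i = dig 2 a' i then 1 else 0)"
    using r by (intro prod.cong refl) (simp add: pauli_ev_resolution del: of_real_mult)
  also have "\<dots> = (if a = a' then 1 else 0)" using a by (rule prod_dig_delta)
  finally show ?thesis .
qed

text \<open>Parseval for a weighted resolution of the identity. The vectors \<open>v t\<close> may
  be neither orthogonal nor normalised, as is the case for eigenvectors from three different
  bases.\<close>

lemma resolution_norm:
  fixes v :: "'t \<Rightarrow> nat \<Rightarrow> complex" and w :: "'t \<Rightarrow> real"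
  assumes "\<And>a a'. a < d \<Longrightarrow> a' < d \<Longrightarrow> (\<Sum>t\<in>T. of_real (w t) * (v t a * cnj (v t a'))) = (if a = a' then 1 else 0)"
  shows "(\<Sum>t\<in>T. w t * (cmod (\<Sum>a<d. cnj (v t a) * y a))\<^sup>2) = (\<Sum>a<d. (cmod (y a))\<^sup>2)"
proof -
  have "complex_of_real ((cmod (\<Sum>a<d. cnj (v t a) * y a))\<^sup>2)
      = (\<Sum>a'<d. \<Sum>a<d. (cnj (v t a') * y a') * cnj (cnj (v t a) * y a))" for t
    by (simp only: complex_norm_square cnj_sum sum_product)
  hence "complex_of_real (\<Sum>t\<in>T. w t * (cmod (\<Sum>a<d. cnj (v t a) * y a))\<^sup>2)
      = (\<Sum>t\<in>T. \<Sum>a'<d. \<Sum>a<d. y a' * cnj (y a) * (of_real (w t) * (v t a * cnj (v t a'))))"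
    unfolding of_real_sum of_real_mult by (simp add: sum_distrib_left mult_ac)
  also have "\<dots> = (\<Sum>a'<d. \<Sum>a<d. \<Sum>t\<in>T. y a' * cnj (y a) * (of_real (w t) * (v t a * cnj (v t a'))))"
    by (rule sum_rotate3[symmetric])
  also have "\<dots> = (\<Sum>a'<d. \<Sum>a<d. y a' * cnj (y a) * (if a = a' then 1 else 0))"
    by (intro sum.cong refl) (simp only: sum_distrib_left[symmetric] assms lessThan_iff)
  also have "\<dots> = (\<Sum>a'<d. y a' * cnj (y a'))"
    by (simp only: sum_mult_delta finite_lessThan) (intro sum.cong refl, simp)
  also have "\<dots> = complex_of_real (\<Sum>a<d. (cmod (y a))\<^sup>2)"
    by (simp add: complex_norm_square[symmetric])
  finally show ?thesis using of_real_eq_iff by blast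
qed

text \<open>The rank-one bound leaves, for each string of eigenvectors, the probabilities of this
  outcome in the code states. The resolution of the identity sums them to the trace of each state,
  so the messages contribute \<open>K\<close> in total against the square of \<open>K\<close> in the
  denominator.\<close>

lemma privacy_test_measure_prepare_le:
  fixes r :: "nat \<Rightarrow> real" and d n K :: nat
  defines "d \<equiv> 2 ^ n"
  assumes K: "K > 0" and r: "\<And>i. r i \<ge> 0" "r 0 + r 1 + r 2 = 1"
    and contr: "\<And>x v. (\<Sum>f<D. (cmod (\<Sum>p\<in>{..<d}\<times>{..<d}. C x f p * v p))\<^sup>2) \<le> (\<Sum>p\<in>{..<d}\<times>{..<d}. (cmod (v p))\<^sup>2)"
    and povm: "\<And>v. (\<Sum>x<K. \<Sum>c<d. (cmod (\<Sum>b<d. S x c b * v b))\<^sup>2) = (\<Sum>b<d. (cmod (v b))\<^sup>2)"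
    and dens: "\<And>x. x < K \<Longrightarrow> (\<Sum>k<d. \<Sum>a<d. (cmod (R x a k))\<^sup>2) = 1"
  shows "(\<Sum>s<4 ^ n. wprod 4 n (\<lambda>s. (if s = 0 then 1 else r (s - 1)) / 2) s * privacy_test D d K C S R (tens 4 n pauli s)) \<le> 1 / real K"
proof -
  let ?w = "wprod 6 n (ev_weight r)"
  let ?N = "\<lambda>t. \<Sum>b<d. (cmod (ev_tens n t b))\<^sup>2"
  have w0: "0 \<le> ?w t" for t using r(1) by (auto simp: wprod_def ev_weight_def intro!: prod_nonneg)
  have single: "(\<Sum>s<4. complex_of_real ((if s = 0 then 1 else r (s - 1)) / 2) * (pauli s b a * cnj (pauli s b' a')))
      = (\<Sum>t<6. complex_of_real (ev_weight r t) * ((pauli_ev t b * cnj (pauli_ev t a)) * cnj (pauli_ev t b' * cnj (pauli_ev t a'))))"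
    if "b < 2" "a < 2" "b' < 2" "a' < 2" for b a b' a'
    using pauli_twirl_eq_measure_prepare[OF that, of r] unfolding r(2) .
  have "(\<Sum>s<4 ^ n. wprod 4 n (\<lambda>s. (if s = 0 then 1 else r (s - 1)) / 2) s * privacy_test D d K C S R (tens 4 n pauli s))
      = (\<Sum>t<6 ^ n. ?w t * privacy_test D d K C S R (tens 6 n (\<lambda>t b a. pauli_ev t b * cnj (pauli_ev t a)) t))"
    by (rule privacy_test_kernel_cong, rule kernel_tens_cong, rule single)
  also have "\<dots> = (\<Sum>t<6 ^ n. ?w t * privacy_test D d K C S R (\<lambda>b a. ev_tens n t b * cnj (ev_tens n t a)))"
    by (simp only: tens_ev[abs_def])
  also have "\<dots> \<le> (\<Sum>t<6 ^ n. ?w t * (?N t * (\<Sum>x<K. \<Sum>k<d. (cmod (\<Sum>a<d. cnj (ev_tens n t a) * R x a k))\<^sup>2) / (real K)\<^sup>2))"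
    by (intro sum_mono mult_left_mono privacy_test_rank_one_le K contr povm w0)
  also have "\<dots> = (\<Sum>t<6 ^ n. \<Sum>x<K. \<Sum>k<d. (?w t * ?N t) * (cmod (\<Sum>a<d. cnj (ev_tens n t a) * R x a k))\<^sup>2) / (real K)\<^sup>2"
    by (simp add: sum_divide_distrib[symmetric] sum_distrib_left[symmetric] mult.assoc)
  also have "(\<Sum>t<6 ^ n. \<Sum>x<K. \<Sum>k<d. (?w t * ?N t) * (cmod (\<Sum>a<d. cnj (ev_tens n t a) * R x a k))\<^sup>2)
      = (\<Sum>x<K. \<Sum>k<d. \<Sum>t<6 ^ n. (?w t * ?N t) * (cmod (\<Sum>a<d. cnj (ev_tens n t a) * R x a k))\<^sup>2)"
    by (rule sum_rotate3[symmetric])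
  also have "\<dots> = (\<Sum>x<K. \<Sum>k<d. \<Sum>a<d. (cmod (R x a k))\<^sup>2)"
    by (intro sum.cong refl resolution_norm) (simp only: d_def ev_tens_resolution[OF r(2)])
  also have "\<dots> = real K" by (simp add: dens)
  finally show ?thesis using K by (simp add: power2_eq_square)
qed

text \<open>
  A Chernoff bound in disguise: for each string either the weight \<open>P\<close> is at most \<open>exp (n c)\<close> times \<open>Q\<close>, or
  \<open>\<Prod>i. exp (\<theta> * (g - c))\<close> is at least 1.
\<close>

lemma likelihood_split:
  fixes P Q g :: "nat \<Rightarrow> real"
  assumes T: "\<And>s. 0 \<le> T s" "\<And>s. T s \<le> 1" and m: "m > 0" and Q: "\<And>s. s < m \<Longrightarrow> 0 \<le> Q s"
    and ratio: "\<And>s. s < m \<Longrightarrow> P s = 0 \<or> P s = Q s * exp (g s)"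
    and \<theta>: "\<theta> \<ge> 0"
  shows "(\<Sum>s<m ^ n. wprod m n P s * T s)
    \<le> exp (real n * c) * (\<Sum>s<m ^ n. wprod m n Q s * T s) + (\<Sum>s<m. P s * exp (\<theta> * (g s - c))) ^ n"
proof -
  have P: "0 \<le> P s" if "s < m" for s using ratio[OF that] Q[OF that] by auto
  have one: "wprod m n P s * T s
      \<le> exp (real n * c) * (wprod m n Q s * T s) + wprod m n (\<lambda>s. P s * exp (\<theta> * (g s - c))) s" for s
  proof -
    define L where "L = (\<Sum>i<n. g (dig m s i) - c)"
    have Q0: "0 \<le> wprod m n Q s" and P0: "0 \<le> wprod m n P s"
      unfolding wprod_def using m by (auto intro!: prod_nonneg Q P)
    have X: "wprod m n (\<lambda>s. P s * exp (\<theta> * (g s - c))) s = wprod m n P s * exp (\<theta> * L)"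
      by (simp add: wprod_def prod.distrib exp_sum L_def sum_distrib_left)
    \<comment> \<open>A zero weight at one site annihilates the whole product, so the exponential
      formula is needed only where every factor of \<open>P\<close> is nonzero.\<close>
    consider "wprod m n P s = 0" | "wprod m n P s = wprod m n Q s * exp (L + real n * c)"
    proof (cases "\<exists>i<n. P (dig m s i) = 0")
      case True
      hence "wprod m n P s = 0" unfolding wprod_def by (intro prod_zero) auto
      thus ?thesis using that by blast
    next
      case False
      hence "wprod m n P s = (\<Prod>i<n. Q (dig m s i) * exp (g (dig m s i)))"
        unfolding wprod_def using ratio m by (intro prod.cong refl) (metis dig_less lessThan_iff)
      also have "\<dots> = wprod m n Q s * exp (L + real n * c)"
        by (simp add: wprod_def prod.distrib exp_sum L_def sum_subtractf)
      finally show ?thesis using that by blast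
    qed
    thus ?thesis
    proof cases
      case 1
      thus ?thesis unfolding X using Q0 T by simp
    next
      case 2
      show ?thesis
      proof (cases "L \<le> 0")
        case True
        have "wprod m n P s * T s \<le> (wprod m n Q s * exp (real n * c)) * T s"
          unfolding 2 using True Q0 T by (intro mult_right_mono mult_left_mono) auto
        moreover have "0 \<le> wprod m n P s * exp (\<theta> * L)" using P0 by simp
        ultimately show ?thesis unfolding X by (simp add: mult_ac)
      next
        case False
        have "1 \<le> exp (\<theta> * L)" using False \<theta> by simp
        have "wprod m n P s * T s \<le> wprod m n P s * exp (\<theta> * L)"
          by (rule mult_left_mono[OF order_trans[OF T(2) \<open>1 \<le> exp (\<theta> * L)\<close>] P0])
        moreover have "0 \<le> exp (real n * c) * (wprod m n Q s * T s)" using Q0 T by simp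
        ultimately show ?thesis unfolding X by linarith
      qed
    qed
  qed
  have "(\<Sum>s<m ^ n. wprod m n P s * T s)
      \<le> (\<Sum>s<m ^ n. exp (real n * c) * (wprod m n Q s * T s) + wprod m n (\<lambda>s. P s * exp (\<theta> * (g s - c))) s)"
    by (intro sum_mono one)
  thus ?thesis by (simp only: sum.distrib sum_distrib_left sum_wprod)
qed

text \<open>Stacking the operators \<open>A e\<close> gives one matrix with orthonormal columns, to
  which Parseval applies.\<close>

lemma kraus_isometry:
  fixes d :: nat
  assumes "orthonormal (E \<times> {..<d}) {..<d} (\<lambda>a (e, b). A e b a)"
  shows "(\<Sum>e\<in>E. \<Sum>b<d. (cmod (\<Sum>a<d. A e b a * v a))\<^sup>2) = (\<Sum>a<d. (cmod (v a))\<^sup>2)"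
proof -
  have "(\<Sum>e\<in>E. \<Sum>b<d. (cmod (\<Sum>a<d. A e b a * v a))\<^sup>2)
      = (\<Sum>p\<in>E \<times> {..<d}. (cmod (\<Sum>a<d. v a * (case p of (e, b) \<Rightarrow> A e b a)))\<^sup>2)"
    by (simp add: sum.cartesian_product case_prod_beta mult.commute)
  also have "\<dots> = (\<Sum>a<d. (cmod (v a))\<^sup>2)"
    by (rule parseval[OF finite_lessThan assms])
  finally show ?thesis .
qed

text \<open>The error weights are written as q times a probability vector \<open>r\<close>, so that
  the comparison weights r / 2 involve no division by q and q = 0 is covered. The threshold
  \<open>c\<close> and the Chernoff parameter \<open>\<theta>\<close> stay free until the
  asymptotics.\<close>

lemma privacy_bound:
  fixes U :: "nat \<Rightarrow> nat \<Rightarrow> nat \<Rightarrow> complex" and r :: "nat \<Rightarrow> real" and q \<epsilon> \<theta> c :: real and K dE n :: nat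
    and S R :: "nat \<Rightarrow> nat \<Rightarrow> nat \<Rightarrow> complex"
  defines "d \<equiv> 2 ^ n" and "D \<equiv> dE ^ n"
  defines "A \<equiv> tens dE n U"
  assumes K: "K > 0" and eps: "\<epsilon> \<le> 1" and q: "0 \<le> q" "q \<le> 1"
    and r: "\<And>i. r i \<ge> 0" "r 0 + r 1 + r 2 = 1" and \<theta>: "\<theta> \<ge> 0"
    and choi: "\<And>b a b' a'. b < 2 \<Longrightarrow> a < 2 \<Longrightarrow> b' < 2 \<Longrightarrow> a' < 2 \<Longrightarrow>
      (\<Sum>e<dE. U e b a * cnj (U e b' a'))
        = (\<Sum>s<4. complex_of_real (if s = 0 then 1 - q else q * r (s - 1)) * (pauli s b a * cnj (pauli s b' a')))"
    and povm: "\<And>v. (\<Sum>x<K. \<Sum>c<d. (cmod (\<Sum>b<d. S x c b * v b))\<^sup>2) = (\<Sum>b<d. (cmod (v b))\<^sup>2)"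
    and dens: "\<And>x. x < K \<Longrightarrow> (\<Sum>k<d. \<Sum>a<d. (cmod (R x a k))\<^sup>2) = 1"
    and close: "\<And>u. (\<And>x. x < K \<Longrightarrow> orthonormal {..<D} {..<D} (u x)) \<Longrightarrow>
      (\<Sum>x<K. \<Sum>k<D. cmod (qform D (\<lambda>i j.
         (\<Sum>p\<in>{..<d} \<times> {..<d}. sandwich d (S x) (R x) (A i) p * cnj (sandwich d (S x) (R x) (A j) p))
         - (\<Sum>x<K. \<Sum>p\<in>{..<d} \<times> {..<d}. (\<Sum>a<d. A i (fst p) a * R x a (snd p)) * cnj (\<Sum>a<d. A j (fst p) a * R x a (snd p)))
           / of_nat K) (u x k))) \<le> real K * \<epsilon>"
  shows "(1 - \<epsilon>)\<^sup>2 \<le> exp (real n * c) / real K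
    + ((1 - q) * exp (\<theta> * (ln (2 * (1 - q)) - c)) + q * exp (\<theta> * (ln (2 * q) - c))) ^ n"
proof -
  let ?Q = "{..<d} \<times> {..<d}"
  define P where "P s = (if s = 0 then 1 - q else q * r (s - 1))" for s :: nat
  define Q where "Q s = (if s = 0 then 1 else r (s - 1)) / 2" for s :: nat
  \<comment> \<open>The logarithm of P / Q. The factor \<open>r\<close> cancels, so the three errors
    share the value ln (2 q).\<close>
  define g where "g s = (if s = 0 then ln (2 * (1 - q)) else ln (2 * q))" for s :: nat
  have r1: "r 0 + r (Suc 0) + r 2 = 1" using r(2) by simp
  have Psum: "(\<Sum>s<4. P s) = 1"
    using r1 by (simp add: P_def sum_lessThan_2_4_6 flip: distrib_left)
  have single: "(\<Sum>e<dE. complex_of_real 1 * (U e b a * cnj (U e b' a')))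
      = (\<Sum>s<4. complex_of_real (P s) * (pauli s b a * cnj (pauli s b' a')))"
    if "b < 2" "a < 2" "b' < 2" "a' < 2" for b a b' a'
    using choi[OF that] by (simp add: P_def)
  have kernel: "(\<Sum>e<D. complex_of_real (wprod dE n (\<lambda>_. 1) e) * (A e b a * cnj (A e b' a')))
      = (\<Sum>s<4 ^ n. complex_of_real (wprod 4 n P s) * (tens 4 n pauli s b a * cnj (tens 4 n pauli s b' a')))" for b a b' a'
    unfolding A_def D_def by (rule kernel_tens_cong) (rule single)
  have w1: "wprod dE n (\<lambda>_. 1) e = 1" for e by (simp add: wprod_def)
  \<comment> \<open>Trace preservation on n sites, read off the Pauli form of the kernel: every
    Pauli string has orthonormal columns and the weights \<open>P\<close> sum to 1.\<close>
  have on: "orthonormal ({..<D} \<times> {..<d}) {..<d} (\<lambda>a (e, b). A e b a)"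
    unfolding orthonormal_def
  proof (intro ballI)
    fix a a' assume a: "a \<in> {..<d}" "a' \<in> {..<d}"
    have "(\<Sum>p\<in>{..<D} \<times> {..<d}. cnj (case p of (e, b) \<Rightarrow> A e b a) * (case p of (e, b) \<Rightarrow> A e b a'))
        = (\<Sum>e<D. \<Sum>b<d. complex_of_real (wprod dE n (\<lambda>_. 1) e) * (A e b a' * cnj (A e b a)))"
      by (simp add: w1 sum.cartesian_product case_prod_beta mult.commute)
    also have "\<dots> = (\<Sum>b<d. \<Sum>s<4 ^ n. complex_of_real (wprod 4 n P s) * (tens 4 n pauli s b a' * cnj (tens 4 n pauli s b a)))"
      by (subst sum.swap) (simp only: kernel)
    also have "\<dots> = (\<Sum>s<4 ^ n. complex_of_real (wprod 4 n P s) * (\<Sum>b<d. cnj (tens 4 n pauli s b a) * tens 4 n pauli s b a'))"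
      by (subst sum.swap) (simp only: sum_distrib_left mult.commute[of "cnj _"])
    also have "\<dots> = (\<Sum>s<4 ^ n. complex_of_real (wprod 4 n P s) * (if a = a' then 1 else 0))"
      using orthonormalD[OF tens_pauli_orthonormal] a unfolding d_def by simp
    also have "\<dots> = (if a = a' then 1 else 0)"
      using sum_wprod[where m=4 and n=n and w=P] Psum by (simp flip: of_real_sum)
    finally show "(\<Sum>p\<in>{..<D} \<times> {..<d}. cnj (case p of (e, b) \<Rightarrow> A e b a) * (case p of (e, b) \<Rightarrow> A e b a'))
        = (if a = a' then 1 else 0)" .
  qed
  define G where "G x p e = cnj (sandwich d (S x) (R x) (A e) p)" for x p e
  \<comment> \<open>A purification of the average environment state: the message becomes part of the
    row index, with amplitude 1 / sqrt K.\<close>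
  define G' where "G' y e = cnj (\<Sum>a<d. A e (fst (snd y)) a * R (fst y) a (snd (snd y))) / of_real (sqrt (real K))" for y e
  have sq: "complex_of_real (sqrt (real K)) * complex_of_real (sqrt (real K)) = of_nat K"
    by (simp flip: of_real_mult)
  have GG': "(\<Sum>y\<in>{..<K} \<times> ?Q. cnj (G' y i) * G' y j)
      = (\<Sum>x<K. \<Sum>p\<in>?Q. (\<Sum>a<d. A i (fst p) a * R x a (snd p)) * cnj (\<Sum>a<d. A j (fst p) a * R x a (snd p))) / of_nat K" for i j
    by (simp add: G'_def sq sum_divide_distrib[symmetric] sum.cartesian_product case_prod_beta del: cnj_sum)
  have tr: "(\<Sum>e<D. \<Sum>y\<in>{..<K} \<times> ?Q. (cmod (G' y e))\<^sup>2) = 1"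
  proof -
    have "(\<Sum>e<D. \<Sum>y\<in>{..<K} \<times> ?Q. (cmod (G' y e))\<^sup>2)
        = (\<Sum>e<D. \<Sum>x<K. \<Sum>b<d. \<Sum>k<d. (cmod (\<Sum>a<d. A e b a * R x a k))\<^sup>2) / real K"
      using K by (simp add: G'_def norm_divide power_divide sum_divide_distrib[symmetric] sum.cartesian_product case_prod_beta
          del: cnj_sum)
    also have "(\<Sum>e<D. \<Sum>x<K. \<Sum>b<d. \<Sum>k<d. (cmod (\<Sum>a<d. A e b a * R x a k))\<^sup>2)
        = (\<Sum>x<K. \<Sum>e<D. \<Sum>k<d. \<Sum>b<d. (cmod (\<Sum>a<d. A e b a * R x a k))\<^sup>2)"
      by (subst sum.swap) (intro sum.cong refl sum.swap)
    also have "\<dots> = (\<Sum>x<K. \<Sum>k<d. \<Sum>e<D. \<Sum>b<d. (cmod (\<Sum>a<d. A e b a * R x a k))\<^sup>2)"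
      by (intro sum.cong refl sum.swap)
    also have "\<dots> = real K" by (simp add: kraus_isometry[OF on] dens)
    finally show ?thesis using K by simp
  qed
  have close': "(\<Sum>x<K. \<Sum>k<D. cmod (qform D (\<lambda>i j. (\<Sum>p\<in>?Q. cnj (G x p i) * G x p j)
         - (\<Sum>y\<in>{..<K} \<times> ?Q. cnj (G' y i) * G' y j)) (u x k))) \<le> real K * \<epsilon>"
    if "\<And>x. x < K \<Longrightarrow> orthonormal {..<D} {..<D} (u x)" for u
    using close[OF that] unfolding GG' by (simp only: G_def complex_cnj_cnj)
  obtain C where
    contr: "\<And>x v. (\<Sum>f<D. (cmod (\<Sum>p\<in>?Q. C x f p * v p))\<^sup>2) \<le> (\<Sum>p\<in>?Q. (cmod (v p))\<^sup>2)" and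
    low: "(1 - \<epsilon>)\<^sup>2 \<le> (\<Sum>f<D. \<Sum>e<D. (cmod (\<Sum>x<K. \<Sum>p\<in>?Q. C x f p * G x p e))\<^sup>2) / (real K)\<^sup>2"
    using aligned_purifications[where K=K and J="?Q" and J'="{..<K} \<times> ?Q" and \<epsilon>=\<epsilon> and D=D and G=G and G'=G',
        OF K _ _ eps tr close'] by blast
  let ?T = "privacy_test D d K C S R"
  have iso: "?T (tens 4 n pauli s) \<le> 1" for s
  proof (rule privacy_test_isometry_le[OF K contr povm dens])
    fix v show "(\<Sum>b<d. (cmod (\<Sum>a<d. tens 4 n pauli s b a * v a))\<^sup>2) = (\<Sum>a<d. (cmod (v a))\<^sup>2)"
      using parseval[OF finite_lessThan tens_pauli_orthonormal[of n s], of v] by (simp add: d_def mult.commute)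
  qed
  \<comment> \<open>Exchanging the two sums turns the bound on the aligned purifications, whose
    columns are indexed by the environment, into the sum of the test over the Kraus
    operators.\<close>
  have "(1 - \<epsilon>)\<^sup>2 \<le> (\<Sum>e<D. ?T (A e))"
    using low by (subst (asm) sum.swap) (simp add: privacy_test_def G_def sum_divide_distrib)
  also have "\<dots> = (\<Sum>e<D. wprod dE n (\<lambda>_. 1) e * ?T (A e))" by (simp add: w1)
  also have "\<dots> = (\<Sum>s<4 ^ n. wprod 4 n P s * ?T (tens 4 n pauli s))"
    by (rule privacy_test_kernel_cong) (rule kernel)
  also have "\<dots> \<le> exp (real n * c) * (\<Sum>s<4 ^ n. wprod 4 n Q s * ?T (tens 4 n pauli s))
      + (\<Sum>s<4. P s * exp (\<theta> * (g s - c))) ^ n"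
  proof (rule likelihood_split[OF privacy_test_nonneg iso _ _ _ \<theta>])
    fix s :: nat assume "s < 4"
    show "0 \<le> Q s" using r by (simp add: Q_def)
    \<comment> \<open>For q = 0 or q = 1 the logarithm of 0 enters \<open>g\<close> only at indices
      where \<open>P\<close> vanishes.\<close>
    show "P s = 0 \<or> P s = Q s * exp (g s)"
      using q by (cases "q = 0"; cases "q = 1") (auto simp: P_def Q_def g_def)
  qed simp
  also have "(\<Sum>s<4 ^ n. wprod 4 n Q s * ?T (tens 4 n pauli s)) \<le> 1 / real K"
    unfolding Q_def d_def
    by (rule privacy_test_measure_prepare_le[OF K r(1,2) contr[unfolded d_def] povm[unfolded d_def] dens[unfolded d_def]])
  also have "(\<Sum>s<4. P s * exp (\<theta> * (g s - c)))
      = (1 - q) * exp (\<theta> * (ln (2 * (1 - q)) - c)) + q * exp (\<theta> * (ln (2 * q) - c))"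
  proof -
    have "(\<Sum>s<4. P s * exp (\<theta> * (g s - c)))
        = (1 - q) * exp (\<theta> * (ln (2 * (1 - q)) - c)) + q * (r 0 + r (Suc 0) + r 2) * exp (\<theta> * (ln (2 * q) - c))"
      by (simp add: P_def g_def sum_lessThan_2_4_6 algebra_simps)
    thus ?thesis unfolding r1 by simp
  qed
  finally show ?thesis by simp
qed

section \<open>From codes to the privacy test\<close>

lemma qform_vec:
  assumes "A \<in> carrier_mat d d" "v \<in> carrier_vec d"
  shows "(\<Sum>i<d. cnj (v $ i) * (A *\<^sub>v v) $ i) = qform d (\<lambda>i j. A $$ (i,j)) (\<lambda>i. v $ i)"
  using assms unfolding qform_def
  by (auto simp: scalar_prod_def atLeast0LessThan sum_distrib_left mult.assoc intro!: sum.cong)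

lemma psd_qform:
  assumes "psd d A"
  shows "Im (qform d (\<lambda>i j. A $$ (i,j)) v) = 0" "0 \<le> Re (qform d (\<lambda>i j. A $$ (i,j)) v)"
proof -
  have A: "A \<in> carrier_mat d d" using assms by (simp add: psd_def)
  have "qform d (\<lambda>i j. A $$ (i,j)) (\<lambda>i. vec d v $ i) = qform d (\<lambda>i j. A $$ (i,j)) v"
    by (simp add: qform_def)
  moreover have "Im (qform d (\<lambda>i j. A $$ (i,j)) (\<lambda>i. vec d v $ i)) = 0 \<and> 0 \<le> Re (qform d (\<lambda>i j. A $$ (i,j)) (\<lambda>i. vec d v $ i))"
    using assms[unfolded psd_def Let_def, THEN conjunct2, THEN bspec, OF vec_carrier[of d v]]
    unfolding qform_vec[OF A vec_carrier[of d v]] .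
  ultimately show "Im (qform d (\<lambda>i j. A $$ (i,j)) v) = 0" "0 \<le> Re (qform d (\<lambda>i j. A $$ (i,j)) v)" by simp_all
qed

lemma qform_two_point:
  assumes "i < d" "j < d" "i \<noteq> j"
  shows "qform d a (\<lambda>k. if k = i then x else if k = j then y else 0)
    = cnj x * a i i * x + cnj x * a i j * y + cnj y * a j i * x + cnj y * a j j * y"
proof -
  define w where "w k = (if k = i then x else if k = j then y else 0)" for k
  have pick: "(\<Sum>k<d. f k * w k) = f i * x + f j * y" for f :: "nat \<Rightarrow> complex"
  proof -
    have "(\<Sum>k<d. f k * w k) = (\<Sum>k\<in>{i, j}. f k * w k)"
      using assms by (intro sum.mono_neutral_right) (auto simp: w_def)
    thus ?thesis using assms by (simp add: w_def)
  qed
  have pick': "(\<Sum>k<d. cnj (w k) * f k) = cnj x * f i + cnj y * f j" for f :: "nat \<Rightarrow> complex"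
  proof -
    have "(\<Sum>k<d. cnj (w k) * f k) = (\<Sum>k\<in>{i, j}. cnj (w k) * f k)"
      using assms by (intro sum.mono_neutral_right) (auto simp: w_def)
    thus ?thesis using assms by (simp add: w_def)
  qed
  have "qform d a w = (\<Sum>k<d. cnj (w k) * (\<Sum>l<d. a k l * w l))"
    by (simp add: qform_def sum_distrib_left mult.assoc)
  hence "qform d a w = cnj x * (a i i * x + a i j * y) + cnj y * (a j i * x + a j j * y)"
    by (simp only: pick pick')
  thus ?thesis unfolding w_def[abs_def] by (simp add: algebra_simps)
qed

lemma qform_one_point:
  assumes "i < d"
  shows "qform d a (\<lambda>k. if k = i then 1 else 0) = a i i"
proof -
  have "qform d a (\<lambda>k. if k = i then 1 else 0)
      = (\<Sum>k<d. cnj (if k = i then 1 else 0) * (\<Sum>l<d. a k l * (if l = i then 1 else 0)))"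
    by (simp only: qform_def sum_distrib_left mult.assoc)
  also have "\<dots> = (\<Sum>k<d. a k i * (if k = i then 1 else 0))"
    using assms by (intro sum.cong refl) (simp add: sum_mult_delta)
  also have "\<dots> = a i i" using assms by (simp add: sum_mult_delta)
  finally show ?thesis .
qed

text \<open>\<open>psd\<close> asks only for real nonnegative values of the form. Polarisation
  recovers symmetry: the vector e_i + e_j shows that the sum of the two mirrored entries is real,
  and e_i + \<i> e_j that their difference is imaginary.\<close>

lemma psd_hermitian:
  assumes "psd d A" "i < d" "j < d"
  shows "A $$ (j,i) = cnj (A $$ (i,j))"
proof -
  have diag: "Im (A $$ (k,k)) = 0" if "k < d" for k
    using psd_qform(1)[OF assms(1), of "\<lambda>l. if l = k then 1 else 0"] qform_one_point[OF that] by simp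
  show ?thesis
  proof (cases "i = j")
    case True
    thus ?thesis using diag[OF assms(2)] by (simp add: complex_eq_iff)
  next
    case False
    note two = qform_two_point[OF assms(2,3) False, of "\<lambda>i j. A $$ (i,j)"]
    have "Im (A $$ (i,j)) + Im (A $$ (j,i)) = 0"
      using psd_qform(1)[OF assms(1), of "\<lambda>k. if k = i then 1 else if k = j then 1 else 0"]
        two[of 1 1] diag assms(2,3) by simp
    moreover have "Re (A $$ (i,j)) - Re (A $$ (j,i)) = 0"
      using psd_qform(1)[OF assms(1), of "\<lambda>k. if k = i then 1 else if k = j then \<i> else 0"]
        two[of 1 \<i>] diag assms(2,3) by simp
    ultimately show ?thesis by (simp add: complex_eq_iff)
  qed
qed

text \<open>Eigenvectors scaled by the roots of their eigenvalues. The factor serves twice: for a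
  code state it is a purification, for a POVM element the operator that acts on the decoded
  vector.\<close>

lemma psd_factorization:
  assumes "psd d A"
  obtains R where "\<And>i j. i < d \<Longrightarrow> j < d \<Longrightarrow> A $$ (i,j) = (\<Sum>k<d. R i k * cnj (R j k))"
proof -
  obtain u and \<mu> :: "nat \<Rightarrow> real" where on: "orthonormal {..<d} {..<d} u"
    and compl: "\<And>i j. i < d \<Longrightarrow> j < d \<Longrightarrow> (\<Sum>k<d. u k i * cnj (u k j)) = (if i = j then 1 else 0)"
    and dec: "\<And>i j. i < d \<Longrightarrow> j < d \<Longrightarrow> A $$ (i,j) = (\<Sum>k<d. of_real (\<mu> k) * u k i * cnj (u k j))"
    and "char_poly (mat d d (\<lambda>(i,j). A $$ (i,j))) = (\<Prod>k<d. [:- of_real (\<mu> k), 1:])"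
    using spectral_decomposition[of d "\<lambda>i j. A $$ (i,j)", OF psd_hermitian[OF assms]] by blast
  have \<mu>: "0 \<le> \<mu> k" if k: "k < d" for k
  proof -
    have Au: "(\<Sum>j<d. A $$ (i,j) * u k j) = of_real (\<mu> k) * u k i" if "i < d" for i
    proof -
      have "(\<Sum>j<d. A $$ (i,j) * u k j) = (\<Sum>j<d. \<Sum>l<d. of_real (\<mu> l) * u l i * (cnj (u l j) * u k j))"
        using that by (simp add: dec sum_distrib_right mult.assoc)
      also have "\<dots> = (\<Sum>l<d. of_real (\<mu> l) * u l i * (\<Sum>j<d. cnj (u l j) * u k j))"
        by (subst sum.swap) (simp only: sum_distrib_left)
      also have "\<dots> = (\<Sum>l<d. of_real (\<mu> l) * u l i * (if l = k then 1 else 0))"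
        using k by (intro sum.cong refl) (simp add: orthonormalD[OF on])
      also have "\<dots> = of_real (\<mu> k) * u k i" using k by (simp add: sum_mult_delta)
      finally show ?thesis .
    qed
    have "qform d (\<lambda>i j. A $$ (i,j)) (u k) = (\<Sum>i<d. cnj (u k i) * (\<Sum>j<d. A $$ (i,j) * u k j))"
      by (simp add: qform_def sum_distrib_left mult.assoc)
    also have "\<dots> = (\<Sum>i<d. of_real (\<mu> k) * (cnj (u k i) * u k i))"
      by (intro sum.cong refl) (simp add: Au)
    also have "\<dots> = of_real (\<mu> k)" using on k by (simp add: orthonormalD flip: sum_distrib_left)
    finally show ?thesis using psd_qform(2)[OF assms, of "u k"] by simp
  qed
  show ?thesis
  proof (rule that[of "\<lambda>i k. of_real (sqrt (\<mu> k)) * u k i"])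
    fix i j assume ij: "i < d" "j < d"
    have sq: "complex_of_real (sqrt (\<mu> k)) * complex_of_real (sqrt (\<mu> k)) = of_real (\<mu> k)" if "k < d" for k
      using \<mu>[OF that] by (simp flip: of_real_mult)
    show "A $$ (i,j) = (\<Sum>k<d. of_real (sqrt (\<mu> k)) * u k i * cnj (of_real (sqrt (\<mu> k)) * u k j))"
      unfolding dec[OF ij] by (intro sum.cong refl) (simp add: sq[symmetric] mult_ac)
  qed
qed

section \<open>Regrouping the tensor power into outputs and environments\<close>

lemma kron_pow_carrier: "A \<in> carrier_mat r c \<Longrightarrow> kron_pow n A \<in> carrier_mat (r ^ n) (c ^ n)"
  by (induction n) (auto simp: kron_def)

lemma kron_pow_index:
  assumes A: "A \<in> carrier_mat r c" and "i < r ^ n" "j < c ^ n"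
  shows "kron_pow n A $$ (i, j) = (\<Prod>l<n. A $$ (dig r i l, dig c j l))"
  using assms(2,3)
proof (induction n arbitrary: i j)
  case (Suc n)
  have pos: "r ^ n > 0" "c ^ n > 0" using Suc.prems by (auto intro: Nat.gr0I)
  have kc: "kron_pow n A \<in> carrier_mat (r ^ n) (c ^ n)" using A by (rule kron_pow_carrier)
  have "kron_pow (Suc n) A $$ (i, j)
      = A $$ (i div r ^ n, j div c ^ n) * kron_pow n A $$ (i mod r ^ n, j mod c ^ n)"
    using A kc Suc.prems by (simp add: kron_def)
  also have "kron_pow n A $$ (i mod r ^ n, j mod c ^ n) = (\<Prod>l<n. A $$ (dig r i l, dig c j l))"
    using pos by (simp add: Suc.IH dig_mod)
  also have "i div r ^ n = dig r i n"
    using Suc.prems by (simp add: dig_def less_mult_imp_div_less)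
  also have "j div c ^ n = dig c j n"
    using Suc.prems by (simp add: dig_def less_mult_imp_div_less)
  finally show ?case by (simp add: mult.commute)
qed simp

lemma mult_add_less: "i < m \<Longrightarrow> j < k \<Longrightarrow> i * k + j < m * (k :: nat)"
proof -
  assume "i < m" "j < k"
  hence "i * k + j < (i + 1) * k" "(i + 1) * k \<le> m * k" by (simp, intro mult_right_mono, simp_all)
  thus ?thesis by simp
qed

lemma mult_add_div_mod:
  fixes b e D :: nat
  assumes "e < D"
  shows "(b * D + e) div D = b" "(b * D + e) mod D = e"
  using assms by simp_all

lemma mult_add_unique:
  fixes b B e E D :: nat
  assumes "b * D + e = B * D + E" "e < D" "E < D"
  shows "b = B \<and> e = E"
proof -
  show ?thesis
    using mult_add_div_mod[OF assms(2), of b] mult_add_div_mod[OF assms(3), of B] assms(1) by metis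
qed

text \<open>The inverse of the regrouping, made explicit: the i-th joint digit encodes the pair of
  the i-th digits of \<open>b\<close> and \<open>e\<close>. It locates the unit entry in each row of
  the permutation matrix.\<close>

lemma reidx_eq_iff:
  assumes dE: "dE > 0" and b: "b < 2 ^ n" and e: "e < dE ^ n" and c: "c < (2 * dE) ^ n"
  shows "b * dE ^ n + e = reidx n 2 dE c \<longleftrightarrow> c = (\<Sum>i<n. (dig 2 b i * dE + dig dE e i) * (2 * dE) ^ i)"
proof -
  define c0 where "c0 = (\<Sum>i<n. (dig 2 b i * dE + dig dE e i) * (2 * dE) ^ i)"
  have lt: "dig 2 b i * dE + dig dE e i < 2 * dE" for i
    using dE by (intro mult_add_less) simp_all
  have c0: "c0 < (2 * dE) ^ n" unfolding c0_def by (rule undig_less) (rule lt)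
  have dc0: "dig (2 * dE) c0 i = dig 2 b i * dE + dig dE e i" if "i < n" for i
    unfolding c0_def by (rule dig_undig[OF lt that])
  have re: "reidx n 2 dE c = (\<Sum>i<n. dig (2 * dE) c i div dE * 2 ^ i) * dE ^ n + (\<Sum>i<n. dig (2 * dE) c i mod dE * dE ^ i)" for c
    by (simp add: reidx_def dig_def)
  have d2: "dig (2 * dE) c i div dE < 2" for i
    using dig_less[of "2 * dE" c i] dE by (simp add: less_mult_imp_div_less)
  have "c = c0" if "b * dE ^ n + e = reidx n 2 dE c"
  proof (rule dig_eqI[OF c c0])
    fix i assume i: "i < n"
    let ?B = "\<Sum>i<n. dig (2 * dE) c i div dE * 2 ^ i" and ?E = "\<Sum>i<n. dig (2 * dE) c i mod dE * dE ^ i"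
    have E: "?E < dE ^ n" by (rule undig_less) (use dE in simp)
    have eq: "b * dE ^ n + e = ?B * dE ^ n + ?E" using that unfolding re .
    have "b = ?B" "e = ?E" using mult_add_unique[OF eq e E] by simp_all
    hence "dig 2 b i = dig (2 * dE) c i div dE" "dig dE e i = dig (2 * dE) c i mod dE"
      using dig_undig[where e="\<lambda>i. dig (2 * dE) c i div dE" and d=2 and n=n, OF d2 i]
        dig_undig[where e="\<lambda>i. dig (2 * dE) c i mod dE" and d=dE and n=n, OF mod_less_divisor[OF dE] i] by auto
    thus "dig (2 * dE) c i = dig (2 * dE) c0 i" unfolding dc0[OF i] by simp
  qed
  moreover have "b * dE ^ n + e = reidx n 2 dE c0"
  proof -
    have "reidx n 2 dE c0 = (\<Sum>i<n. dig 2 b i * 2 ^ i) * dE ^ n + (\<Sum>i<n. dig dE e i * dE ^ i)"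
      unfolding re using dE by (simp add: dc0)
    thus ?thesis using b e by (simp add: sum_dig)
  qed
  ultimately show ?thesis unfolding c0_def by blast
qed

text \<open>The operator <e| U, with the environment as the less significant tensor factor. These
  are Kraus operators of the channel that \<open>U\<close> extends.\<close>

definition env_kraus :: "nat \<Rightarrow> complex mat \<Rightarrow> nat \<Rightarrow> nat \<Rightarrow> nat \<Rightarrow> complex" where
  "env_kraus dE U e b a = U $$ (b * dE + e, a)"

lemma mat_sandwich_index:
  assumes "V \<in> carrier_mat m d" "\<rho> \<in> carrier_mat d d" "i < m" "j < m"
  shows "(V * \<rho> * adj V) $$ (i,j) = (\<Sum>a<d. \<Sum>a'<d. V $$ (i,a) * \<rho> $$ (a,a') * cnj (V $$ (j,a')))"
proof -
  have V\<rho>: "V * \<rho> \<in> carrier_mat m d" using assms by auto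
  have "(V * \<rho> * adj V) $$ (i,j) = (\<Sum>a'<d. (V * \<rho>) $$ (i,a') * adj V $$ (a',j))"
    using assms V\<rho> by (intro mat_mult_index[of _ m d _ m]) auto
  also have "\<dots> = (\<Sum>a'<d. \<Sum>a<d. V $$ (i,a) * \<rho> $$ (a,a') * cnj (V $$ (j,a')))"
    using assms by (intro sum.cong refl)
      (simp add: mat_mult_index[of _ m d _ d] sum_distrib_right del: index_mult_mat(1))
  also have "\<dots> = (\<Sum>a<d. \<Sum>a'<d. V $$ (i,a) * \<rho> $$ (a,a') * cnj (V $$ (j,a')))"
    by (rule sum.swap)
  finally show ?thesis .
qed

text \<open>The permutation matrix only relabels rows: row (b, e) of P W is the row of W that pairs
  the digits of \<open>b\<close> and \<open>e\<close>, and its entries are products of Kraus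
  entries. Environment strings thus label tensor products of Kraus operators.\<close>

lemma out_state_index:
  assumes U: "U \<in> carrier_mat (2 * dE) 2" and dE: "dE > 0" and \<rho>: "\<rho> \<in> carrier_mat (2 ^ n) (2 ^ n)"
    and b: "b < 2 ^ n" "b' < 2 ^ n" and e: "e < dE ^ n" "e' < dE ^ n"
  shows "out_state 2 dE U n \<rho> $$ (b * dE ^ n + e, b' * dE ^ n + e')
    = (\<Sum>a<2 ^ n. \<Sum>a'<2 ^ n. tens dE n (env_kraus dE U) e b a * \<rho> $$ (a,a') * cnj (tens dE n (env_kraus dE U) e' b' a'))"
proof -
  define P where "P = reorder n 2 dE"
  define W where "W = kron_pow n U"
  let ?N = "(2 * dE) ^ n" and ?d = "(2::nat) ^ n"
  have P: "P \<in> carrier_mat ?N ?N" by (simp add: P_def reorder_def)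
  have W: "W \<in> carrier_mat ?N ?d" unfolding W_def by (rule kron_pow_carrier[OF U])
  have PW: "P * W \<in> carrier_mat ?N ?d" using P W by auto
  have lt: "b * dE ^ n + e < ?N" if "b < 2 ^ n" "e < dE ^ n" for b e
    using mult_add_less[OF that] by (simp add: power_mult_distrib)
  have out: "out_state 2 dE U n \<rho> = (P * W) * \<rho> * adj (P * W)"
  proof -
    have W\<rho>: "W * \<rho> \<in> carrier_mat ?N ?d" using W \<rho> by auto
    have "out_state 2 dE U n \<rho> = P * (W * \<rho> * adj W) * adj P"
      by (simp add: out_state_def Let_def P_def W_def)
    also have "\<dots> = P * ((W * \<rho>) * adj W * adj P)"
      using P W W\<rho> by (intro assoc_mult_mat[of _ ?N ?N _ ?N _ ?N]) auto
    also have "(W * \<rho>) * adj W * adj P = (W * \<rho>) * (adj W * adj P)"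
      using P W W\<rho> by (intro assoc_mult_mat[of _ ?N ?d _ ?N _ ?N]) auto
    also have "adj W * adj P = adj (P * W)" using adj_mult[OF P W] by simp
    also have "P * ((W * \<rho>) * adj (P * W)) = P * (W * \<rho>) * adj (P * W)"
      using P W\<rho> PW by (intro assoc_mult_mat[symmetric, of _ ?N ?N _ ?d _ ?N]) auto
    also have "P * (W * \<rho>) = P * W * \<rho>"
      using P W \<rho> by (intro assoc_mult_mat[symmetric, of _ ?N ?N _ ?d _ ?d]) auto
    finally show ?thesis .
  qed
  have idx: "(P * W) $$ (b * dE ^ n + e, a) = tens dE n (env_kraus dE U) e b a"
    if b: "b < 2 ^ n" and e: "e < dE ^ n" and a: "a < 2 ^ n" for b e a
  proof -
    define c0 where "c0 = (\<Sum>i<n. (dig 2 b i * dE + dig dE e i) * (2 * dE) ^ i)"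
    have ltd: "dig 2 b i * dE + dig dE e i < 2 * dE" for i
      using dE by (intro mult_add_less) simp_all
    have c0: "c0 < ?N" unfolding c0_def by (rule undig_less) (rule ltd)
    have "(P * W) $$ (b * dE ^ n + e, a) = (\<Sum>c<?N. P $$ (b * dE ^ n + e, c) * W $$ (c, a))"
      using lt[OF b e] a by (intro mat_mult_index[OF P W]) auto
    also have "\<dots> = (\<Sum>c<?N. W $$ (c, a) * (if c = c0 then 1 else 0))"
    proof (rule sum.cong[OF refl])
      fix c assume "c \<in> {..<?N}"
      thus "P $$ (b * dE ^ n + e, c) * W $$ (c, a) = W $$ (c, a) * (if c = c0 then 1 else 0)"
        using reidx_eq_iff[OF dE b e, of c] lt[OF b e] by (simp add: P_def reorder_def c0_def)
    qed
    also have "\<dots> = W $$ (c0, a)" using c0 by (simp add: sum_mult_delta)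
    also have "\<dots> = (\<Prod>i<n. U $$ (dig (2 * dE) c0 i, dig 2 a i))"
      unfolding W_def using U c0 a by (rule kron_pow_index)
    also have "\<dots> = tens dE n (env_kraus dE U) e b a"
    proof -
      have "dig (2 * dE) c0 i = dig 2 b i * dE + dig dE e i" if "i < n" for i
        unfolding c0_def by (rule dig_undig[OF ltd that])
      thus ?thesis by (simp add: tens_def env_kraus_def)
    qed
    finally show ?thesis .
  qed
  show ?thesis
    unfolding out using mat_sandwich_index[OF PW \<rho> lt[OF b(1) e(1)] lt[OF b(2) e(2)]] b e by (simp add: idx)
qed

lemma sum_pick2:
  fixes f g :: "nat \<Rightarrow> complex" and d :: nat
  assumes "a < d" "a' < d"
  shows "(\<Sum>x<d. \<Sum>y<d. f x * (if x = a \<and> y = a' then 1 else 0) * g y) = f a * g a'"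
proof -
  have "(\<Sum>x<d. \<Sum>y<d. f x * (if x = a \<and> y = a' then 1 else 0) * g y)
      = (\<Sum>x<d. f x * (if x = a then 1 else 0)) * (\<Sum>y<d. g y * (if y = a' then 1 else 0))"
    unfolding sum_product by (intro sum.cong refl) auto
  thus ?thesis using assms by (simp only: sum_mult_delta finite_lessThan lessThan_iff if_True)
qed

lemma pauli_mats:
  "pauliX \<in> carrier_mat 2 2" "pauliY \<in> carrier_mat 2 2" "pauliZ \<in> carrier_mat 2 2"
  "adj pauliX = pauliX" "adj pauliY = pauliY" "adj pauliZ = pauliZ"
  by (auto simp: pauliX_def pauliY_def pauliZ_def mat_of_rows_list_def adj_def less_Suc_eq numeral_2_eq_2 intro!: eq_matI)

lemma pauli_mats_index:
  assumes "i < 2" "j < 2"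
  shows "pauliX $$ (i,j) = pauli 1 i j" "pauliY $$ (i,j) = pauli 2 i j" "pauliZ $$ (i,j) = pauli 3 i j"
  using assms
  by (auto simp: pauliX_def pauliY_def pauliZ_def mat_of_rows_list_def pauli_def less_Suc_eq numeral_2_eq_2)

text \<open>The defining equation is evaluated at the matrix unit with its entry at (a, a') and read
  off at (b, b'), which gives the Choi matrix. Off-diagonal matrix units are not states, so the
  equation is used for general \<rho>.\<close>

lemma isometric_extension_choi:
  assumes ext: "isometric_extension (pauli_channel p1 p2 p3) 2 2 dE U"
    and lt: "b < 2" "a < 2" "b' < 2" "a' < 2"
  shows "(\<Sum>e<dE. env_kraus dE U e b a * cnj (env_kraus dE U e b' a'))
    = complex_of_real (1 - (p1 + p2 + p3)) * (pauli 0 b a * cnj (pauli 0 b' a'))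
      + complex_of_real p1 * (pauli 1 b a * cnj (pauli 1 b' a'))
      + complex_of_real p2 * (pauli 2 b a * cnj (pauli 2 b' a'))
      + complex_of_real p3 * (pauli 3 b a * cnj (pauli 3 b' a'))"
proof -
  define \<rho> :: "complex mat" where "\<rho> = mat 2 2 (\<lambda>(i,j). if i = a \<and> j = a' then 1 else 0)"
  have \<rho>: "\<rho> \<in> carrier_mat 2 2" by (simp add: \<rho>_def)
  have U: "U \<in> carrier_mat (2 * dE) 2" using ext by (simp add: isometric_extension_def)
  have entry: "(V * \<rho> * adj V) $$ (i,j) = V $$ (i,a) * cnj (V $$ (j,a'))"
    if "V \<in> carrier_mat m 2" "i < m" "j < m" for V m i j
  proof -
    have "(V * \<rho> * adj V) $$ (i,j) = (\<Sum>x<2. \<Sum>y<2. V $$ (i,x) * (if x = a \<and> y = a' then 1 else 0) * cnj (V $$ (j,y)))"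
      using mat_sandwich_index[OF that(1) \<rho> that(2,3)] by (simp add: \<rho>_def)
    thus ?thesis using sum_pick2[OF lt(2,4), of "\<lambda>x. V $$ (i,x)" "\<lambda>y. cnj (V $$ (j,y))"] by (simp only:)
  qed
  have "ptrace2 2 dE (U * \<rho> * adj U) = pauli_channel p1 p2 p3 \<rho>"
    using ext \<rho> by (auto simp: isometric_extension_def)
  hence "ptrace2 2 dE (U * \<rho> * adj U) $$ (b,b') = pauli_channel p1 p2 p3 \<rho> $$ (b,b')" by simp
  also have "ptrace2 2 dE (U * \<rho> * adj U) $$ (b,b') = (\<Sum>e<dE. env_kraus dE U e b a * cnj (env_kraus dE U e b' a'))"
    unfolding ptrace2_def using lt by (simp add: env_kraus_def entry[OF U] mult_add_less)
  also have "pauli_channel p1 p2 p3 \<rho> $$ (b,b') = complex_of_real (1 - (p1 + p2 + p3)) * (pauli 0 b a * cnj (pauli 0 b' a'))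
      + complex_of_real p1 * (pauli 1 b a * cnj (pauli 1 b' a'))
      + complex_of_real p2 * (pauli 2 b a * cnj (pauli 2 b' a'))
      + complex_of_real p3 * (pauli 3 b a * cnj (pauli 3 b' a'))"
  proof -
    have X: "(pauliX * \<rho> * pauliX) $$ (b,b') = pauli 1 b a * cnj (pauli 1 b' a')"
      using entry[OF pauli_mats(1) lt(1,3)] lt by (simp only: pauli_mats pauli_mats_index)
    have Y: "(pauliY * \<rho> * pauliY) $$ (b,b') = pauli 2 b a * cnj (pauli 2 b' a')"
      using entry[OF pauli_mats(2) lt(1,3)] lt by (simp only: pauli_mats pauli_mats_index)
    have Z: "(pauliZ * \<rho> * pauliZ) $$ (b,b') = pauli 3 b a * cnj (pauli 3 b' a')"
      using entry[OF pauli_mats(3) lt(1,3)] lt by (simp only: pauli_mats pauli_mats_index)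
    have I: "\<rho> $$ (b,b') = pauli 0 b a * cnj (pauli 0 b' a')"
      using lt by (simp add: \<rho>_def pauli_def)
    have c: "pauliX * \<rho> * pauliX \<in> carrier_mat 2 2" "pauliY * \<rho> * pauliY \<in> carrier_mat 2 2"
      "pauliZ * \<rho> * pauliZ \<in> carrier_mat 2 2"
      using \<rho> pauli_mats(1,2,3) by (auto intro!: mult_carrier_mat)
    have comb: "(\<alpha> \<cdot>\<^sub>m A1 + \<beta> \<cdot>\<^sub>m A2 + \<gamma> \<cdot>\<^sub>m A3 + \<delta> \<cdot>\<^sub>m A4) $$ (b,b')
        = \<alpha> * A1 $$ (b,b') + \<beta> * A2 $$ (b,b') + \<gamma> * A3 $$ (b,b') + \<delta> * A4 $$ (b,b')"
      if "A1 \<in> carrier_mat 2 2" "A2 \<in> carrier_mat 2 2" "A3 \<in> carrier_mat 2 2" "A4 \<in> carrier_mat 2 2"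
      for \<alpha> \<beta> \<gamma> \<delta> :: complex and A1 A2 A3 A4
      using that lt by auto
    show ?thesis
      unfolding pauli_channel_def comb[OF \<rho> c] X Y Z I ..
  qed
  finally show ?thesis .
qed

lemma out_state_carrier:
  assumes "U \<in> carrier_mat (2 * dE) 2" "\<rho> \<in> carrier_mat (2 ^ n) (2 ^ n)"
  shows "out_state 2 dE U n \<rho> \<in> carrier_mat (2 ^ n * dE ^ n) (2 ^ n * dE ^ n)"
  by (auto simp: out_state_def Let_def reorder_def power_mult_distrib intro!: carrier_matI)

section \<open>The correct-decoding blocks of the key states\<close>

lemma block_index:
  fixes x K D i :: nat
  assumes "x < K" "y < K" "i < D"
  shows "((x * K + y) * D + i) div (K * D) = x" "((x * K + y) * D + i) mod (K * D) = y * D + i"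
    "(x * K + y) * D + i < K * (K * D)"
proof -
  have r: "(x * K + y) * D + i = x * (K * D) + (y * D + i)" by (simp add: algebra_simps)
  have l: "y * D + i < K * D" using assms(2,3) by (rule mult_add_less)
  show "((x * K + y) * D + i) div (K * D) = x" "((x * K + y) * D + i) mod (K * D) = y * D + i"
    unfolding r using mult_add_div_mod[OF l] by blast+
  show "(x * K + y) * D + i < K * (K * D)"
    unfolding r by (rule mult_add_less[OF assms(1) l])
qed

text \<open>The block in which sent and decoded message are both \<open>x\<close> has the joint key
  index \<open>x * K + x\<close>. Compressing to these blocks is enough for a lower bound on the
  trace norm.\<close>

lemma kron_proj_block:
  assumes T: "T \<in> carrier_mat D D" and x: "x < K" and ij: "i < D" "j < D"
  shows "kron (proj K x') (kron (proj K y') T) $$ ((x * K + x) * D + i, (x * K + x) * D + j)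
    = (if x = x' \<and> x = y' then T $$ (i,j) else 0)"
proof -
  have inner: "kron (proj K y') T $$ (x * D + i, x * D + j) = (if x = y' then T $$ (i,j) else 0)"
    using T x ij mult_add_less[OF x ij(1)] mult_add_less[OF x ij(2)] by (simp add: kron_def proj_def)
  have dims: "dim_row (proj K x') = K" "dim_col (proj K x') = K"
    "dim_row (kron (proj K y') T) = K * D" "dim_col (kron (proj K y') T) = K * D"
    using T by (simp_all add: proj_def kron_def)
  have "kron (proj K x') (kron (proj K y') T) $$ ((x * K + x) * D + i, (x * K + x) * D + j)
      = proj K x' $$ (x, x) * kron (proj K y') T $$ (x * D + i, x * D + j)"
    unfolding kron_def[of "proj K x'"] dims
    using block_index[OF x x ij(1)] block_index[OF x x ij(2)] by simp
  thus ?thesis unfolding inner using x by (simp add: proj_def)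
qed

lemma ptrace1_kron_mult:
  assumes M: "M \<in> carrier_mat d d" and X: "X \<in> carrier_mat (d * D) (d * D)" and ij: "i < D" "j < D"
  shows "ptrace1 d D (kron M (1\<^sub>m D) * X) $$ (i,j) = (\<Sum>k<d. \<Sum>l<d. M $$ (k,l) * X $$ (l * D + i, k * D + j))"
proof -
  have km: "kron M (1\<^sub>m D) \<in> carrier_mat (d * D) (d * D)" using M by (auto simp: kron_def)
  have "ptrace1 d D (kron M (1\<^sub>m D) * X) $$ (i,j) = (\<Sum>k<d. (kron M (1\<^sub>m D) * X) $$ (k * D + i, k * D + j))"
    using ij by (simp add: ptrace1_def)
  also have "\<dots> = (\<Sum>k<d. \<Sum>l<d. M $$ (k,l) * X $$ (l * D + i, k * D + j))"
  proof (rule sum.cong[OF refl])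
    fix k assume "k \<in> {..<d}"
    hence k: "k < d" by simp
    have "(kron M (1\<^sub>m D) * X) $$ (k * D + i, k * D + j)
        = (\<Sum>r<d * D. kron M (1\<^sub>m D) $$ (k * D + i, r) * X $$ (r, k * D + j))"
      by (rule mat_mult_index[OF km X]) (use k ij in \<open>auto intro: mult_add_less\<close>)
    also have "\<dots> = (\<Sum>l<d. \<Sum>i'<D. kron M (1\<^sub>m D) $$ (k * D + i, l * D + i') * X $$ (l * D + i', k * D + j))"
      by (rule sum_lessThan_mult)
    also have "\<dots> = (\<Sum>l<d. \<Sum>i'<D. M $$ (k,l) * X $$ (l * D + i', k * D + j) * (if i = i' then 1 else 0))"
      using M k ij mult_add_less[OF k ij(1)] mult_add_less
      by (intro sum.cong refl) (auto simp: kron_def)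
    also have "\<dots> = (\<Sum>l<d. M $$ (k,l) * X $$ (l * D + i, k * D + j))"
      using ij by (simp add: sum_mult_delta)
    finally show "(kron M (1\<^sub>m D) * X) $$ (k * D + i, k * D + j) = (\<Sum>l<d. M $$ (k,l) * X $$ (l * D + i, k * D + j))" .
  qed
  finally show ?thesis .
qed

text \<open>With the POVM element split as the adjoint of S times S and the state as R times its
  adjoint, cyclicity of the trace over the output places one factor of each on either side. The
  unnormalised environment state after the outcome is then the Gram matrix of the vectors S A
  R.\<close>

lemma sandwich_gram:
  fixes d :: nat
  assumes m: "\<And>k l. k < d \<Longrightarrow> l < d \<Longrightarrow> m k l = (\<Sum>c<d. cnj (s c k) * s c l)"
    and \<rho>: "\<And>a a'. a < d \<Longrightarrow> a' < d \<Longrightarrow> \<rho> a a' = (\<Sum>k<d. r a k * cnj (r a' k))"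
  shows "(\<Sum>k<d. \<Sum>l<d. m k l * (\<Sum>a<d. \<Sum>a'<d. A l a * \<rho> a a' * cnj (B k a')))
    = (\<Sum>p\<in>{..<d} \<times> {..<d}. sandwich d s r A p * cnj (sandwich d s r B p))"
proof -
  let ?Q = "{..<d} \<times> {..<d}"
  define F where "F p q q' = (s (fst p) (fst q) * A (fst q) (snd q) * r (snd q) (snd p))
      * cnj (s (fst p) (fst q') * B (fst q') (snd q') * r (snd q') (snd p))" for p q q'
  have "(\<Sum>k<d. \<Sum>l<d. m k l * (\<Sum>a<d. \<Sum>a'<d. A l a * \<rho> a a' * cnj (B k a')))
      = (\<Sum>k<d. \<Sum>l<d. \<Sum>a<d. \<Sum>a'<d. \<Sum>p\<in>?Q. F p (l,a) (k,a'))"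
  proof (intro sum.cong refl)
    fix k l assume kl: "k \<in> {..<d}" "l \<in> {..<d}"
    have "m k l * (\<Sum>a<d. \<Sum>a'<d. A l a * \<rho> a a' * cnj (B k a'))
        = (\<Sum>a<d. \<Sum>a'<d. (A l a * cnj (B k a')) * (m k l * \<rho> a a'))"
      by (simp add: sum_distrib_left mult_ac)
    also have "\<dots> = (\<Sum>a<d. \<Sum>a'<d. \<Sum>p\<in>?Q. F p (l,a) (k,a'))"
    proof (intro sum.cong refl)
      fix a a' assume aa: "a \<in> {..<d}" "a' \<in> {..<d}"
      have "m k l * \<rho> a a' = (\<Sum>c<d. \<Sum>\<kappa><d. (cnj (s c k) * s c l) * (r a \<kappa> * cnj (r a' \<kappa>)))"
        using kl aa by (simp add: m \<rho> sum_product)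
      hence "(A l a * cnj (B k a')) * (m k l * \<rho> a a')
          = (\<Sum>c<d. \<Sum>\<kappa><d. F (c, \<kappa>) (l,a) (k,a'))"
        by (simp add: F_def sum_distrib_left mult_ac)
      thus "(A l a * cnj (B k a')) * (m k l * \<rho> a a') = (\<Sum>p\<in>?Q. F p (l,a) (k,a'))"
        by (simp add: sum.cartesian_product case_prod_beta)
    qed
    finally show "m k l * (\<Sum>a<d. \<Sum>a'<d. A l a * \<rho> a a' * cnj (B k a')) = (\<Sum>a<d. \<Sum>a'<d. \<Sum>p\<in>?Q. F p (l,a) (k,a'))" .
  qed
  also have "\<dots> = (\<Sum>l<d. \<Sum>k<d. \<Sum>a<d. \<Sum>a'<d. \<Sum>p\<in>?Q. F p (l,a) (k,a'))"
    by (rule sum.swap)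
  also have "\<dots> = (\<Sum>l<d. \<Sum>a<d. \<Sum>k<d. \<Sum>a'<d. \<Sum>p\<in>?Q. F p (l,a) (k,a'))"
    by (rule sum.cong[OF refl], rule sum.swap)
  also have "\<dots> = (\<Sum>q\<in>?Q. \<Sum>q'\<in>?Q. \<Sum>p\<in>?Q. F p q q')"
  proof -
    have "(\<Sum>q\<in>?Q. h q) = (\<Sum>l<d. \<Sum>a<d. h (l,a))" for h :: "nat \<times> nat \<Rightarrow> complex"
      by (simp add: sum.cartesian_product)
    note pair = this
    have "(\<Sum>q\<in>?Q. \<Sum>q'\<in>?Q. H q q') = (\<Sum>l<d. \<Sum>a<d. \<Sum>k<d. \<Sum>a'<d. H (l,a) (k,a'))" for H :: "nat \<times> nat \<Rightarrow> nat \<times> nat \<Rightarrow> complex"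
      unfolding pair ..
    from this[of "\<lambda>q q'. \<Sum>p\<in>?Q. F p q q'"] show ?thesis by (rule sym)
  qed
  also have "\<dots> = (\<Sum>p\<in>?Q. \<Sum>q\<in>?Q. \<Sum>q'\<in>?Q. F p q q')"
    by (rule sum_rotate3)
  also have "\<dots> = (\<Sum>p\<in>?Q. sandwich d s r A p * cnj (sandwich d s r B p))"
  proof (rule sum.cong[OF refl])
    fix p
    have sw: "sandwich d s r C p = (\<Sum>q\<in>?Q. s (fst p) (fst q) * C (fst q) (snd q) * r (snd q) (snd p))" for C
      by (simp add: sandwich_def sum.cartesian_product case_prod_beta)
    show "(\<Sum>q\<in>?Q. \<Sum>q'\<in>?Q. F p q q') = sandwich d s r A p * cnj (sandwich d s r B p)"
      unfolding sw cnj_sum sum_product F_def ..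
  qed
  finally show ?thesis .
qed

text \<open>The counterpart of \<open>sandwich_gram\<close> with the identity in place of the POVM
  element, for the environment state without decoding.\<close>

lemma density_gram:
  fixes d :: nat
  assumes \<rho>: "\<And>a a'. a < d \<Longrightarrow> a' < d \<Longrightarrow> \<rho> a a' = (\<Sum>k<d. r a k * cnj (r a' k))"
  shows "(\<Sum>b<d. \<Sum>a<d. \<Sum>a'<d. A b a * \<rho> a a' * cnj (B b a'))
    = (\<Sum>p\<in>{..<d} \<times> {..<d}. (\<Sum>a<d. A (fst p) a * r a (snd p)) * cnj (\<Sum>a<d. B (fst p) a * r a (snd p)))"
proof -
  have "(\<Sum>a<d. \<Sum>a'<d. A b a * \<rho> a a' * cnj (B b a'))
      = (\<Sum>k<d. (\<Sum>a<d. A b a * r a k) * cnj (\<Sum>a<d. B b a * r a k))" for b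
  proof -
    have "(\<Sum>a<d. \<Sum>a'<d. A b a * \<rho> a a' * cnj (B b a'))
        = (\<Sum>a<d. \<Sum>a'<d. \<Sum>k<d. (A b a * r a k) * cnj (B b a' * r a' k))"
      by (intro sum.cong refl) (simp add: \<rho> sum_distrib_left sum_distrib_right mult_ac)
    also have "\<dots> = (\<Sum>k<d. \<Sum>a<d. \<Sum>a'<d. (A b a * r a k) * cnj (B b a' * r a' k))"
      by (rule sum_rotate3)
    finally show ?thesis by (simp only: sum_product cnj_sum)
  qed
  thus ?thesis by (simp add: sum.cartesian_product case_prod_beta del: cnj_sum)
qed

text \<open>A vector supported on one block sees only that block. One orthonormal family in the
  large space can thereby probe the blocks of all messages at once.\<close>

lemma block_embedding_qform:
  fixes K D :: nat
  assumes B: "\<And>x i j. x < K \<Longrightarrow> i < D \<Longrightarrow> j < D \<Longrightarrow>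
      B ((x * K + x) * D + i) ((x * K + x) * D + j) = T x i j" and x: "x < K"
  shows "qform (K * (K * D)) B (\<lambda>r. if r div D = x * K + x then v (r mod D) else 0) = qform D (T x) v"
proof -
  define w where "w r = (if r div D = x * K + x then v (r mod D) else (0::complex))" for r
  have split: "(\<Sum>r<K * (K * D). h r) = (\<Sum>t<K * K. \<Sum>i<D. h (t * D + i))" for h :: "nat \<Rightarrow> complex"
    using sum_lessThan_mult[of h "K * K" D] by (simp add: mult.assoc)
  have wi: "w (t * D + i) = (if t = x * K + x then v i else 0)" if "i < D" for t i
    using that by (simp add: w_def mult_add_div_mod)
  have xx: "x * K + x < K * K" using x x by (rule mult_add_less)
  have pick: "(\<Sum>r<K * (K * D). f r * w r) = (\<Sum>i<D. f ((x * K + x) * D + i) * v i)" for f :: "nat \<Rightarrow> complex"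
  proof -
    have "(\<Sum>r<K * (K * D). f r * w r) = (\<Sum>t<K * K. (\<Sum>i<D. f (t * D + i) * v i) * (if t = x * K + x then 1 else 0))"
      unfolding split by (intro sum.cong refl) (simp add: wi sum_distrib_right)
    thus ?thesis using xx by (simp add: sum_mult_delta)
  qed
  have pick': "(\<Sum>r<K * (K * D). cnj (w r) * f r) = (\<Sum>i<D. cnj (v i) * f ((x * K + x) * D + i))" for f :: "nat \<Rightarrow> complex"
  proof -
    have "(\<Sum>r<K * (K * D). cnj (w r) * f r) = (\<Sum>t<K * K. (\<Sum>i<D. cnj (v i) * f (t * D + i)) * (if t = x * K + x then 1 else 0))"
      unfolding split by (intro sum.cong refl) (simp add: wi sum_distrib_right)
    thus ?thesis using xx by (simp add: sum_mult_delta)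
  qed
  have "qform (K * (K * D)) B w = (\<Sum>r<K * (K * D). cnj (w r) * (\<Sum>l<K * (K * D). B r l * w l))"
    by (simp add: qform_def sum_distrib_left mult.assoc)
  also have "\<dots> = (\<Sum>i<D. cnj (v i) * (\<Sum>j<D. B ((x * K + x) * D + i) ((x * K + x) * D + j) * v j))"
    by (simp only: pick pick')
  also have "\<dots> = qform D (T x) v"
    using x by (simp add: qform_def sum_distrib_left mult.assoc B)
  finally show ?thesis unfolding w_def[abs_def] .
qed

text \<open>Vectors of different messages have disjoint supports, since \<open>x * K + x\<close>
  determines \<open>x\<close>; within a block the given basis decides.\<close>

lemma block_embedding_orthonormal:
  fixes K D :: nat
  assumes u: "\<And>x. x < K \<Longrightarrow> orthonormal {..<D} {..<D} (u x)"
  shows "orthonormal {..<K * (K * D)} ({..<K} \<times> {..<D})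
    (\<lambda>y r. if r div D = fst y * K + fst y then u (fst y) (snd y) (r mod D) else 0)"
  unfolding orthonormal_def
proof (intro ballI)
  fix y z assume "y \<in> {..<K} \<times> {..<D}" "z \<in> {..<K} \<times> {..<D}"
  then obtain x k x' k' where y: "y = (x,k)" "x < K" "k < D" and z: "z = (x',k')" "x' < K" "k' < D" by auto
  let ?g = "\<lambda>y r. if r div D = fst y * K + fst y then u (fst y) (snd y) (r mod D) else 0"
  have xx: "x * K + x < K * K" using y(2) y(2) by (rule mult_add_less)
  have "(\<Sum>r<K * (K * D). cnj (?g y r) * ?g z r) = (\<Sum>t<K * K. \<Sum>i<D. cnj (?g y (t * D + i)) * ?g z (t * D + i))"
    using sum_lessThan_mult[of "\<lambda>r. cnj (?g y r) * ?g z r" "K * K" D] by (simp only: mult.assoc)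
  also have "\<dots> = (\<Sum>t<K * K. (if x = x' then \<Sum>i<D. cnj (u x k i) * u x k' i else 0) * (if t = x * K + x then 1 else 0))"
  proof (rule sum.cong[OF refl])
    fix t
    have "x * K + x = x' * K + x' \<longleftrightarrow> x = x'"
      using mult_add_unique[of x K x x' x'] y z by auto
    thus "(\<Sum>i<D. cnj (?g y (t * D + i)) * ?g z (t * D + i))
        = (if x = x' then \<Sum>i<D. cnj (u x k i) * u x k' i else 0) * (if t = x * K + x then 1 else 0)"
      unfolding y z by (auto simp: mult_add_div_mod)
  qed
  also have "\<dots> = (if x = x' then \<Sum>i<D. cnj (u x k i) * u x k' i else 0)"
    using xx by (simp only: sum_mult_delta finite_lessThan lessThan_iff if_True)
  also have "\<dots> = (if y = z then 1 else 0)"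
    using orthonormalD[OF u[OF y(2)], of k k'] y z by auto
  finally show "(\<Sum>r<K * (K * D). cnj (?g y r) * ?g z r) = (if y = z then 1 else 0)" .
qed

text \<open>The code, its states and the norm condition are translated into the index form of
  \<open>privacy_bound\<close>; the correct-decoding blocks of the trace-norm difference supply its
  assumption \<open>close\<close>.\<close>

lemma good_code_bound:
  fixes p1 p2 p3 \<epsilon> \<theta> c :: real and dE n K :: nat and U :: "complex mat"
  defines "q \<equiv> p1 + p2 + p3"
  assumes p: "0 \<le> p1" "0 \<le> p2" "0 \<le> p3" "q \<le> 1"
    and ext: "isometric_extension (pauli_channel p1 p2 p3) 2 2 dE U"
    and good: "good_code 2 2 dE U n \<epsilon> (K, \<rho>, M)"
    and eps: "\<epsilon> \<le> 1" and \<theta>: "\<theta> \<ge> 0"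
  shows "(1 - \<epsilon>)\<^sup>2 \<le> exp (real n * c) / real K
    + ((1 - q) * exp (\<theta> * (ln (2 * (1 - q)) - c)) + q * exp (\<theta> * (ln (2 * q) - c))) ^ n"
proof -
  define d where "d = (2::nat) ^ n"
  define D where "D = dE ^ n"
  define A where "A = tens dE n (env_kraus dE U)"
  have U: "U \<in> carrier_mat (2 * dE) 2" using ext by (simp add: isometric_extension_def)
  \<comment> \<open>An environment of dimension 0 would turn \<open>adj U * U\<close> into the zero
    matrix.\<close>
  have dE: "dE > 0"
  proof (rule ccontr)
    assume "\<not> dE > 0"
    hence "(adj U * U) $$ (0,0) = 0" using U by (subst mat_mult_index[of _ 2 0 _ 2]) auto
    thus False using ext by (simp add: isometric_extension_def del: index_mult_mat(1))
  qed
  have K: "K > 0" and \<rho>: "\<And>x. x < K \<Longrightarrow> density d (\<rho> x)" and M: "\<And>x. x < K \<Longrightarrow> psd d (M x)"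
    and Msum: "matsum d d M {..<K} = 1\<^sub>m d"
    using good by (auto simp: good_code_def is_key_code_def d_def)
  have tn: "trace_norm (measured_state 2 dE U n (K, \<rho>, M) - ideal_state 2 dE U n (K, \<rho>, M)) < \<epsilon>"
    using good by (simp add: good_code_def)
  have \<rho>c: "\<rho> x \<in> carrier_mat d d" if "x < K" for x
    using \<rho>[OF that] by (simp add: density_def psd_def)
  have Mc: "M x \<in> carrier_mat d d" if "x < K" for x
    using M[OF that] by (simp add: psd_def)
  have "\<forall>x. \<exists>r. x < K \<longrightarrow> (\<forall>i<d. \<forall>j<d. \<rho> x $$ (i,j) = (\<Sum>k<d. r i k * cnj (r j k)))"
    using psd_factorization \<rho> unfolding density_def by metis
  from choice[OF this] obtain R
    where R': "\<forall>x. x < K \<longrightarrow> (\<forall>i<d. \<forall>j<d. \<rho> x $$ (i,j) = (\<Sum>k<d. R x i k * cnj (R x j k)))" by blast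
  hence R: "\<rho> x $$ (i,j) = (\<Sum>k<d. R x i k * cnj (R x j k))" if "x < K" "i < d" "j < d" for x i j
    using that by blast
  have "\<forall>x. \<exists>r. x < K \<longrightarrow> (\<forall>i<d. \<forall>j<d. M x $$ (i,j) = (\<Sum>k<d. r i k * cnj (r j k)))"
    using psd_factorization M by metis
  from choice[OF this] obtain S'
    where S': "\<forall>x. x < K \<longrightarrow> (\<forall>i<d. \<forall>j<d. M x $$ (i,j) = (\<Sum>k<d. S' x i k * cnj (S' x j k)))" by blast
  \<comment> \<open>Passing to the conjugate transpose makes the POVM element the adjoint of S times
    S, so that its form at a vector is the squared length of the image under S.\<close>
  define S where "S x c b = cnj (S' x b c)" for x c b
  have S: "M x $$ (k,l) = (\<Sum>c<d. cnj (S x c k) * S x c l)" if "x < K" "k < d" "l < d" for x k l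
    using S' that by (simp add: S_def)
  \<comment> \<open>For q = 0 every probability vector fits the weights; the first unit vector is
    taken.\<close>
  define r where "r i = (if q = 0 then (if i = 0 then 1 else 0)
    else (if i = 0 then p1 else if i = 1 then p2 else p3) / q)" for i :: nat
  have q0: "0 \<le> q" using p by (simp add: q_def)
  have r: "\<And>i. 0 \<le> r i" "r 0 + r 1 + r 2 = 1"
    using p q0 by (auto simp: r_def add_divide_distrib[symmetric] q_def[symmetric])
  have qr: "q * r 0 = p1" "q * r 1 = p2" "q * r 2 = p3"
    using p by (auto simp: r_def q_def)
  have choi: "(\<Sum>e<dE. env_kraus dE U e b a * cnj (env_kraus dE U e b' a'))
      = (\<Sum>s<4. complex_of_real (if s = 0 then 1 - q else q * r (s - 1)) * (pauli s b a * cnj (pauli s b' a')))"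
    if "b < 2" "a < 2" "b' < 2" "a' < 2" for b a b' a'
  proof -
    have w: "(\<Sum>s<4. complex_of_real (if s = 0 then 1 - q else q * r (s - 1)) * (pauli s b a * cnj (pauli s b' a')))
      = complex_of_real (1 - q) * (pauli 0 b a * cnj (pauli 0 b' a'))
        + complex_of_real (q * r 0) * (pauli (Suc 0) b a * cnj (pauli (Suc 0) b' a'))
        + complex_of_real (q * r (Suc 0)) * (pauli 2 b a * cnj (pauli 2 b' a'))
        + complex_of_real (q * r 2) * (pauli 3 b a * cnj (pauli 3 b' a'))"
      by (simp add: sum_lessThan_2_4_6)
    show ?thesis
      unfolding w isometric_extension_choi[OF ext that] using qr by (simp add: q_def)
  qed
  have povm: "(\<Sum>x<K. \<Sum>c<d. (cmod (\<Sum>b<d. S x c b * v b))\<^sup>2) = (\<Sum>b<d. (cmod (v b))\<^sup>2)" for v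
  proof -
    have "complex_of_real (\<Sum>x<K. \<Sum>c<d. (cmod (\<Sum>b<d. S x c b * v b))\<^sup>2)
        = (\<Sum>x<K. complex_of_real (\<Sum>c<d. (cmod (\<Sum>b<d. v b * S x c b))\<^sup>2))"
      by (simp add: mult.commute)
    also have "\<dots> = (\<Sum>x<K. \<Sum>b<d. \<Sum>b'<d. v b * cnj (v b') * M x $$ (b',b))"
      unfolding norm_sq_linear_combination by (intro sum.cong refl) (simp add: S)
    also have "\<dots> = (\<Sum>b<d. \<Sum>b'<d. \<Sum>x<K. v b * cnj (v b') * M x $$ (b',b))"
      by (rule sum_rotate3[symmetric])
    also have "\<dots> = (\<Sum>b<d. \<Sum>b'<d. v b * cnj (v b') * (if b' = b then 1 else 0))"
    proof (intro sum.cong refl)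
      fix b b' assume b: "b \<in> {..<d}" "b' \<in> {..<d}"
      have "(\<Sum>x<K. M x $$ (b',b)) = (if b' = b then 1 else 0)"
        using arg_cong[OF Msum, of "\<lambda>X. X $$ (b',b)"] b by (simp add: matsum_def)
      thus "(\<Sum>x<K. v b * cnj (v b') * M x $$ (b',b)) = v b * cnj (v b') * (if b' = b then 1 else 0)"
        by (simp only: sum_distrib_left[symmetric])
    qed
    also have "\<dots> = (\<Sum>b<d. v b * cnj (v b))"
      by (simp only: sum_mult_delta finite_lessThan) (intro sum.cong refl, simp)
    also have "\<dots> = complex_of_real (\<Sum>b<d. (cmod (v b))\<^sup>2)"
      by (simp add: complex_norm_square[symmetric])
    finally show ?thesis using of_real_eq_iff by blast
  qed
  have dens: "(\<Sum>k<d. \<Sum>a<d. (cmod (R x a k))\<^sup>2) = 1" if x: "x < K" for x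
  proof -
    have "complex_of_real (\<Sum>k<d. \<Sum>a<d. (cmod (R x a k))\<^sup>2) = (\<Sum>a<d. \<Sum>k<d. R x a k * cnj (R x a k))"
      by (subst sum.swap) (simp only: of_real_sum complex_norm_square)
    also have "\<dots> = (\<Sum>a<d. \<rho> x $$ (a,a))" by (simp add: R x)
    also have "\<dots> = 1" using \<rho>[OF x] \<rho>c[OF x] by (simp add: density_def mtrace_def)
    finally show ?thesis by (metis of_real_eq_1_iff)
  qed
  let ?Q = "{..<d} \<times> {..<d}"
  let ?out = "\<lambda>x. out_state 2 dE U n (\<rho> x)"
  have outc: "?out x \<in> carrier_mat (d * D) (d * D)" if "x < K" for x
    using out_state_carrier[OF U, of "\<rho> x" n] \<rho>c[OF that] by (simp add: d_def D_def)
  have out: "?out x $$ (b * D + e, b' * D + e') = (\<Sum>a<d. \<Sum>a'<d. A e b a * \<rho> x $$ (a,a') * cnj (A e' b' a'))"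
    if "x < K" "b < d" "b' < d" "e < D" "e' < D" for x b b' e e'
    using out_state_index[OF U dE, of "\<rho> x" n b b' e e'] \<rho>c[OF that(1)] that by (simp add: d_def D_def A_def)
  define \<omega> where "\<omega> x i j = (\<Sum>p\<in>?Q. sandwich d (S x) (R x) (A i) p * cnj (sandwich d (S x) (R x) (A j) p))" for x i j
  define \<omega>0 where "\<omega>0 i j = (\<Sum>x<K. \<Sum>p\<in>?Q. (\<Sum>a<d. A i (fst p) a * R x a (snd p)) * cnj (\<Sum>a<d. A j (fst p) a * R x a (snd p)))
     / of_nat K" for i j
  have meas: "ptrace1 d D (kron (M x) (1\<^sub>m D) * ?out x) $$ (i,j) = \<omega> x i j" if "x < K" "i < D" "j < D" for x i j
  proof -
    have "ptrace1 d D (kron (M x) (1\<^sub>m D) * ?out x) $$ (i,j)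
        = (\<Sum>k<d. \<Sum>l<d. M x $$ (k,l) * ?out x $$ (l * D + i, k * D + j))"
      by (rule ptrace1_kron_mult[OF Mc[OF that(1)] outc[OF that(1)] that(2,3)])
    also have "\<dots> = (\<Sum>k<d. \<Sum>l<d. M x $$ (k,l) * (\<Sum>a<d. \<Sum>a'<d. A i l a * \<rho> x $$ (a,a') * cnj (A j k a')))"
      using that by (intro sum.cong refl) (simp add: out)
    also have "\<dots> = \<omega> x i j"
      unfolding \<omega>_def by (rule sandwich_gram) (use S R that in simp_all)
    finally show ?thesis .
  qed
  have env: "env_state 2 dE U n (K, \<rho>, M) $$ (i,j) = \<omega>0 i j" if "i < D" "j < D" for i j
  proof -
    have "env_state 2 dE U n (K, \<rho>, M) $$ (i,j) = (\<Sum>x<K. complex_of_real (1 / real K) * ptrace1 d D (?out x) $$ (i,j))"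
      using that by (simp add: env_state_def matsum_def d_def D_def ptrace1_def)
    also have "\<dots> = (\<Sum>x<K. ptrace1 d D (?out x) $$ (i,j)) / of_nat K"
      by (simp add: sum_divide_distrib)
    also have "(\<Sum>x<K. ptrace1 d D (?out x) $$ (i,j))
        = (\<Sum>x<K. \<Sum>p\<in>?Q. (\<Sum>a<d. A i (fst p) a * R x a (snd p)) * cnj (\<Sum>a<d. A j (fst p) a * R x a (snd p)))"
    proof (rule sum.cong[OF refl])
      fix x assume "x \<in> {..<K}"
      hence x: "x < K" by simp
      have "ptrace1 d D (?out x) $$ (i,j) = (\<Sum>b<d. \<Sum>a<d. \<Sum>a'<d. A i b a * \<rho> x $$ (a,a') * cnj (A j b a'))"
        using that x by (simp add: ptrace1_def out)
      also have "\<dots> = (\<Sum>p\<in>?Q. (\<Sum>a<d. A i (fst p) a * R x a (snd p)) * cnj (\<Sum>a<d. A j (fst p) a * R x a (snd p)))"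
        by (rule density_gram) (rule R[OF x])
      finally show "ptrace1 d D (?out x) $$ (i,j)
        = (\<Sum>p\<in>?Q. (\<Sum>a<d. A i (fst p) a * R x a (snd p)) * cnj (\<Sum>a<d. A j (fst p) a * R x a (snd p)))" .
    qed
    finally show ?thesis by (simp add: \<omega>0_def)
  qed
  define \<Delta> where "\<Delta> = measured_state 2 dE U n (K, \<rho>, M) - ideal_state 2 dE U n (K, \<rho>, M)"
  let ?N = "K * (K * D)"
  have \<Delta>c: "\<Delta> \<in> carrier_mat ?N ?N"
    by (rule carrier_matI) (simp_all add: \<Delta>_def ideal_state_def matsum_def D_def)
  \<comment> \<open>Both states carry the factor 1 / K of the uniform message; it reappears as the
    factor \<open>real K\<close> on the right of \<open>close\<close>.\<close>
  have block: "\<Delta> $$ ((x * K + x) * D + i, (x * K + x) * D + j) = (\<omega> x i j - \<omega>0 i j) / of_nat K"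
    if x: "x < K" and ij: "i < D" "j < D" for x i j
  proof -
    let ?i = "(x * K + x) * D + i" and ?j = "(x * K + x) * D + j"
    have lt: "?i < ?N" "?j < ?N" using block_index(3)[OF x x] ij by auto
    have pc: "ptrace1 d D Y \<in> carrier_mat D D" for Y by (simp add: ptrace1_def)
    have ec: "env_state 2 dE U n (K, \<rho>, M) \<in> carrier_mat D D" by (simp add: env_state_def matsum_def D_def)
    have kd: "dim_row (kron (proj K y) (kron (proj K z) T)) = ?N" "dim_col (kron (proj K y) (kron (proj K z) T)) = ?N"
      if "T \<in> carrier_mat D D" for y z T
      using that by (simp_all add: kron_def proj_def)
    have "measured_state 2 dE U n (K, \<rho>, M) $$ (?i, ?j)
        = (\<Sum>(y,z)\<in>{..<K} \<times> {..<K}. complex_of_real (1 / real K) *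
            kron (proj K y) (kron (proj K z) (ptrace1 d D (kron (M z) (1\<^sub>m D) * ?out y))) $$ (?i, ?j))"
      using lt by (simp add: measured_state_def matsum_def d_def[symmetric] D_def[symmetric] case_prod_beta kd[OF pc])
    also have "\<dots> = (\<Sum>y\<in>{..<K} \<times> {..<K}. complex_of_real (1 / real K) * \<omega> x i j * (if y = (x,x) then 1 else 0))"
      by (intro sum.cong refl) (auto simp: kron_proj_block[OF pc x ij] meas[OF x ij] split: if_splits)
    also have "\<dots> = complex_of_real (1 / real K) * \<omega> x i j"
      unfolding sum_mult_delta(1)[OF finite_cartesian_product[OF finite_lessThan finite_lessThan]] using x by simp
    finally have 1: "measured_state 2 dE U n (K, \<rho>, M) $$ (?i, ?j) = complex_of_real (1 / real K) * \<omega> x i j" .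
    have "ideal_state 2 dE U n (K, \<rho>, M) $$ (?i, ?j)
        = (\<Sum>y<K. complex_of_real (1 / real K) *
            kron (proj K y) (kron (proj K y) (env_state 2 dE U n (K, \<rho>, M))) $$ (?i, ?j))"
      using lt by (simp add: ideal_state_def matsum_def D_def[symmetric] kd[OF ec])
    also have "\<dots> = (\<Sum>y<K. complex_of_real (1 / real K) * \<omega>0 i j * (if y = x then 1 else 0))"
      by (intro sum.cong refl) (auto simp: kron_proj_block[OF ec x ij] env[OF ij])
    also have "\<dots> = complex_of_real (1 / real K) * \<omega>0 i j"
      unfolding sum_mult_delta(1)[OF finite_lessThan] using x by simp
    finally have 2: "ideal_state 2 dE U n (K, \<rho>, M) $$ (?i, ?j) = complex_of_real (1 / real K) * \<omega>0 i j" .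
    have "\<Delta> $$ (?i, ?j) = measured_state 2 dE U n (K, \<rho>, M) $$ (?i, ?j) - ideal_state 2 dE U n (K, \<rho>, M) $$ (?i, ?j)"
      unfolding \<Delta>_def using lt by (intro index_minus_mat(1)) (simp_all add: ideal_state_def matsum_def D_def)
    thus ?thesis unfolding 1 2 by (simp add: diff_divide_distrib)
  qed
  have close: "(\<Sum>x<K. \<Sum>k<D. cmod (qform D (\<lambda>i j. \<omega> x i j - \<omega>0 i j) (u x k))) \<le> real K * \<epsilon>"
    if u: "\<And>x. x < K \<Longrightarrow> orthonormal {..<D} {..<D} (u x)" for u
  proof -
    let ?g = "\<lambda>y r. if r div D = fst y * K + fst y then u (fst y) (snd y) (r mod D) else 0"
    have bl: "qform ?N (\<lambda>i j. \<Delta> $$ (i,j)) (?g (x,k)) = qform D (\<lambda>i j. (\<omega> x i j - \<omega>0 i j) / of_nat K) (u x k)"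
      if "x < K" for x k
      unfolding fst_conv snd_conv
      by (rule block_embedding_qform[where T="\<lambda>x i j. (\<omega> x i j - \<omega>0 i j) / of_nat K", OF block that])
    have scale: "cmod (qform D (\<lambda>i j. (\<omega> x i j - \<omega>0 i j) / of_nat K) v) = cmod (qform D (\<lambda>i j. \<omega> x i j - \<omega>0 i j) v) / real K" for x v
    proof -
      have "qform D (\<lambda>i j. (\<omega> x i j - \<omega>0 i j) / of_nat K) v = qform D (\<lambda>i j. \<omega> x i j - \<omega>0 i j) v / of_nat K"
        by (simp add: qform_def sum_divide_distrib)
      thus ?thesis by (simp add: norm_divide)
    qed
    have "(\<Sum>x<K. \<Sum>k<D. cmod (qform D (\<lambda>i j. \<omega> x i j - \<omega>0 i j) (u x k))) / real K
        = (\<Sum>x<K. \<Sum>k<D. cmod (qform ?N (\<lambda>i j. \<Delta> $$ (i,j)) (?g (x,k))))"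
      unfolding sum_divide_distrib by (intro sum.cong refl) (simp only: bl scale lessThan_iff)
    also have "\<dots> = (\<Sum>y\<in>{..<K} \<times> {..<D}. cmod (qform ?N (\<lambda>i j. \<Delta> $$ (i,j)) (?g y)))"
      unfolding sum.cartesian_product by (intro sum.cong refl) auto
    also have "\<dots> \<le> trace_norm \<Delta>"
      by (rule qform_le_trace_norm[OF \<Delta>c _ block_embedding_orthonormal[OF u]]) auto
    also have "\<dots> \<le> \<epsilon>" using tn by (simp add: \<Delta>_def)
    finally show ?thesis using K by (simp add: divide_le_eq mult.commute)
  qed
  show ?thesis
    using privacy_bound[where K=K and \<epsilon>=\<epsilon> and q=q and r=r and \<theta>=\<theta> and dE=dE and U="env_kraus dE U" and n=n and c=c
        and S=S and R=R, folded d_def D_def A_def, OF K eps q0 p(4) r \<theta> choi povm dens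
        close[unfolded \<omega>_def \<omega>0_def]] by blast
qed

section \<open>Asymptotics\<close>

text \<open>At \<theta> = 0 the sum equals 1, and its derivative there is the mean log-likelihood
  ratio minus \<open>c\<close>, which is - \<delta> ln 2. Hence every sufficiently small positive
  \<theta> works.\<close>

lemma chernoff_exponent:
  fixes q \<delta> :: real
  assumes q: "0 \<le> q" "q \<le> 1" and \<delta>: "\<delta> > 0"
  defines "c \<equiv> (1 - bin_entropy q + \<delta>) * ln 2"
  obtains \<theta> where "\<theta> > 0"
    "(1 - q) * exp (\<theta> * (ln (2 * (1 - q)) - c)) + q * exp (\<theta> * (ln (2 * q) - c)) < 1"
proof -
  define F where "F \<theta> = (1 - q) * exp (\<theta> * (ln (2 * (1 - q)) - c)) + q * exp (\<theta> * (ln (2 * q) - c))" for \<theta>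
  \<comment> \<open>The mean of the log-likelihood ratio. At the end points both sides are ln 2,
    because the logarithms of 0 have vanishing prefactors.\<close>
  have ent: "(1 - q) * ln (2 * (1 - q)) + q * ln (2 * q) = (1 - bin_entropy q) * ln 2"
  proof (cases "q = 0 \<or> q = 1")
    case False
    hence "0 < q" "q < 1" using q by auto
    hence l: "ln (2 * (1 - q)) = ln 2 + ln (1 - q)" "ln (2 * q) = ln 2 + ln q"
      using ln_mult_pos[of 2 "1 - q"] ln_mult_pos[of 2 q] by simp_all
    have "(1 - bin_entropy q) * ln 2 = ln 2 + q * ln q + (1 - q) * ln (1 - q)"
      by (simp add: bin_entropy_def log_def field_simps)
    thus ?thesis unfolding l by (simp add: algebra_simps)
  qed (auto simp: bin_entropy_def)
  have slope: "(1 - q) * (ln (2 * (1 - q)) - c) + q * (ln (2 * q) - c) = - \<delta> * ln 2"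
  proof -
    have "(1 - q) * (ln (2 * (1 - q)) - c) + q * (ln (2 * q) - c)
        = (1 - q) * ln (2 * (1 - q)) + q * ln (2 * q) - c" by (simp add: algebra_simps)
    thus ?thesis unfolding ent c_def by (simp add: algebra_simps)
  qed
  have "((\<lambda>\<theta>. (1 - q) * exp (\<theta> * a) + q * exp (\<theta> * b)) has_real_derivative (1 - q) * a + q * b) (at 0)" for a b
    by (auto intro!: derivative_eq_intros)
  hence "(F has_real_derivative - \<delta> * ln 2) (at 0)"
    unfolding F_def[abs_def] slope[symmetric] .
  moreover have "- \<delta> * ln 2 < 0" using \<delta> by simp
  ultimately obtain e where e: "e > 0" "\<And>h. 0 < h \<Longrightarrow> h < e \<Longrightarrow> F (0 + h) < F 0"
    using DERIV_neg_dec_right[of F "- \<delta> * ln 2" 0] by blast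
  have "F (e / 2) < F 0" using e(2)[of "e / 2"] e(1) by simp
  thus ?thesis using that[of "e / 2"] e(1) by (simp add: F_def)
qed

theorem theorem12:
  fixes p1 p2 p3 :: real and dE :: nat and U :: "complex mat"
  assumes "p1 \<ge> 0" and "p2 \<ge> 0" and "p3 \<ge> 0" and "p1 + p2 + p3 \<le> 1"
    and "isometric_extension (pauli_channel p1 p2 p3) 2 2 dE U"
  shows "private_capacity 2 2 dE U \<le> ereal (1 - bin_entropy (p1 + p2 + p3))"
  unfolding private_capacity_def
proof (rule Sup_least)
  fix y assume "y \<in> {ereal R | R. achievable_private_rate 2 2 dE U R}"
  then obtain R where y: "y = ereal R" and R: "achievable_private_rate 2 2 dE U R" by blast
  define q where "q = p1 + p2 + p3"
  have q: "0 \<le> q" "q \<le> 1" using assms by (simp_all add: q_def)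
  have "R \<le> 1 - bin_entropy q"
  proof (rule ccontr)
    assume "\<not> R \<le> 1 - bin_entropy q"
    \<comment> \<open>A third of the gap: threshold \<open>c\<close>, rate \<open>m\<close> and
      assumed rate \<open>R\<close> lie one, two and three steps above the bound. The steps pay for
      the Chernoff decay, for the decay of exp (n c) / K, and for the passage from the limit
      inferior to single n.\<close>
    define \<delta> where "\<delta> = (R - (1 - bin_entropy q)) / 3"
    have \<delta>: "\<delta> > 0" using \<open>\<not> R \<le> 1 - bin_entropy q\<close> by (simp add: \<delta>_def)
    have R\<delta>: "R = 1 - bin_entropy q + 3 * \<delta>" by (simp add: \<delta>_def field_simps)
    define c where "c = (1 - bin_entropy q + \<delta>) * ln 2"
    obtain \<theta> where \<theta>: "\<theta> > 0"
      and \<phi>1: "(1 - q) * exp (\<theta> * (ln (2 * (1 - q)) - c)) + q * exp (\<theta> * (ln (2 * q) - c)) < 1"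
      using chernoff_exponent[OF q \<delta>] unfolding c_def by blast
    define \<phi> where "\<phi> = (1 - q) * exp (\<theta> * (ln (2 * (1 - q)) - c)) + q * exp (\<theta> * (ln (2 * q) - c))"
    have \<phi>: "0 \<le> \<phi>" "\<phi> < 1" using \<phi>1 q by (simp_all add: \<phi>_def)
    \<comment> \<open>Any fixed \<epsilon> strictly between 0 and 1 would lead to a contradiction;
      1/4 gives the lower bound 9/16.\<close>
    obtain C N where good: "\<And>n. n \<ge> N \<Longrightarrow> good_code 2 2 dE U n (1/4) (C n)"
      and rate: "ereal R \<le> liminf (\<lambda>n. ereal (log 2 (real (fst (C n))) / real n))"
      using R[unfolded achievable_private_rate_def, rule_format, of "1/4"] by auto
    define m where "m = 1 - bin_entropy q + 2 * \<delta>"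
    have "ereal m < ereal R" using \<delta> by (simp add: m_def R\<delta>)
    hence "eventually (\<lambda>n. ereal m < ereal (log 2 (real (fst (C n))) / real n)) sequentially"
      using rate by (intro less_LiminfD) (rule less_le_trans)
    hence ev: "eventually (\<lambda>n. m < log 2 (real (fst (C n))) / real n) sequentially" by simp
    have "(\<lambda>n. exp (- \<delta> * ln 2) ^ n + \<phi> ^ n) \<longlonglongrightarrow> 0 + 0"
      using \<delta> \<phi> by (intro tendsto_add LIMSEQ_realpow_zero) auto
    hence "eventually (\<lambda>n. exp (- \<delta> * ln 2) ^ n + \<phi> ^ n < 9/16) sequentially"
      by (intro order_tendstoD(2)[where a = "9/16"]) auto
    \<comment> \<open>The condition 1 \<le> n makes the division by n in the rate genuine, so that
      it can be cleared below.\<close>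
    with ev have "eventually (\<lambda>n. m < log 2 (real (fst (C n))) / real n \<and> exp (- \<delta> * ln 2) ^ n + \<phi> ^ n < 9/16
        \<and> N \<le> n \<and> 1 \<le> n) sequentially"
      using eventually_ge_at_top[of N] eventually_ge_at_top[of 1] by eventually_elim simp
    then obtain n where n: "m < log 2 (real (fst (C n))) / real n" "exp (- \<delta> * ln 2) ^ n + \<phi> ^ n < 9/16"
      "N \<le> n" "1 \<le> n"
      using eventually_happens'[OF sequentially_bot] by blast
    obtain K \<rho> M where C: "C n = (K, \<rho>, M)" by (cases "C n")
    have gc: "good_code 2 2 dE U n (1/4) (K, \<rho>, M)" using good[OF n(3)] C by simp
    hence K: "K > 0" by (auto simp: good_code_def is_key_code_def)
    have "(1 - 1/4)\<^sup>2 \<le> exp (real n * c) / real K + \<phi> ^ n"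
      unfolding \<phi>_def q_def
      by (rule good_code_bound[OF assms(1-5) gc]) (use \<theta> in auto)
    moreover have "exp (real n * c) / real K \<le> exp (- \<delta> * ln 2) ^ n"
    proof -
      have "real n * m < ln (real K) / ln 2"
        using n(1,4) C by (simp add: log_def less_divide_eq mult.commute)
      hence "real n * m * ln 2 < ln (real K)" by (simp add: less_divide_eq)
      hence "exp (real n * m * ln 2) \<le> real K"
        using K by (metis exp_less_mono exp_ln less_imp_le of_nat_0_less_iff)
      moreover have "exp (real n * c) = exp (- \<delta> * ln 2) ^ n * exp (real n * m * ln 2)"
        by (simp add: exp_of_nat_mult[symmetric] exp_add[symmetric] c_def m_def algebra_simps)
      ultimately show ?thesis using K by (simp add: divide_le_eq)
    qed
    moreover have "(1 - 1/4)\<^sup>2 = (9/16 :: real)" by (simp add: power2_eq_square)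
    ultimately show False using n(2) by linarith
  qed
  thus "y \<le> ereal (1 - bin_entropy (p1 + p2 + p3))" by (simp add: y q_def)
qed

end
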